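(* Let $A\in\mathbb{R}_+^{n\times n}$. Then, both in max algebra and in nonnegative algebra: (i) for each $\rho\in\Lambda(A)$, $\sigma_{\rho}$ is the period of the sequence $\{V(A^k,\rho^k)\}_{k\geq 1}$, and $V(A^k,\rho^k)\subseteq V(A^{\sigma_{\rho}},\rho^{\sigma_{\rho}})$ for all $k\geq 1$; (ii) $\sigma_{\Lambda}$ is the period of the sequence $\{V^{\Sigma}(A^k)\}_{k\geq 1}$, and $V^{\Sigma}(A^k)\subseteq V^{\Sigma}(A^{\sigma_{\Lambda}})$ for all $k\geq 1$.
   Context: The statement is asserted in each of two settings. Nonnegative algebra: the semiring $\mathbb{R}_+=[0,\infty)$ with usual addition and multiplication. Max algebra: $\mathbb{R}_+$ with addition $a\oplus b=\max(a,b)$ and usual multiplication. Sums, matrix products $Ax$ and powers $A^k$ are taken in the algebra considered (in max algebra $(A\otimes B)_{ij}=\max_k a_{ik}b_{kj}$ and $A^k$ is the $k$-th max-algebraic power). Period: a sequence $\{\Omega_k\}_{k\ge1}$ is periodic if there is a positive integer $p$ with $\Omega_{k+p}=\Omega_k$ for all $k\ge1$; the least such $p$ is its period. Eigencones: $\rho\in\mathbb{R}_+$ is an eigenvalue of $A$ if $Ax=\rho x$ for some nonzero $x\in\mathbb{R}_+^n$; $V(A,\rho)=\{x\in\mathbb{R}_+^n: Ax=\rho x\}$; $\Lambda(A)$ is the set of nonzero eigenvalues; $V^{\Sigma}(A)=\sum_{\rho\in\Lambda(A)}V(A,\rho)$ (set of all sums of elements), equal to $\{0\}$ if $\Lambda(A)=\emptyset$.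 Classes: $\mathcal{G}(A)$ is the weighted digraph on $\{1,\dots,n\}$ with an edge $(i,j)$ of weight $a_{ij}$ iff $a_{ij}\ne0$. The classes $\mu$ of $A$ correspond to the strongly connected components of $\mathcal{G}(A)$ (an isolated node without a loop counts as a component), with node sets $N_\mu$; $A_{\mu\mu}$ is the corresponding (irreducible) principal submatrix and its unique eigenvalue in the algebra considered is the Perron root $\rho_\mu$. Class $\mu$ accesses class $\nu$ ($\mu\to\nu$) if $\mu=\nu$ or there is a path in $\mathcal{G}(A)$ from a node of $\mu$ to a node of $\nu$; a node accesses $\nu$ if its class does. A class $\nu$ is spectral, associated with $\rho\neq0$ (or $(A,\rho)$-spectral), if $\rho_\nu=\rho$ and: in max algebra, $\mu\to\nu$ implies $\rho_\mu\le\rho_\nu$; in nonnegative algebra, $\mu\to\nu$, $\mu\ne\nu$ implies $\rho_\mu<\rho_\nu$. Cyclicity: the cyclicity of a strongly connected graph is the gcd of the lengths of its elementary cycles ($1$ for a single node without edges); for a graph with several strongly connected components it is the lcm of their cyclicities. The cyclicity of a class $\mu$ is that of $\mathcal{G}(A_{\mu\mu})$. Critical graph (max algebra only): for a matrix $B$, $\lambda(B)$ is the maximum over cycles $C$ of $\mathcal{G}(B)$ of $w(C)^{1/l(C)}$ ($w$ = product of edge weights, $l$ = length), and the critical graph $\mathcal{C}(B)$ consists of all nodes and edges on cycles attaining this maximum. For $\rho\in\Lambda(A)$ let $M_\rho$ be the set of indices accessing some $(A,\rho)$-spectral class, and let $A_\rho$ be the $n\times n$ matrix with entries $\rho^{-1}a_{ij}$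 for $i,j\in M_\rho$ and $0$ otherwise. The critical graph associated with $\rho$ is $\mathcal{C}(A_\rho)$. Numbers $\sigma$: for $\rho\in\Lambda(A)$, $\sigma_\rho$ is, in nonnegative algebra, the lcm of the cyclicities of all spectral classes associated with $\rho$, and, in max algebra, the cyclicity of the critical graph associated with $\rho$. $\sigma_\Lambda$ is the lcm of all $\sigma_\rho$, $\rho\in\Lambda(A)$ (the empty lcm being $1$). *)

theory Defs
  imports "HOL-Analysis.Analysis"
begin

datatype algebra = Nonneg_Algebra | Max_Algebra

text \<open>
  Finite sums in the algebra. In max algebra the neutral element of addition is \<open>0\<close>; inserting it
  gives the empty sum its value and changes nothing else, as all summands are nonnegative.
\<close>

fun alg_sum :: "algebra \<Rightarrow> ('i \<Rightarrow> real) \<Rightarrow> 'i set \<Rightarrow> real" where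
  "alg_sum Nonneg_Algebra f I = sum f I"
| "alg_sum Max_Algebra f I = Max (insert 0 (f ` I))"

definition alg_mult :: "algebra \<Rightarrow> real^'n^'n \<Rightarrow> real^'n^'n \<Rightarrow> real^'n^'n" where
  "alg_mult alg A B = (\<chi> i j. alg_sum alg (\<lambda>k. A $ i $ k * B $ k $ j) UNIV)"

definition alg_mult_vec :: "algebra \<Rightarrow> real^'n^'n \<Rightarrow> real^'n \<Rightarrow> real^'n" where
  "alg_mult_vec alg A x = (\<chi> i. alg_sum alg (\<lambda>j. A $ i $ j * x $ j) UNIV)"

lemma alg_mult_Nonneg: "alg_mult Nonneg_Algebra A B = A ** B"
  by (simp add: alg_mult_def matrix_matrix_mult_def)

lemma alg_mult_vec_Nonneg: "alg_mult_vec Nonneg_Algebra A x = A *v x"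
  by (simp add: alg_mult_vec_def matrix_vector_mult_def)

text \<open>The matrix \<open>mat 1\<close> is the identity of both algebras.\<close>

primrec alg_power :: "algebra \<Rightarrow> real^'n^'n \<Rightarrow> nat \<Rightarrow> real^'n^'n" where
  "alg_power alg A 0 = mat 1"
| "alg_power alg A (Suc k) = alg_mult alg A (alg_power alg A k)"

definition nonneg_mat :: "real^'n^'n \<Rightarrow> bool" where
  "nonneg_mat A \<longleftrightarrow> (\<forall>i j. 0 \<le> A $ i $ j)"

definition nonneg_vec :: "real^'n \<Rightarrow> bool" where
  "nonneg_vec x \<longleftrightarrow> (\<forall>i. 0 \<le> x $ i)"

definition eigencone :: "algebra \<Rightarrow> real^'n^'n \<Rightarrow> real \<Rightarrow> (real^'n) set" where
  "eigencone alg A \<rho> = {x. nonneg_vec x \<and> alg_mult_vec alg A x = \<rho> *\<^sub>R x}"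

definition eigval :: "algebra \<Rightarrow> real^'n^'n \<Rightarrow> real \<Rightarrow> bool" where
  "eigval alg A \<rho> \<longleftrightarrow> 0 \<le> \<rho> \<and> (\<exists>x \<in> eigencone alg A \<rho>. x \<noteq> 0)"

definition nonzero_eigvals :: "algebra \<Rightarrow> real^'n^'n \<Rightarrow> real set" where
  "nonzero_eigvals alg A = {\<rho>. eigval alg A \<rho> \<and> \<rho> \<noteq> 0}"

text \<open>
  The sum of the eigencones of all nonzero eigenvalues. Taking finite index sets \<open>F\<close> makes the
  definition meaningful without knowing that there are finitely many eigenvalues; as
  \<open>0\<close> lies in every eigencone, for finitely many eigenvalues one may take \<open>F\<close> to be all of them.
\<close>

definition eigencone_sum :: "algebra \<Rightarrow> real^'n^'n \<Rightarrow> (real^'n) set" where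
  "eigencone_sum alg A =
     {(\<chi> i. alg_sum alg (\<lambda>\<rho>. x \<rho> $ i) F) | x F.
        finite F \<and> F \<subseteq> nonzero_eigvals alg A \<and> (\<forall>\<rho>\<in>F. x \<rho> \<in> eigencone alg A \<rho>)}"

text \<open>
  A digraph is given by a node set \<open>V\<close> and an edge relation \<open>E \<subseteq> V \<times> V\<close>. The nonempty list
  \<open>[v\<^sub>0, \<dots>, v\<^sub>l]\<close> stands for the closed walk \<open>v\<^sub>0 \<rightarrow> \<dots> \<rightarrow> v\<^sub>l \<rightarrow> v\<^sub>0\<close>, of length \<open>l + 1\<close>.
\<close>

definition cycle_edges :: "'a list \<Rightarrow> 'a rel" where
  "cycle_edges c = {(c ! t, c ! (Suc t mod length c)) | t. t < length c}"

definition is_cycle :: "'a rel \<Rightarrow> 'a list \<Rightarrow> bool" where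
  "is_cycle E c \<longleftrightarrow> c \<noteq> [] \<and> cycle_edges c \<subseteq> E"

definition elementary_cycle :: "'a rel \<Rightarrow> 'a list \<Rightarrow> bool" where
  "elementary_cycle E c \<longleftrightarrow> is_cycle E c \<and> distinct c"

definition components :: "'a set \<Rightarrow> 'a rel \<Rightarrow> 'a set set" where
  "components V E = V // {(i, j). i \<in> V \<and> j \<in> V \<and> (i, j) \<in> E\<^sup>* \<and> (j, i) \<in> E\<^sup>*}"

text \<open>
  A strongly connected digraph without edges is a single node. The case distinction is needed
  because \<open>Gcd {} = 0\<close>.
\<close>

definition sc_cyclicity :: "'a rel \<Rightarrow> nat" where
  "sc_cyclicity E = (if E = {} then 1 else Gcd {length c | c. elementary_cycle E c})"

definition cyclicity :: "'a set \<Rightarrow> 'a rel \<Rightarrow> nat" where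
  "cyclicity V E = Lcm {sc_cyclicity (Restr E N) | N. N \<in> components V E}"

definition mat_edges :: "real^'n^'n \<Rightarrow> 'n rel" where
  "mat_edges A = {(i, j). A $ i $ j \<noteq> 0}"

text \<open>Classes are represented by their node sets.\<close>

definition classes :: "real^'n^'n \<Rightarrow> 'n set set" where
  "classes A = components UNIV (mat_edges A)"

definition accesses :: "real^'n^'n \<Rightarrow> 'n set \<Rightarrow> 'n set \<Rightarrow> bool" where
  "accesses A \<mu> \<nu> \<longleftrightarrow> \<mu> = \<nu> \<or> (\<exists>i\<in>\<mu>. \<exists>j\<in>\<nu>. (i, j) \<in> (mat_edges A)\<^sup>+)"

definition node_accesses :: "real^'n^'n \<Rightarrow> 'n \<Rightarrow> 'n set \<Rightarrow> bool" where
  "node_accesses A i \<nu> \<longleftrightarrow> (\<exists>\<mu>\<in>classes A. i \<in> \<mu> \<and> accesses A \<mu> \<nu>)"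

text \<open>
  Eigenvalues of the principal submatrix with index set \<open>N\<close>; the components of \<open>x\<close> outside \<open>N\<close> play
  no role.
\<close>

definition submatrix_eigval :: "algebra \<Rightarrow> real^'n^'n \<Rightarrow> 'n set \<Rightarrow> real \<Rightarrow> bool" where
  "submatrix_eigval alg A N \<rho> \<longleftrightarrow> 0 \<le> \<rho> \<and>
     (\<exists>x :: real^'n. (\<forall>i\<in>N. 0 \<le> x $ i) \<and> (\<exists>i\<in>N. x $ i \<noteq> 0) \<and>
        (\<forall>i\<in>N. alg_sum alg (\<lambda>j. A $ i $ j * x $ j) N = \<rho> * x $ i))"

definition perron_root :: "algebra \<Rightarrow> real^'n^'n \<Rightarrow> 'n set \<Rightarrow> real" where
  "perron_root alg A \<mu> = (THE \<rho>. submatrix_eigval alg A \<mu> \<rho>)"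

fun dominates :: "algebra \<Rightarrow> real^'n^'n \<Rightarrow> 'n set \<Rightarrow> bool" where
  "dominates Nonneg_Algebra A \<nu> \<longleftrightarrow>
     (\<forall>\<mu>\<in>classes A. accesses A \<mu> \<nu> \<and> \<mu> \<noteq> \<nu> \<longrightarrow>
        perron_root Nonneg_Algebra A \<mu> < perron_root Nonneg_Algebra A \<nu>)"
| "dominates Max_Algebra A \<nu> \<longleftrightarrow>
     (\<forall>\<mu>\<in>classes A. accesses A \<mu> \<nu> \<longrightarrow>
        perron_root Max_Algebra A \<mu> \<le> perron_root Max_Algebra A \<nu>)"

definition spectral_class :: "algebra \<Rightarrow> real^'n^'n \<Rightarrow> real \<Rightarrow> 'n set \<Rightarrow> bool" where
  "spectral_class alg A \<rho> \<nu> \<longleftrightarrow>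
     \<nu> \<in> classes A \<and> \<rho> \<noteq> 0 \<and> perron_root alg A \<nu> = \<rho> \<and> dominates alg A \<nu>"

definition cycle_weight :: "real^'n^'n \<Rightarrow> 'n list \<Rightarrow> real" where
  "cycle_weight B c = (\<Prod>t<length c. B $ (c ! t) $ (c ! (Suc t mod length c)))"

definition cycle_mean :: "real^'n^'n \<Rightarrow> 'n list \<Rightarrow> real" where
  "cycle_mean B c = root (length c) (cycle_weight B c)"

text \<open>
  The maximum is attained, by an elementary cycle, as soon as there is a cycle. Without cycles the
  value is unspecified, and the critical graph is empty.
\<close>

definition max_cycle_mean :: "real^'n^'n \<Rightarrow> real" where
  "max_cycle_mean B = (GREATEST m. \<exists>c. is_cycle (mat_edges B) c \<and> m = cycle_mean B c)"

definition critical_cycle :: "real^'n^'n \<Rightarrow> 'n list \<Rightarrow> bool" where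
  "critical_cycle B c \<longleftrightarrow> is_cycle (mat_edges B) c \<and> cycle_mean B c = max_cycle_mean B"

definition critical_nodes :: "real^'n^'n \<Rightarrow> 'n set" where
  "critical_nodes B = (\<Union>c\<in>{c. critical_cycle B c}. set c)"

definition critical_edges :: "real^'n^'n \<Rightarrow> 'n rel" where
  "critical_edges B = (\<Union>c\<in>{c. critical_cycle B c}. cycle_edges c)"

definition accessing_nodes :: "real^'n^'n \<Rightarrow> real \<Rightarrow> 'n set" where
  "accessing_nodes A \<rho> = {i. \<exists>\<nu>. spectral_class Max_Algebra A \<rho> \<nu> \<and> node_accesses A i \<nu>}"

definition scaled_submatrix :: "real^'n^'n \<Rightarrow> real \<Rightarrow> real^'n^'n" where
  "scaled_submatrix A \<rho> =
     (\<chi> i j. if i \<in> accessing_nodes A \<rho> \<and> j \<in> accessing_nodes A \<rho>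
             then inverse \<rho> * A $ i $ j else 0)"

fun sigma_num :: "algebra \<Rightarrow> real^'n^'n \<Rightarrow> real \<Rightarrow> nat" where
  "sigma_num Nonneg_Algebra A \<rho> =
     Lcm {sc_cyclicity (Restr (mat_edges A) \<nu>) | \<nu>. spectral_class Nonneg_Algebra A \<rho> \<nu>}"
| "sigma_num Max_Algebra A \<rho> =
     cyclicity (critical_nodes (scaled_submatrix A \<rho>)) (critical_edges (scaled_submatrix A \<rho>))"

definition sigma_all :: "algebra \<Rightarrow> real^'n^'n \<Rightarrow> nat" where
  "sigma_all alg A = Lcm (sigma_num alg A ` nonzero_eigvals alg A)"

definition periodic_with :: "(nat \<Rightarrow> 'a) \<Rightarrow> nat \<Rightarrow> bool" where
  "periodic_with \<Omega> p \<longleftrightarrow> 0 < p \<and> (\<forall>k\<ge>1. \<Omega> (k + p) = \<Omega> k)"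

definition is_period :: "(nat \<Rightarrow> 'a) \<Rightarrow> nat \<Rightarrow> bool" where
  "is_period \<Omega> p \<longleftrightarrow> periodic_with \<Omega> p \<and> (\<forall>q. periodic_with \<Omega> q \<longrightarrow> p \<le> q)"

end

theory Submission
  imports Defs "HOL-Number_Theory.Cong"
begin

text \<open>
  Write \<open>T\<close> for the multiplication by \<open>\<rho>\<^sup>-\<^sup>1 A\<close> in the algebra considered. The eigencone
  \<open>V(A\<^sup>k, \<rho>\<^sup>k)\<close> is the set of nonnegative vectors fixed by \<open>T ^^ k\<close>, so part (i) is a statement
  about the periodic vectors of \<open>T\<close>. It follows formally from two facts: \<open>\<sigma>\<^sub>\<rho>\<close> is a period of
  every periodic vector (\<open>cyclicity_multiple_is_period\<close>), and a number that is a period of all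
  vectors fixed by \<open>T ^^ d\<close>, where \<open>d\<close> is one of the cyclicities whose least common multiple is \<open>\<sigma>\<^sub>\<rho>\<close>,
  is a multiple of \<open>d\<close> (\<open>cyclicity_set_dvd_period\<close>).

  For the first fact, a periodic vector \<open>x\<close> with \<open>(T ^^ m) x = x\<close> lies below the fixed vector \<open>y\<close> that
  is the sum of \<open>x\<close> over its orbit, and values are measured relative to \<open>y\<close>. In nonnegative algebra the
  largest relative difference between the orbit and its shift by \<open>\<sigma>\<^sub>\<rho>\<close> propagates, by a maximum
  principle, to a final class of the support of \<open>y\<close>, which is spectral. In max algebra the largest
  value that drops under the shift propagates along edges where \<open>y\<close> attains its maximum, which lead
  to a critical cycle. In both cases there is a closed walk of length \<open>\<equiv> \<sigma>\<^sub>\<rho>\<close> modulo \<open>m\<close> at the place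
  reached, because the cyclicity there divides \<open>\<sigma>\<^sub>\<rho>\<close> (\<open>closed_walk_in_residue_class\<close>), and following
  it contradicts the periodicity of \<open>x\<close> (\<open>nonneg_cyclicity_is_period\<close>, \<open>max_cyclicity_is_period\<close>).

  For the second fact, take a spectral class or a component of the critical graph, of cyclicity \<open>d\<close>,
  and a vector \<open>u\<close> with \<open>T u \<le> u\<close> that is positive on it (\<open>superharmonic_vector_exists\<close>). Restricting
  \<open>u\<close> to one of the \<open>d\<close> cyclic classes gives a vector \<open>w\<close> with \<open>w \<le> (T ^^ d) w\<close>, and the limit of
  \<open>(T ^^ (d * k)) w\<close> is fixed by \<open>T ^^ d\<close> but by no \<open>T ^^ q\<close> with \<open>d\<close> not dividing \<open>q\<close>
  (\<open>period_multiple_of_cyclicity\<close>). The Perron roots that enter through the notion of spectral class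
  exist by Brouwer's theorem and are compared by ratios of vectors (\<open>submatrix_eigval_exists\<close>,
  \<open>collatz_wielandt_le\<close>), in both algebras alike.

  For part (ii), the nonzero eigenvalues of \<open>A\<^sup>k\<close> are the \<open>k\<close>-th powers of those of \<open>A\<close>
  (\<open>nonzero_eigvals_power\<close>), so the summands of \<open>V\<^sup>\<Sigma>(A\<^sup>k)\<close> are the eigencones of part (i), and
  \<open>\<sigma>\<^sub>\<Lambda>\<close> is a period. It is the least one because a vector of a single eigencone that is written as
  a sum over all of them equals its own summand (\<open>eigencone_sum_component\<close>), so a period of the sums
  is a period of each summand.
\<close>

section \<open>Sums and matrix-vector products in the two algebras\<close>

fun alg_add :: "algebra \<Rightarrow> real \<Rightarrow> real \<Rightarrow> real" where
  "alg_add Nonneg_Algebra a b = a + b"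
| "alg_add Max_Algebra a b = max a b"

lemma alg_add_nonneg: "0 \<le> a \<Longrightarrow> 0 \<le> b \<Longrightarrow> 0 \<le> alg_add alg a b"
  by (cases alg) auto

lemma alg_add_mono: "a \<le> a' \<Longrightarrow> b \<le> b' \<Longrightarrow> alg_add alg a b \<le> alg_add alg a' b'"
  by (cases alg) auto

lemma alg_add_mult: "0 \<le> c \<Longrightarrow> c * alg_add alg a b = alg_add alg (c * a) (c * b)"
  by (cases alg) (simp_all add: distrib_left max_mult_distrib_left)

lemma alg_add_tendsto:
  "(f \<longlongrightarrow> a) F \<Longrightarrow> (g \<longlongrightarrow> b) F \<Longrightarrow> ((\<lambda>k. alg_add alg (f k) (g k)) \<longlongrightarrow> alg_add alg a b) F"
  by (cases alg) (auto intro: tendsto_add tendsto_max)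

lemma alg_add_pos_iff:
  "0 \<le> a \<Longrightarrow> 0 \<le> b \<Longrightarrow> 0 < alg_add alg a b \<longleftrightarrow> 0 < a \<or> 0 < b"
  by (cases alg) auto

lemma alg_sum_empty [simp]: "alg_sum alg f {} = 0"
  by (cases alg) auto

lemma alg_sum_insert:
  assumes "finite I" "i \<notin> I"
  shows "alg_sum alg f (insert i I) = alg_add alg (f i) (alg_sum alg f I)"
  using assms by (cases alg) (auto simp: insert_commute[of 0])

lemma alg_sum_cong:
  assumes "I = J" "\<And>i. i \<in> J \<Longrightarrow> f i = g i"
  shows "alg_sum alg f I = alg_sum alg g J"
proof -
  have "f ` J = g ` J" using assms(2) by (rule image_cong[OF refl])
  then show ?thesis using assms by (cases alg) auto
qed

lemma alg_sum_mono:
  assumes "finite I" "\<And>i. i \<in> I \<Longrightarrow> f i \<le> g i"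
  shows "alg_sum alg f I \<le> alg_sum alg g I"
  using assms by (induction I rule: finite_induct) (auto simp: alg_sum_insert intro!: alg_add_mono)

lemma alg_sum_zero [simp]: "alg_sum alg (\<lambda>i. 0) I = 0"
  by (cases alg) (auto simp: image_constant_conv)

lemma alg_sum_nonneg:
  assumes "finite I" "\<And>i. i \<in> I \<Longrightarrow> 0 \<le> f i"
  shows "0 \<le> alg_sum alg f I"
  using alg_sum_mono[OF assms(1), of "\<lambda>_. 0" f alg] assms by simp

lemma alg_sum_upper:
  assumes "finite I" "i \<in> I" "\<And>j. j \<in> I \<Longrightarrow> 0 \<le> f j"
  shows "f i \<le> alg_sum alg f I"
  using assms by (cases alg) (auto intro: member_le_sum)

lemma alg_sum_mult:
  assumes "0 \<le> c" "finite I"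
  shows "alg_sum alg (\<lambda>i. c * f i) I = c * alg_sum alg f I"
  using assms(2) by (induction I rule: finite_induct) (auto simp: alg_sum_insert alg_add_mult assms(1))

lemma alg_sum_mult_right:
  assumes "0 \<le> c" "finite I"
  shows "alg_sum alg (\<lambda>i. f i * c) I = alg_sum alg f I * c"
  using alg_sum_mult[OF assms, of alg f] by (simp add: mult.commute)

lemma alg_sum_add:
  assumes "finite I"
  shows "alg_sum alg (\<lambda>i. alg_add alg (f i) (g i)) I = alg_add alg (alg_sum alg f I) (alg_sum alg g I)"
  using assms by (induction I rule: finite_induct) (cases alg; auto simp: alg_sum_insert simp del: alg_sum.simps)+

lemma alg_sum_swap:
  assumes "finite I" "finite J"
  shows "alg_sum alg (\<lambda>i. alg_sum alg (f i) J) I = alg_sum alg (\<lambda>j. alg_sum alg (\<lambda>i. f i j) I) J"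
  using assms(1) by (induction I rule: finite_induct) (auto simp: alg_sum_insert alg_sum_add assms(2))

lemma alg_sum_mono_neutral:
  assumes "finite J" "I \<subseteq> J" "\<And>j. j \<in> J - I \<Longrightarrow> f j = 0"
  shows "alg_sum alg f J = alg_sum alg f I"
proof (cases alg)
  case Nonneg_Algebra
  then show ?thesis using assms by (simp add: sum.mono_neutral_right)
next
  case Max_Algebra
  have "insert 0 (f ` J) = insert 0 (f ` I)" using assms by force
  then show ?thesis using Max_Algebra by simp
qed

lemma alg_sum_reindex:
  assumes "inj_on h I"
  shows "alg_sum alg f (h ` I) = alg_sum alg (\<lambda>i. f (h i)) I"
  using assms by (cases alg) (auto simp: sum.reindex image_image)

lemma alg_sum_singleton: "0 \<le> f a \<Longrightarrow> alg_sum alg f {a} = f a"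
  by (cases alg) auto

lemma alg_sum_tendsto:
  assumes "finite I" "\<And>i. i \<in> I \<Longrightarrow> (f i \<longlongrightarrow> g i) F"
  shows "((\<lambda>k. alg_sum alg (\<lambda>i. f i k) I) \<longlongrightarrow> alg_sum alg g I) F"
  using assms by (induction I rule: finite_induct) (auto simp: alg_sum_insert intro!: alg_add_tendsto)

lemma alg_sum_pos_iff:
  assumes "finite I" "\<And>i. i \<in> I \<Longrightarrow> 0 \<le> f i"
  shows "0 < alg_sum alg f I \<longleftrightarrow> (\<exists>i\<in>I. 0 < f i)"
  using assms
  by (induction I rule: finite_induct) (auto simp: alg_sum_insert alg_add_pos_iff alg_sum_nonneg)

lemma max_sum_attained:
  assumes "finite I" "I \<noteq> {}" "\<And>i. i \<in> I \<Longrightarrow> 0 \<le> f i"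
  shows "\<exists>i\<in>I. alg_sum Max_Algebra f I = f i"
proof -
  have "Max (insert 0 (f ` I)) \<in> insert 0 (f ` I)" using assms by (intro Max_in) auto
  moreover have "\<exists>i\<in>I. f i = 0" if "Max (insert 0 (f ` I)) = 0"
  proof -
    obtain i where i: "i \<in> I" using assms(2) by blast
    then have "f i \<le> Max (insert 0 (f ` I))" using assms by (intro Max_ge) auto
    then show ?thesis using that i assms(3) by (metis order.antisym)
  qed
  ultimately show ?thesis by auto
qed

lemma mult_vec_nth: "alg_mult_vec alg B x $ i = alg_sum alg (\<lambda>j. B $ i $ j * x $ j) UNIV"
  by (simp add: alg_mult_vec_def)

context
  fixes B :: "real^'n^'n"
  assumes B: "nonneg_mat B"
begin

lemma entry_nonneg: "0 \<le> B $ i $ j"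
  using B by (simp add: nonneg_mat_def)

lemma mult_vec_nonneg: "nonneg_vec x \<Longrightarrow> nonneg_vec (alg_mult_vec alg B x)"
  by (auto simp: nonneg_vec_def mult_vec_nth entry_nonneg intro!: alg_sum_nonneg)

lemma mult_vec_pow_nonneg: "nonneg_vec x \<Longrightarrow> nonneg_vec ((alg_mult_vec alg B ^^ k) x)"
  by (induction k) (auto intro: mult_vec_nonneg)

lemma mult_vec_mono: "x \<le> y \<Longrightarrow> alg_mult_vec alg B x \<le> alg_mult_vec alg B y"
  by (auto simp: less_eq_vec_def mult_vec_nth entry_nonneg intro!: alg_sum_mono mult_left_mono)

lemma mult_vec_pow_mono: "x \<le> y \<Longrightarrow> (alg_mult_vec alg B ^^ k) x \<le> (alg_mult_vec alg B ^^ k) y"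
  by (induction k) (auto intro: mult_vec_mono)

lemma mult_vec_ge_entry:
  assumes "nonneg_vec x"
  shows "B $ i $ j * x $ j \<le> alg_mult_vec alg B x $ i"
  using assms unfolding mult_vec_nth by (intro alg_sum_upper) (auto simp: nonneg_vec_def entry_nonneg)

lemma max_mult_vec_attained:
  assumes "nonneg_vec x"
  shows "\<exists>j. alg_mult_vec Max_Algebra B x $ i = B $ i $ j * x $ j"
  using max_sum_attained[of UNIV "\<lambda>j. B $ i $ j * x $ j"] assms
  by (auto simp: nonneg_vec_def entry_nonneg mult_vec_nth)

lemma mult_vec_alg_sum:
  assumes "finite F"
  shows "alg_mult_vec alg B (\<chi> i. alg_sum alg (\<lambda>a. f a $ i) F) = (\<chi> i. alg_sum alg (\<lambda>a. alg_mult_vec alg B (f a) $ i) F)"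
proof -
  have "alg_sum alg (\<lambda>j. B $ i $ j * alg_sum alg (\<lambda>a. f a $ j) F) UNIV
      = alg_sum alg (\<lambda>a. alg_sum alg (\<lambda>j. B $ i $ j * f a $ j) UNIV) F" for i
    by (subst alg_sum_swap[OF assms]) (simp_all add: alg_sum_mult entry_nonneg assms)
  then show ?thesis by (simp add: vec_eq_iff mult_vec_nth)
qed

lemma mult_vec_pow_alg_sum:
  assumes "finite F"
  shows "(alg_mult_vec alg B ^^ k) (\<chi> i. alg_sum alg (\<lambda>a. f a $ i) F)
     = (\<chi> i. alg_sum alg (\<lambda>a. (alg_mult_vec alg B ^^ k) (f a) $ i) F)"
  by (induction k) (simp_all add: mult_vec_alg_sum[OF assms])

lemma mult_vec_mult:
  assumes "nonneg_vec x"
  shows "alg_mult_vec alg (alg_mult alg B C) x = alg_mult_vec alg B (alg_mult_vec alg C x)"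
proof -
  have "alg_sum alg (\<lambda>j. alg_sum alg (\<lambda>k. B $ i $ k * C $ k $ j) UNIV * x $ j) UNIV
      = alg_sum alg (\<lambda>j. alg_sum alg (\<lambda>k. B $ i $ k * (C $ k $ j * x $ j)) UNIV) UNIV" for i
    using assms by (simp add: nonneg_vec_def alg_sum_mult_right[symmetric] mult.assoc)
  also have "\<dots> i = alg_sum alg (\<lambda>k. B $ i $ k * alg_sum alg (\<lambda>j. C $ k $ j * x $ j) UNIV) UNIV" for i
    by (subst alg_sum_swap) (simp_all add: alg_sum_mult entry_nonneg)
  finally show ?thesis
    by (simp add: vec_eq_iff mult_vec_nth alg_mult_def)
qed

lemma mult_vec_mat_1:
  assumes "nonneg_vec x"
  shows "alg_mult_vec alg (mat 1) x = x"
proof -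
  have "alg_sum alg (\<lambda>j. mat 1 $ i $ j * x $ j) UNIV = alg_sum alg (\<lambda>j. mat 1 $ i $ j * x $ j) {i}" for i
    by (rule alg_sum_mono_neutral) (auto simp: mat_def)
  then show ?thesis using assms
    by (cases alg) (simp_all add: vec_eq_iff mult_vec_nth mat_def nonneg_vec_def)
qed

lemma mult_vec_alg_power:
  assumes "nonneg_vec x"
  shows "alg_mult_vec alg (alg_power alg B k) x = (alg_mult_vec alg B ^^ k) x"
proof (induction k)
  case (Suc k)
  then show ?case by (simp add: mult_vec_mult assms)
qed (simp add: mult_vec_mat_1 assms)

lemma mult_vec_scale:
  assumes "0 \<le> c"
  shows "alg_mult_vec alg B (c *\<^sub>R x) = c *\<^sub>R alg_mult_vec alg B x"
  using assms by (simp add: vec_eq_iff mult_vec_nth alg_sum_mult mult.left_commute)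

lemma mult_vec_tendsto:
  assumes "(f \<longlongrightarrow> x) F"
  shows "((\<lambda>k. alg_mult_vec alg B (f k)) \<longlongrightarrow> alg_mult_vec alg B x) F"
  by (rule vec_tendstoI) (auto simp: mult_vec_nth intro!: alg_sum_tendsto tendsto_mult tendsto_vec_nth assms)

lemma mult_vec_pow_tendsto:
  assumes "(f \<longlongrightarrow> x) F"
  shows "((\<lambda>k. (alg_mult_vec alg B ^^ m) (f k)) \<longlongrightarrow> (alg_mult_vec alg B ^^ m) x) F"
  by (induction m) (auto intro: assms mult_vec_tendsto)

end

lemma mult_vec_scale_mat:
  assumes "0 \<le> c"
  shows "alg_mult_vec alg (c *\<^sub>R B) x = c *\<^sub>R alg_mult_vec alg B x"
  using assms by (simp add: vec_eq_iff mult_vec_nth alg_sum_mult mult.assoc)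

lemma nonneg_mat_scale: "nonneg_mat B \<Longrightarrow> 0 \<le> c \<Longrightarrow> nonneg_mat (c *\<^sub>R B)"
  by (simp add: nonneg_mat_def)

lemma mult_vec_pow_scale_mat:
  assumes "0 \<le> c" "nonneg_mat B"
  shows "(alg_mult_vec alg (c *\<^sub>R B) ^^ k) x = c ^ k *\<^sub>R (alg_mult_vec alg B ^^ k) x"
  using assms by (induction k) (simp_all add: mult_vec_scale_mat mult_vec_scale)

lemma mem_eigencone_power_iff:
  assumes "nonneg_mat A" "0 < \<rho>"
  shows "x \<in> eigencone alg (alg_power alg A k) (\<rho> ^ k) \<longleftrightarrow>
    nonneg_vec x \<and> (alg_mult_vec alg (inverse \<rho> *\<^sub>R A) ^^ k) x = x"
proof -
  have "v = \<rho> ^ k *\<^sub>R x \<longleftrightarrow> inverse \<rho> ^ k *\<^sub>R v = x" for v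
    using assms(2) by (auto simp: power_inverse)
  then have "alg_mult_vec alg (alg_power alg A k) x = \<rho> ^ k *\<^sub>R x \<longleftrightarrow>
      (alg_mult_vec alg (inverse \<rho> *\<^sub>R A) ^^ k) x = x" if "nonneg_vec x"
    using assms mult_vec_pow_scale_mat[of "inverse \<rho>" A k alg x]
    by (simp only: mult_vec_alg_power[OF assms(1) that] inverse_nonnegative_iff_nonnegative order.strict_implies_order)
  then show ?thesis unfolding eigencone_def by blast
qed

section \<open>Closed walks and cyclicity\<close>

definition strongly_connected :: "'a set \<Rightarrow> 'a rel \<Rightarrow> bool" where
  "strongly_connected N G \<longleftrightarrow> G \<subseteq> N \<times> N \<and> (\<forall>i\<in>N. \<forall>j\<in>N. (i, j) \<in> G\<^sup>*)"

lemma strongly_connectedD: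
  assumes "strongly_connected N G"
  shows "(i, j) \<in> G \<Longrightarrow> i \<in> N" "(i, j) \<in> G \<Longrightarrow> j \<in> N"
    and "i \<in> N \<Longrightarrow> j \<in> N \<Longrightarrow> \<exists>k. (i, j) \<in> G ^^ k"
  using assms by (auto simp: strongly_connected_def rtrancl_power)

lemma relpow_add_trans: "(i, j) \<in> G ^^ k \<Longrightarrow> (j, l) \<in> G ^^ m \<Longrightarrow> (i, l) \<in> G ^^ (k + m)"
  by (auto simp: relpow_add)

lemma relpow_subset:
  fixes G H :: "'a rel"
  shows "(i, j) \<in> G ^^ k \<Longrightarrow> G \<subseteq> H \<Longrightarrow> (i, j) \<in> H ^^ k"
  by (induction k arbitrary: j) auto

lemma relpow_imp_mem:
  assumes "(i, j) \<in> G ^^ k" "G \<subseteq> N \<times> N" "j \<in> N"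
  shows "i \<in> N"
proof (cases k)
  case (Suc m)
  then show ?thesis using assms(2) relpow_Suc_D2[of i j m G] assms(1) by auto
qed (use assms in auto)

lemma walk_segment:
  assumes "\<And>t. t < k \<Longrightarrow> (f t, f (Suc t)) \<in> G" "a \<le> b" "b \<le> k"
  shows "(f a, f b) \<in> G ^^ (b - a)"
  unfolding relpow_fun_conv
  by (rule exI[of _ "\<lambda>t. f (a + t)"]) (use assms in auto)

lemma cycle_of_walk:
  assumes "\<And>t. t < k \<Longrightarrow> (f t, f (Suc t)) \<in> G" "f k = f 0" "0 < k"
  shows "is_cycle G (map f [0..<k])"
proof -
  have "f (Suc t mod k) = f (Suc t)" if "t < k" for t
    using that assms(2) by (cases "Suc t = k") auto
  then show ?thesis using assms by (auto simp: is_cycle_def cycle_edges_def)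
qed

lemma Suc_mod_bij:
  assumes "0 < (m::nat)"
  shows "bij_betw (\<lambda>a. Suc a mod m) {..<m} {..<m}"
proof -
  have inj: "inj_on (\<lambda>a. Suc a mod m) {..<m}"
    by (intro inj_onI) (metis cong_def cong_less_modulus_unique_nat lessThan_iff cong_add_rcancel_nat Suc_eq_plus1)
  moreover have "(\<lambda>a. Suc a mod m) ` {..<m} \<subseteq> {..<m}" using assms by auto
  ultimately show ?thesis using endo_inj_surj[of "{..<m}"] unfolding bij_betw_def by blast
qed

lemma cycle_edges_subset: "cycle_edges c \<subseteq> set c \<times> set c"
proof -
  have "Suc t mod length c < length c" if "t < length c" for t
    using that by (intro mod_less_divisor) auto
  then show ?thesis by (auto simp: cycle_edges_def)
qed

lemma cycle_edge_at: "t < length c \<Longrightarrow> (c ! t, c ! (Suc t mod length c)) \<in> cycle_edges c"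
  by (auto simp: cycle_edges_def)

lemma cycle_walk:
  assumes "s < length c"
  shows "(c ! s, c ! ((s + n) mod length c)) \<in> cycle_edges c ^^ n"
proof (induction n)
  case (Suc n)
  have "(s + n) mod length c < length c" using assms by (intro mod_less_divisor) auto
  then have "(c ! ((s + n) mod length c), c ! (Suc (s + n) mod length c)) \<in> cycle_edges c"
    using cycle_edge_at by (metis mod_Suc_eq)
  then show ?case using Suc by (auto intro: relpow_Suc_I)
qed (use assms in auto)

lemma cycle_nodes_connected:
  assumes "v \<in> set c" "v' \<in> set c"
  shows "(v, v') \<in> (cycle_edges c)\<^sup>*"
proof -
  obtain s r where sr: "s < length c" "v = c ! s" "r < length c" "v' = c ! r"
    using assms by (metis in_set_conv_nth)
  have "(s + (length c - s + r)) mod length c = r" using sr by simp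
  then have "(v, v') \<in> cycle_edges c ^^ (length c - s + r)" using cycle_walk[OF sr(1)] sr by metis
  then show ?thesis by (auto simp: rtrancl_power)
qed

lemma is_cycle_edge:
  "is_cycle E c \<Longrightarrow> t < length c \<Longrightarrow> (c ! t, c ! (Suc t mod length c)) \<in> E"
  using cycle_edge_at unfolding is_cycle_def by blast

lemma edge_on_cycle:
  assumes "(i, j) \<in> G" "(j, i) \<in> G\<^sup>*"
  shows "\<exists>c. is_cycle G c \<and> (i, j) \<in> cycle_edges c"
proof -
  obtain k where "(j, i) \<in> G ^^ k" using assms(2) by (auto simp: rtrancl_power)
  then obtain g where g: "g 0 = j" "g k = i" "\<And>t. t < k \<Longrightarrow> (g t, g (Suc t)) \<in> G"
    unfolding relpow_fun_conv by blast
  define h where "h t = (case t of 0 \<Rightarrow> i | Suc t \<Rightarrow> g t)" for t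
  have h: "(h t, h (Suc t)) \<in> G" if "t < Suc k" for t
    using that assms(1) g by (cases t) (auto simp: h_def)
  have "is_cycle G (map h [0..<Suc k])"
    by (rule cycle_of_walk) (use h g in \<open>auto simp: h_def\<close>)
  moreover have "map h [0..<Suc k] ! (Suc 0 mod Suc k) = j"
  proof (cases k)
    case 0
    then show ?thesis using g by (simp add: h_def)
  next
    case (Suc k')
    then have "Suc 0 mod Suc k = Suc 0" by simp
    then show ?thesis using Suc g by (simp add: h_def del: upt_Suc)
  qed
  then have "(i, j) \<in> cycle_edges (map h [0..<Suc k])"
    using cycle_edge_at[of 0 "map h [0..<Suc k]"] by (simp add: h_def del: upt_Suc)
  ultimately show ?thesis by blast
qed

text \<open>
  A closed walk that visits a node twice splits there into two shorter closed walks, and one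
  that does not is an elementary cycle.
\<close>

lemma sc_cyclicity_dvd_closed_walk:
  assumes "(i, i) \<in> G ^^ k"
  shows "sc_cyclicity G dvd k"
  using assms
proof (induction k arbitrary: i rule: less_induct)
  case (less k)
  obtain f where f: "f 0 = i" "f k = i" "\<And>t. t < k \<Longrightarrow> (f t, f (Suc t)) \<in> G"
    using less.prems by (auto simp: relpow_fun_conv)
  consider "k = 0" | "0 < k" "inj_on f {..<k}" | a b where "a < b" "b < k" "f a = f b"
  proof (cases "inj_on f {..<k}")
    case False
    then obtain a b where "a < k" "b < k" "a \<noteq> b" "f a = f b" by (auto simp: inj_on_def)
    then show ?thesis using that(3)[of a b] that(3)[of b a] by (cases "a < b") auto
  qed (use that in auto)
  then show ?case
  proof cases
    case 2
    have "is_cycle G (map f [0..<k])" using f 2 by (intro cycle_of_walk) auto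
    moreover have "distinct (map f [0..<k])" using 2 by (simp add: distinct_map lessThan_atLeast0)
    ultimately have c: "elementary_cycle G (map f [0..<k])" by (simp add: elementary_cycle_def)
    have "k \<in> {length c |c. elementary_cycle G c}" using c by force
    then have "Gcd {length c |c. elementary_cycle G c} dvd k" by (rule Gcd_dvd)
    moreover have "G \<noteq> {}" using f(3) 2(1) by blast
    ultimately show ?thesis by (simp add: sc_cyclicity_def)
  next
    case 3
    have "(f a, f a) \<in> G ^^ (b - a)" using walk_segment[of k f G a b] f(3) 3 by auto
    then have "sc_cyclicity G dvd b - a" using 3 by (intro less.IH) auto
    moreover have "(i, i) \<in> G ^^ ((a - 0) + (k - b))"
      using walk_segment[of k f G 0 a] walk_segment[of k f G b k] f 3
      by (intro relpow_add_trans[of _ "f a"]) auto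
    then have "sc_cyclicity G dvd a + (k - b)" using 3 by (intro less.IH[of _ i]) auto
    ultimately have "sc_cyclicity G dvd (b - a) + (a + (k - b))" by (rule dvd_add)
    then show ?thesis using 3 by simp
  qed simp
qed

text \<open>
  Modulo \<open>m\<close>, subtracting \<open>y\<close> is the same as adding \<open>(m - 1) *
  y\<close>. So the residues met by \<open>W\<close> form a subgroup, which consists of the
  multiples of its least positive element \<open>e\<close>; since \<open>e\<close> divides all
  elements of \<open>W\<close>, it divides their gcd.
\<close>

lemma additive_set_meets_residue_class:
  fixes W :: "nat set"
  assumes "0 \<in> W" and add: "\<And>x y. x \<in> W \<Longrightarrow> y \<in> W \<Longrightarrow> x + y \<in> W"
    and "Gcd W dvd t" and m: "0 < m"
  shows "\<exists>L\<in>W. [L = t] (mod m)"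
proof -
  define R where "R = {x. \<exists>L\<in>W. [L = x] (mod m)}"
  have R_add: "x + y \<in> R" if "x \<in> R" "y \<in> R" for x y
    using that add unfolding R_def by (blast intro: cong_add)
  have R_0: "0 \<in> R" using assms(1) unfolding R_def by (blast intro: cong_refl)
  have R_mult: "n * x \<in> R" if "x \<in> R" for n x
    by (induction n) (auto intro: R_0 R_add that)
  have R_diff: "x - y \<in> R" if "x \<in> R" "y \<in> R" "y \<le> x" for x y
  proof -
    have "x + (m - 1) * y \<in> R" using that by (intro R_add R_mult)
    moreover have "(x - y) + m * y = x + (m - 1) * y"
      using that(3) m by (cases m) auto
    ultimately have "(x - y) + m * y \<in> R" by simp
    then show ?thesis by (auto simp: R_def cong_def)
  qed
  have m_R: "m \<in> R" using assms(1) by (auto simp: R_def cong_def intro!: bexI[of _ 0])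
  define e where "e = (LEAST x. 0 < x \<and> x \<in> R)"
  have e: "0 < e" "e \<in> R" using LeastI[of "\<lambda>x. 0 < x \<and> x \<in> R" m] m m_R by (auto simp: e_def)
  have e_dvd: "e dvd x" if "x \<in> R" for x
  proof (rule ccontr)
    assume "\<not> e dvd x"
    then have "0 < x mod e" by (simp add: dvd_eq_mod_eq_0)
    moreover have "x mod e \<in> R"
      using R_diff[OF that R_mult[OF e(2), of "x div e"]] by (simp add: minus_div_mult_eq_mod)
    ultimately have "e \<le> x mod e" unfolding e_def by (intro Least_le) auto
    then show False using mod_less_divisor[OF e(1), of x] by simp
  qed
  have "W \<subseteq> R" unfolding R_def by (blast intro: cong_refl)
  then have "e dvd Gcd W" using e_dvd by (auto intro: Gcd_greatest)
  then obtain n where "t = n * e" using assms(3) by (metis dvd_def dvd_trans mult.commute)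
  then have "t \<in> R" using R_mult[OF e(2)] by simp
  then show ?thesis by (auto simp: R_def)
qed

lemma closed_walk_through_edge:
  assumes "strongly_connected N G" "i \<in> N" "G \<noteq> {}"
  shows "\<exists>p>0. (i, i) \<in> G ^^ p"
proof -
  obtain u v where uv: "(u, v) \<in> G" using assms(3) by auto
  then obtain a b where "(i, u) \<in> G ^^ a" "(v, i) \<in> G ^^ b"
    using strongly_connectedD[OF assms(1)] assms(2) by metis
  then have "(i, i) \<in> G ^^ (a + (1 + b))" using uv by (intro relpow_add_trans[of _ u] relpow_add_trans[of _ v]) auto
  then show ?thesis by (intro exI[of _ "a + (1 + b)"]) auto
qed

lemma sc_cyclicity_pos:
  assumes "strongly_connected N G"
  shows "0 < sc_cyclicity G"
proof (cases "G = {}")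
  case False
  then obtain u v where "(u, v) \<in> G" by auto
  then have "u \<in> N" using strongly_connectedD(1)[OF assms] by blast
  from closed_walk_through_edge[OF assms this False]
  obtain p where "0 < p" "sc_cyclicity G dvd p" by (blast intro: sc_cyclicity_dvd_closed_walk)
  then show ?thesis by (auto intro: Nat.gr0I)
qed (simp add: sc_cyclicity_def)

text \<open>
  The lengths of the closed walks at \<open>i\<close> form an additive set. A detour from
  \<open>i\<close> to an elementary cycle gives two such lengths, without and with the cycle, so
  their gcd divides the length of the cycle. Hence it divides the cyclicity, and all residue
  classes of multiples of the cyclicity are met. This is how the cyclicity makes every period
  \<open>m\<close> of a vector comparable with \<open>t\<close>.
\<close>

lemma closed_walk_in_residue_class:
  assumes G: "strongly_connected N G" "i \<in> N" "G \<noteq> {}" and "sc_cyclicity G dvd t" "0 < m"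
  shows "\<exists>L\<ge>s. [L = t] (mod m) \<and> (i, i) \<in> G ^^ L"
proof -
  define W where "W = {k. (i, i) \<in> G ^^ k}"
  have W0: "0 \<in> W" by (simp add: W_def)
  have W_add: "x + y \<in> W" if "x \<in> W" "y \<in> W" for x y
    using that by (auto simp: W_def intro: relpow_add_trans)
  have W_mult: "n * x \<in> W" if "x \<in> W" for n x
    by (induction n) (auto intro: W0 W_add that)
  have "Gcd W dvd length c" if c: "elementary_cycle G c" for c
  proof -
    let ?v = "c ! 0"
    have cyc: "is_cycle G c" "c \<noteq> []" using c by (auto simp: elementary_cycle_def is_cycle_def)
    then have "(?v, ?v) \<in> cycle_edges c ^^ length c" using cycle_walk[of 0 c "length c"] by simp
    then have loop: "(?v, ?v) \<in> G ^^ length c" using cyc(1) by (auto simp: is_cycle_def intro: relpow_subset)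
    have "(c ! 0, c ! (Suc 0 mod length c)) \<in> G"
      using is_cycle_edge[OF cyc(1), of 0] cyc(2) by simp
    then have "?v \<in> N" using strongly_connectedD(1)[OF G(1)] by blast
    then obtain a b where ab: "(i, ?v) \<in> G ^^ a" "(?v, i) \<in> G ^^ b"
      using strongly_connectedD(3)[OF G(1)] G(2) by metis
    then have "a + b \<in> W" by (auto simp: W_def intro: relpow_add_trans)
    moreover have "a + (length c + b) \<in> W"
      using ab loop by (auto simp: W_def intro: relpow_add_trans)
    ultimately have "Gcd W dvd a + b" "Gcd W dvd (a + b) + length c"
      by (auto intro: Gcd_dvd simp: ac_simps)
    then show ?thesis using dvd_add_right_iff by blast
  qed
  then have "Gcd W dvd sc_cyclicity G"
    using G(3) unfolding sc_cyclicity_def by (auto intro!: Gcd_greatest)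
  then have "Gcd W dvd t" using assms(4) by (rule dvd_trans)
  then obtain L where L: "L \<in> W" "[L = t] (mod m)"
    using additive_set_meets_residue_class[OF W0 W_add _ assms(5)] by blast
  obtain p where p: "0 < p" "p \<in> W"
    using closed_walk_through_edge[OF G] by (auto simp: W_def)
  (* going \<open>m * s\<close> more times around some closed walk changes nothing modulo
      \<open>m\<close> and makes the length at least \<open>s\<close> *)
  have "L + (m * s) * p \<in> W" using L p by (intro W_add W_mult)
  moreover have "[L + (m * s) * p = t] (mod m)" using L(2) by (simp add: cong_def mult.assoc)
  moreover have "s \<le> L + (m * s) * p"
  proof -
    have "1 * s * 1 \<le> m * s * p" using assms(5) p(1) by (intro mult_le_mono) auto
    then have "s \<le> m * s * p" by (simp only: mult_1_left mult_1_right)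
    then show ?thesis by (rule trans_le_add2)
  qed
  ultimately show ?thesis unfolding W_def by blast
qed

text \<open>
  If \<open>d\<close> divides the lengths of all closed walks of a strongly connected graph,
  these sets are its cyclic classes: each edge leads from the class with index \<open>a +
  1\<close> to the class with index \<open>a\<close>.
\<close>

definition phase_class :: "'a rel \<Rightarrow> nat \<Rightarrow> 'a \<Rightarrow> nat \<Rightarrow> 'a set" where
  "phase_class G d i a = {j. \<exists>k. [k = a] (mod d) \<and> (j, i) \<in> G ^^ k}"

lemma phase_class_cong: "[a = b] (mod d) \<Longrightarrow> phase_class G d i a = phase_class G d i b"
  unfolding phase_class_def by (metis cong_sym cong_trans)

lemma phase_class_subset:
  assumes "strongly_connected N G" "i \<in> N"
  shows "phase_class G d i a \<subseteq> N"
  using assms by (auto simp: phase_class_def strongly_connected_def intro: relpow_imp_mem)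

lemma phase_class_successor:
  assumes G: "strongly_connected N G" "i \<in> N" and d: "\<And>k. (i, i) \<in> G ^^ k \<Longrightarrow> d dvd k"
    and j: "j \<in> phase_class G d i (Suc a)" and e: "(j, j') \<in> G"
  shows "j' \<in> phase_class G d i a"
proof -
  obtain k where k: "[k = Suc a] (mod d)" "(j, i) \<in> G ^^ k" using j by (auto simp: phase_class_def)
  obtain b l where b: "(i, j) \<in> G ^^ b" and l: "(j', i) \<in> G ^^ l"
    using strongly_connectedD[OF G(1)] G(2) e by metis
  have "(i, i) \<in> G ^^ (b + Suc l)" using relpow_add_trans[OF b, of i "Suc l"] relpow_Suc_I2[OF e l] by simp
  moreover have "(i, i) \<in> G ^^ (b + k)" using b k(2) by (rule relpow_add_trans)
  ultimately have "[b + Suc l = b + k] (mod d)" using d by (simp add: cong_def dvd_eq_mod_eq_0)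
  then have "[Suc l = Suc a] (mod d)" using k(1) by (metis cong_add_lcancel_nat cong_trans)
  then have "[l = a] (mod d)" by (metis cong_add_rcancel_nat Suc_eq_plus1)
  then show ?thesis using l by (auto simp: phase_class_def)
qed

lemma phase_class_0_walk:
  assumes "\<And>k. (i, i) \<in> G ^^ k \<Longrightarrow> d dvd k" "j \<in> phase_class G d i 0" "(i, j) \<in> G ^^ k"
  shows "d dvd k"
proof -
  obtain l where "[l = 0] (mod d)" "(j, i) \<in> G ^^ l" using assms(2) by (auto simp: phase_class_def)
  then show ?thesis using assms(1)[of "k + l"] assms(3)
    by (auto simp: cong_0_iff intro: relpow_add_trans simp: dvd_add_left_iff)
qed

section \<open>Strongly connected components\<close>

lemma component_eq:
  assumes "N \<in> components V E" "i \<in> N"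
  shows "N = {j \<in> V. (i, j) \<in> E\<^sup>* \<and> (j, i) \<in> E\<^sup>*}"
  using assms unfolding components_def by (auto elim!: quotientE intro: rtrancl_trans)

lemma component_exists:
  assumes "i \<in> V"
  shows "\<exists>N\<in>components V E. i \<in> N"
proof -
  let ?r = "{(i, j). i \<in> V \<and> j \<in> V \<and> (i, j) \<in> E\<^sup>* \<and> (j, i) \<in> E\<^sup>*}"
  have "?r `` {i} \<in> components V E" unfolding components_def using assms by (rule quotientI)
  moreover have "i \<in> ?r `` {i}" using assms by auto
  ultimately show ?thesis by (rule bexI[rotated])
qed

lemma component_nonempty: "N \<in> components V E \<Longrightarrow> N \<noteq> {}"
  unfolding components_def by (auto elim!: quotientE)

lemma component_subset: "N \<in> components V E \<Longrightarrow> N \<subseteq> V"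
  unfolding components_def quotient_def by auto

text \<open>
  All nodes between two nodes of a component belong to the component.
\<close>

lemma component_walk:
  assumes E: "E \<subseteq> V \<times> V" and N: "N \<in> components V E"
  shows "i \<in> N \<Longrightarrow> (i, j) \<in> E ^^ k \<Longrightarrow> (j, i) \<in> E\<^sup>* \<Longrightarrow> j \<in> N \<and> (i, j) \<in> (Restr E N) ^^ k"
proof (induction k arbitrary: i)
  case (Suc k)
  obtain z where z: "(i, z) \<in> E" "(z, j) \<in> E ^^ k" using relpow_Suc_D2[OF Suc.prems(2)] by auto
  have zj: "(z, j) \<in> E\<^sup>*" using z(2) by (auto simp: rtrancl_power)
  have "z \<in> V" using E z(1) by auto
  moreover have "(z, i) \<in> E\<^sup>*" using zj Suc.prems(3) by (rule rtrancl_trans)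
  ultimately have "z \<in> N" using component_eq[OF N Suc.prems(1)] z(1) by auto
  moreover have "(j, z) \<in> E\<^sup>*" using Suc.prems(3) z(1) by (rule rtrancl_into_rtrancl)
  ultimately have "j \<in> N" "(z, j) \<in> (Restr E N) ^^ k" using Suc.IH z(2) by auto
  moreover have "(i, z) \<in> Restr E N" using z(1) \<open>z \<in> N\<close> Suc.prems(1) by auto
  ultimately show ?case by (blast intro: relpow_Suc_I2)
qed simp

lemma component_strongly_connected:
  assumes "E \<subseteq> V \<times> V" "N \<in> components V E"
  shows "strongly_connected N (Restr E N)"
proof -
  have "(i, j) \<in> (Restr E N)\<^sup>*" if "i \<in> N" "j \<in> N" for i j
  proof -
    have "(i, j) \<in> E\<^sup>*" "(j, i) \<in> E\<^sup>*" using component_eq[OF assms(2) that(1)] that(2) by auto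
    then show ?thesis using component_walk[OF assms that(1), of j] by (auto simp: rtrancl_power)
  qed
  then show ?thesis by (auto simp: strongly_connected_def)
qed

lemma component_cyclicity_pos:
  assumes "E \<subseteq> V \<times> V" "N \<in> components V E"
  shows "0 < sc_cyclicity (Restr E N)"
  using component_strongly_connected[OF assms] by (rule sc_cyclicity_pos)

lemma rtrancl_leaves_set:
  assumes "(i, j) \<in> r\<^sup>*" "i \<in> M" "j \<notin> M"
  shows "\<exists>k\<in>M. \<exists>l. l \<notin> M \<and> (k, l) \<in> r \<and> (l, j) \<in> r\<^sup>*"
  using assms by (induction rule: converse_rtrancl_induct) auto

text \<open>
  A node of \<open>Q\<close> that reaches as few nodes as possible is reached back from each of
  them.
\<close>

lemma final_node_exists:
  fixes G :: "('a::finite) rel"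
  assumes "Q \<noteq> {}" "\<And>i j. i \<in> Q \<Longrightarrow> (i, j) \<in> G \<Longrightarrow> j \<in> Q"
  shows "\<exists>c\<in>Q. \<forall>j. (c, j) \<in> G\<^sup>* \<longrightarrow> j \<in> Q \<and> (j, c) \<in> G\<^sup>*"
proof -
  define r where "r c = {j. (c, j) \<in> G\<^sup>*}" for c
  obtain c where c: "c \<in> Q" "\<And>j. j \<in> Q \<Longrightarrow> card (r c) \<le> card (r j)"
    using ex_has_least_nat[of "\<lambda>c. c \<in> Q" _ "\<lambda>c. card (r c)"] assms(1) by blast
  have "j \<in> Q \<and> (j, c) \<in> G\<^sup>*" if "(c, j) \<in> G\<^sup>*" for j
  proof -
    have j: "j \<in> Q" using that by (induction) (auto intro: c(1) assms(2))
    have "r j \<subseteq> r c" using that by (auto simp: r_def intro: rtrancl_trans)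
    then have "r j = r c" using c(2)[OF j] by (intro card_seteq) auto
    then show ?thesis using j by (auto simp: r_def)
  qed
  then show ?thesis using c(1) by blast
qed

lemma closed_walk_exists:
  fixes G :: "('a::finite) rel"
  assumes "Q \<noteq> {}" "\<And>i. i \<in> Q \<Longrightarrow> \<exists>j\<in>Q. (i, j) \<in> G"
  shows "\<exists>c\<in>Q. \<exists>k>0. (c, c) \<in> (Restr G Q) ^^ k"
proof -
  obtain c where c: "c \<in> Q" "\<And>j. (c, j) \<in> (Restr G Q)\<^sup>* \<Longrightarrow> (j, c) \<in> (Restr G Q)\<^sup>*"
    using final_node_exists[OF assms(1), of "Restr G Q"] by blast
  obtain j where j: "(c, j) \<in> Restr G Q" using assms(2)[OF c(1)] c(1) by blast
  then obtain k where "(j, c) \<in> (Restr G Q) ^^ k" using c(2) rtrancl_imp_relpow by (metis r_into_rtrancl)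
  then have "(c, c) \<in> (Restr G Q) ^^ Suc k" using j by (blast intro: relpow_Suc_I2)
  then show ?thesis using c(1) zero_less_Suc by blast
qed

section \<open>Perron roots of irreducible blocks\<close>

lemma finite_max_exists:
  fixes f :: "'a \<Rightarrow> real"
  assumes "finite N" "N \<noteq> {}"
  shows "\<exists>i\<in>N. \<forall>j\<in>N. f j \<le> f i"
proof -
  have "Max (f ` N) \<in> f ` N" using assms by (intro Max_in) auto
  then obtain i where "i \<in> N" "Max (f ` N) = f i" by auto
  then show ?thesis using assms by (metis Max_ge finite_imageI imageI)
qed

text \<open>
  Where the ratio of \<open>x\<close> to \<open>y\<close> is largest, say \<open>M\<close>, the
  comparison of \<open>B x\<close> with \<open>M B y\<close> gives \<open>a \<le> b\<close>.
  Only monotonicity and homogeneity enter, so the argument covers both algebras.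
\<close>

lemma collatz_wielandt_le:
  fixes B :: "real^'n^'n"
  assumes B: "nonneg_mat B"
    and x: "\<And>i. i \<in> N \<Longrightarrow> 0 \<le> x $ i" "k \<in> N" "x $ k \<noteq> 0"
    and y: "\<And>i. i \<in> N \<Longrightarrow> 0 < y $ i"
    and ax: "\<And>i. i \<in> N \<Longrightarrow> a * x $ i \<le> alg_sum alg (\<lambda>j. B $ i $ j * x $ j) N"
    and bz: "\<And>i. i \<in> N \<Longrightarrow> alg_sum alg (\<lambda>j. B $ i $ j * y $ j) N \<le> b * y $ i"
  shows "a \<le> b"
proof -
  obtain i where i: "i \<in> N" "\<And>j. j \<in> N \<Longrightarrow> x $ j / y $ j \<le> x $ i / y $ i"
    using finite_max_exists[of N "\<lambda>i. x $ i / y $ i"] x(2) by auto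
  define M where "M = x $ i / y $ i"
  have "0 < x $ k" using x(1)[OF x(2)] x(3) by simp
  then have "0 < x $ k / y $ k" using y[OF x(2)] by simp
  then have M: "0 < M" using i(2)[OF x(2)] by (simp add: M_def)
  have le: "x $ j \<le> M * y $ j" if "j \<in> N" for j
    using i(2)[OF that] y[OF that] by (simp add: M_def pos_divide_le_eq)
  have xi: "x $ i = M * y $ i" using y[OF i(1)] by (simp add: M_def)
  have "a * x $ i \<le> alg_sum alg (\<lambda>j. M * (B $ i $ j * y $ j)) N"
    by (rule order.trans[OF ax[OF i(1)]], rule alg_sum_mono)
       (auto simp: mult.left_commute[of M] intro!: mult_left_mono le entry_nonneg[OF B])
  also have "\<dots> = M * alg_sum alg (\<lambda>j. B $ i $ j * y $ j) N" using M by (intro alg_sum_mult) auto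
  also have "\<dots> \<le> M * (b * y $ i)" using M bz[OF i(1)] by (intro mult_left_mono) auto
  also have "\<dots> = b * x $ i" by (simp add: xi)
  finally show ?thesis using M y[OF i(1)] by (simp add: xi)
qed

text \<open>
  If \<open>a\<close> were at least \<open>b\<close>, all inequalities at an index of largest
  ratio would be equalities, so the largest ratio would be attained at all its successors too.
  By strong connectedness \<open>x\<close> would be a multiple of \<open>y\<close>, which the
  strict inequality at \<open>k\<close> forbids.
\<close>

lemma collatz_wielandt_less:
  fixes B :: "real^'n^'n"
  assumes B: "nonneg_mat B" and sc: "strongly_connected N (Restr (mat_edges B) N)"
    and x: "\<And>i. i \<in> N \<Longrightarrow> 0 < x $ i" and y: "\<And>i. i \<in> N \<Longrightarrow> 0 < y $ i"
    and ax: "\<And>i. i \<in> N \<Longrightarrow> a * x $ i \<le> (\<Sum>j\<in>N. B $ i $ j * x $ j)"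
    and bz: "\<And>i. i \<in> N \<Longrightarrow> (\<Sum>j\<in>N. B $ i $ j * y $ j) \<le> b * y $ i"
    and k: "k \<in> N" "(\<Sum>j\<in>N. B $ k $ j * y $ j) < b * y $ k"
  shows "a < b"
proof (rule ccontr)
  assume ab: "\<not> a < b"
  obtain i where i: "i \<in> N" "\<And>j. j \<in> N \<Longrightarrow> x $ j / y $ j \<le> x $ i / y $ i"
    using finite_max_exists[of N "\<lambda>i. x $ i / y $ i"] k(1) by auto
  define M where "M = x $ i / y $ i"
  have M: "0 < M" using x[OF i(1)] y[OF i(1)] by (simp add: M_def)
  have le: "x $ j \<le> M * y $ j" if "j \<in> N" for j
    using i(2)[OF that] y[OF that] by (simp add: M_def pos_divide_le_eq)
  have xi: "x $ i = M * y $ i" using y[OF i(1)] by (simp add: M_def)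
  have chain: "(\<Sum>j\<in>N. B $ l $ j * (M * y $ j - x $ j)) \<le> 0 \<and> b * y $ l \<le> (\<Sum>j\<in>N. B $ l $ j * y $ j)"
    if l: "l \<in> N" "x $ l = M * y $ l" for l
  proof -
    let ?X = "\<Sum>j\<in>N. B $ l $ j * x $ j" and ?Y = "\<Sum>j\<in>N. B $ l $ j * y $ j"
    have 1: "b * (M * y $ l) \<le> a * (M * y $ l)" using ab M y[OF l(1)] by (intro mult_right_mono) auto
    have 2: "a * (M * y $ l) \<le> ?X" using ax[OF l(1)] l(2) by simp
    have 3: "?X \<le> (\<Sum>j\<in>N. B $ l $ j * (M * y $ j))"
      by (intro sum_mono mult_left_mono le entry_nonneg[OF B])
    have 4: "(\<Sum>j\<in>N. B $ l $ j * (M * y $ j)) = M * ?Y" by (simp add: sum_distrib_left mult.left_commute)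
    have 5: "M * ?Y \<le> M * (b * y $ l)" using M bz[OF l(1)] by (intro mult_left_mono) auto
    have "M * (b * y $ l) \<le> M * ?Y" using 1 2 3 4 by (simp add: mult.left_commute)
    moreover have "(\<Sum>j\<in>N. B $ l $ j * (M * y $ j - x $ j)) = M * ?Y - ?X"
      by (simp add: 4[symmetric] right_diff_distrib sum_subtractf)
    moreover have "M * ?Y \<le> ?X" using 1 2 5 by (simp add: mult.left_commute)
    ultimately show ?thesis using M by simp
  qed
  have "x $ l = M * y $ l \<and> l \<in> N" if "(i, l) \<in> (Restr (mat_edges B) N)\<^sup>*" for l
    using that
  proof induction
    case (step l m)
    have nn: "0 \<le> B $ l $ j * (M * y $ j - x $ j)" if "j \<in> N" for j
      using le[OF that] by (intro mult_nonneg_nonneg entry_nonneg[OF B]) auto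
    have "B $ l $ m * (M * y $ m - x $ m) \<le> (\<Sum>j\<in>N. B $ l $ j * (M * y $ j - x $ j))"
      using step nn by (intro member_le_sum) auto
    moreover have "m \<in> N" "l \<in> N" using step by auto
    ultimately have "B $ l $ m * (M * y $ m - x $ m) = 0"
      using conjunct1[OF chain[of l]] step.IH nn[of m] by linarith
    then show ?case using step by (auto simp: mat_edges_def)
  qed (use i xi in auto)
  moreover have "(i, k) \<in> (Restr (mat_edges B) N)\<^sup>*"
    using sc i(1) k(1) unfolding strongly_connected_def by blast
  ultimately have "x $ k = M * y $ k" by blast
  then show False using chain[OF k(1)] k(2) by linarith
qed

text \<open>
  Brouwer's theorem, applied to \<open>x \<mapsto> (x + B x) / s x\<close> on the simplex of the
  nonnegative vectors supported in \<open>N\<close> with coordinate sum \<open>1\<close>, where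
  \<open>s x\<close> normalises the coordinate sum. The sum \<open>x + B x\<close> is the
  ordinary one in both algebras: it keeps \<open>s x \<ge> 1\<close> even where \<open>B
  x\<close> vanishes, and a fixed point satisfies \<open>B x = (s x - 1) x\<close>.
\<close>

lemma submatrix_eigval_exists:
  fixes B :: "real^'n^'n"
  assumes B: "nonneg_mat B" and "N \<noteq> {}"
  shows "\<exists>\<rho>. submatrix_eigval alg B N \<rho>"
proof -
  define S where "S = {x::real^'n. (\<forall>i. 0 \<le> x $ i) \<and> (\<forall>i. i \<notin> N \<longrightarrow> x $ i = 0) \<and> (\<Sum>i\<in>UNIV. x $ i) = 1}"
  define g where "g x = (\<chi> i. if i \<in> N then x $ i + alg_sum alg (\<lambda>j. B $ i $ j * x $ j) N else 0)"
    for x :: "real^'n"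
  define s where "s x = (\<Sum>i\<in>UNIV. g x $ i)" for x
  have Bx: "0 \<le> alg_sum alg (\<lambda>j. B $ i $ j * x $ j) N" if "x \<in> S" for x i
    using that by (intro alg_sum_nonneg) (auto simp: S_def entry_nonneg[OF B])
  have g_ge: "x $ i \<le> g x $ i" if "x \<in> S" for x i
    using Bx[OF that] that by (auto simp: g_def S_def)
  have s_ge: "1 \<le> s x" if "x \<in> S" for x
    using sum_mono[of UNIV "\<lambda>i. x $ i" "\<lambda>i. g x $ i"] g_ge[OF that] that by (simp add: s_def S_def)
  have "closed S" unfolding S_def
    by (intro closed_Collect_conj closed_Collect_all closed_Collect_imp open_Collect_const
        closed_Collect_le closed_Collect_eq continuous_intros)
  moreover have "bounded S"
  proof -
    have "norm x \<le> 1" if "x \<in> S" for x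
      using norm_le_l1_cart[of x] that by (simp add: S_def)
    then show ?thesis by (auto simp: bounded_iff)
  qed
  ultimately have "compact S" by (simp add: compact_eq_bounded_closed)
  moreover have "convex S"
    unfolding convex_def S_def by (auto simp: sum.distrib sum_distrib_left[symmetric])
  moreover have "S \<noteq> {}"
  proof -
    obtain i where "i \<in> N" using assms(2) by blast
    then have "axis i 1 \<in> S" by (auto simp: S_def axis_def)
    then show ?thesis by blast
  qed
  moreover have "continuous_on S (\<lambda>x. inverse (s x) *\<^sub>R g x)"
  proof -
    have "continuous_on S (\<lambda>x. alg_sum alg (\<lambda>j. B $ i $ j * x $ j) N)" for i
      unfolding continuous_on_def
      by (intro ballI alg_sum_tendsto) (auto intro!: tendsto_intros)
    then have "continuous_on S (\<lambda>x. if i \<in> N then x $ i + alg_sum alg (\<lambda>j. B $ i $ j * x $ j) N else 0)" for i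
      by (cases "i \<in> N") (auto intro!: continuous_intros)
    then have "continuous_on S g" unfolding g_def by (rule continuous_on_vec_lambda)
    moreover from this have "continuous_on S s" unfolding s_def by (intro continuous_intros)
    moreover have "s x \<noteq> 0" if "x \<in> S" for x using s_ge[OF that] by auto
    ultimately show ?thesis by (intro continuous_intros) auto
  qed
  moreover have "inverse (s x) *\<^sub>R g x \<in> S" if x: "x \<in> S" for x
  proof -
    have "0 \<le> g x $ i" for i using g_ge[OF x, of i] x by (auto simp: S_def intro: order.trans)
    moreover have "(\<Sum>i\<in>UNIV. inverse (s x) * g x $ i) = 1"
      unfolding sum_distrib_left[symmetric] s_def[symmetric] using s_ge[OF x] by simp
    moreover have "0 \<le> inverse (s x)" using s_ge[OF x] by simp
    ultimately show ?thesis unfolding S_def by (auto simp: g_def)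
  qed
  ultimately obtain x where x: "x \<in> S" "inverse (s x) *\<^sub>R g x = x"
    using brouwer[of S "\<lambda>x. inverse (s x) *\<^sub>R g x"] by blast
  have "g x = s x *\<^sub>R x" using x(2) s_ge[OF x(1)]
    by (metis inverse_eq_divide not_one_le_zero scaleR_one scaleR_scaleR right_inverse)
  then have eq: "x $ i + alg_sum alg (\<lambda>j. B $ i $ j * x $ j) N = s x * x $ i" if "i \<in> N" for i
    using that by (auto simp: vec_eq_iff g_def split: if_splits)
  have "\<exists>i\<in>N. x $ i \<noteq> 0"
    using x(1) unfolding S_def by (metis (mono_tags, lifting) mem_Collect_eq sum.neutral zero_neq_one)
  moreover have "alg_sum alg (\<lambda>j. B $ i $ j * x $ j) N = (s x - 1) * x $ i" if "i \<in> N" for i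
    using eq[OF that] by (simp add: algebra_simps)
  ultimately have "submatrix_eigval alg B N (s x - 1)"
    unfolding submatrix_eigval_def using s_ge[OF x(1)] x(1) by (auto simp: S_def)
  then show ?thesis ..
qed

text \<open>
  Positivity spreads from an index to its predecessors. For \<open>\<rho> = 0\<close> the
  support cannot have a predecessor at all, and the block is a single node.
\<close>

lemma submatrix_eigvec_pos:
  fixes B :: "real^'n^'n"
  assumes B: "nonneg_mat B" and sc: "strongly_connected N (Restr (mat_edges B) N)"
    and x: "\<And>i. i \<in> N \<Longrightarrow> 0 \<le> x $ i" "k \<in> N" "x $ k \<noteq> 0" and "0 \<le> \<rho>"
    and eq: "\<And>i. i \<in> N \<Longrightarrow> alg_sum alg (\<lambda>j. B $ i $ j * x $ j) N = \<rho> * x $ i"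
    and i: "i \<in> N"
  shows "0 < x $ i"
proof -
  have pos: "0 < \<rho> * x $ l" if "(l, m) \<in> Restr (mat_edges B) N" "0 < x $ m" for l m
  proof -
    have "0 < B $ l $ m" using that entry_nonneg[OF B, of l m] by (auto simp: mat_edges_def)
    then have "\<exists>j\<in>N. 0 < B $ l $ j * x $ j" using that by (intro bexI[of _ m]) auto
    then have "0 < alg_sum alg (\<lambda>j. B $ l $ j * x $ j) N" using x(1)
      by (subst alg_sum_pos_iff) (auto simp: entry_nonneg[OF B])
    then show ?thesis using eq that(1) by auto
  qed
  have "(i, k) \<in> (Restr (mat_edges B) N)\<^sup>*" using sc i x(2) by (auto simp: strongly_connected_def)
  then show ?thesis
  proof (induction rule: converse_rtrancl_induct)
    case base
    show ?case using x(1)[OF x(2)] x(3) by simp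
  next
    case (step l m)
    then show ?case using pos[OF step(1) step.IH] \<open>0 \<le> \<rho>\<close> by (simp add: zero_less_mult_iff)
  qed
qed

context
  fixes B :: "real^'n^'n" and N :: "'n set"
  assumes B: "nonneg_mat B" and sc: "strongly_connected N (Restr (mat_edges B) N)" and ne: "N \<noteq> {}"
begin

text \<open>
  The Perron root is defined by a definite description; eigenvectors of an irreducible block are
  positive, so any two eigenvalues can be compared both ways.
\<close>

lemma perron_root_eigval: "submatrix_eigval alg B N (perron_root alg B N)"
proof -
  obtain \<rho> where \<rho>: "submatrix_eigval alg B N \<rho>" using submatrix_eigval_exists[OF B ne] by blast
  have le: "a \<le> b" if ab: "submatrix_eigval alg B N a" "submatrix_eigval alg B N b" for a b
  proof -
    obtain x where x: "\<forall>i\<in>N. 0 \<le> x $ i" "\<exists>i\<in>N. x $ i \<noteq> 0"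
      "\<forall>i\<in>N. alg_sum alg (\<lambda>j. B $ i $ j * x $ j) N = a * x $ i"
      using ab(1) unfolding submatrix_eigval_def by blast
    obtain y where y: "\<forall>i\<in>N. 0 \<le> y $ i" "\<exists>i\<in>N. y $ i \<noteq> 0" "0 \<le> b"
      "\<forall>i\<in>N. alg_sum alg (\<lambda>j. B $ i $ j * y $ j) N = b * y $ i"
      using ab(2) unfolding submatrix_eigval_def by blast
    obtain k where k: "k \<in> N" "x $ k \<noteq> 0" using x(2) by blast
    obtain l where l: "l \<in> N" "y $ l \<noteq> 0" using y(2) by blast
    have ypos: "0 < y $ i" if "i \<in> N" for i
      using submatrix_eigvec_pos[OF B sc, where x = y and k = l and \<rho> = b and alg = alg and i = i] y l that by auto
    show ?thesis
      using collatz_wielandt_le[OF B, of N x k y a alg b] x k y ypos by auto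
  qed
  have "\<exists>!\<rho>. submatrix_eigval alg B N \<rho>" using \<rho> le by (intro ex1I[of _ \<rho>]) (auto intro: order.antisym)
  then show ?thesis unfolding perron_root_def by (rule theI')
qed

lemma perron_root_nonneg: "0 \<le> perron_root alg B N"
  using perron_root_eigval by (auto simp: submatrix_eigval_def)

lemma perron_vector_exists:
  "\<exists>v. \<forall>i\<in>N. 0 < v $ i \<and> alg_sum alg (\<lambda>j. B $ i $ j * v $ j) N = perron_root alg B N * v $ i"
proof -
  obtain v k where v: "\<forall>i\<in>N. 0 \<le> v $ i" "k \<in> N" "v $ k \<noteq> 0"
    "\<forall>i\<in>N. alg_sum alg (\<lambda>j. B $ i $ j * v $ j) N = perron_root alg B N * v $ i"
    using perron_root_eigval[of alg] unfolding submatrix_eigval_def by blast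
  have "0 < v $ i" if "i \<in> N" for i
    using submatrix_eigvec_pos[OF B sc, where x = v and k = k and i = i] v that perron_root_nonneg by blast
  then show ?thesis using v by blast
qed

lemma perron_root_le:
  assumes "\<And>i. i \<in> N \<Longrightarrow> 0 < y $ i" "\<And>i. i \<in> N \<Longrightarrow> alg_sum alg (\<lambda>j. B $ i $ j * y $ j) N \<le> b * y $ i"
  shows "perron_root alg B N \<le> b"
proof -
  obtain v where v: "\<forall>i\<in>N. 0 < v $ i \<and> alg_sum alg (\<lambda>j. B $ i $ j * v $ j) N = perron_root alg B N * v $ i"
    using perron_vector_exists by blast
  obtain k where k: "k \<in> N" using ne by blast
  then have vk: "v $ k \<noteq> 0" using v by force
  show ?thesis
    by (rule collatz_wielandt_le[OF B, where x = v and k = k and y = y and N = N and alg = alg])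
       (use v k vk assms in \<open>auto simp: less_imp_le\<close>)
qed

lemma perron_root_ge:
  assumes "\<And>i. i \<in> N \<Longrightarrow> 0 \<le> x $ i" "k \<in> N" "x $ k \<noteq> 0"
    "\<And>i. i \<in> N \<Longrightarrow> a * x $ i \<le> alg_sum alg (\<lambda>j. B $ i $ j * x $ j) N"
  shows "a \<le> perron_root alg B N"
proof -
  obtain v where v: "\<forall>i\<in>N. 0 < v $ i \<and> alg_sum alg (\<lambda>j. B $ i $ j * v $ j) N = perron_root alg B N * v $ i"
    using perron_vector_exists by blast
  show ?thesis
    by (rule collatz_wielandt_le[OF B, where x = x and k = k and y = v and N = N and alg = alg])
       (use v assms in auto)
qed

lemma perron_root_less:
  assumes "\<And>i. i \<in> N \<Longrightarrow> 0 < y $ i" "\<And>i. i \<in> N \<Longrightarrow> (\<Sum>j\<in>N. B $ i $ j * y $ j) \<le> b * y $ i"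
    and "k \<in> N" "(\<Sum>j\<in>N. B $ k $ j * y $ j) < b * y $ k"
  shows "perron_root Nonneg_Algebra B N < b"
proof -
  obtain v where v: "\<forall>i\<in>N. 0 < v $ i \<and> alg_sum Nonneg_Algebra (\<lambda>j. B $ i $ j * v $ j) N
      = perron_root Nonneg_Algebra B N * v $ i"
    using perron_vector_exists by blast
  show ?thesis
    by (rule collatz_wielandt_less[OF B sc, where x = v and y = y and k = k]) (use v assms in auto)
qed

end

lemma class_strongly_connected:
  assumes "\<mu> \<in> classes B"
  shows "strongly_connected \<mu> (Restr (mat_edges B) \<mu>)" "\<mu> \<noteq> {}"
  using assms component_strongly_connected[of "mat_edges B" UNIV] component_nonempty
  by (auto simp: classes_def)

lemma class_eq: "\<mu> \<in> classes B \<Longrightarrow> i \<in> \<mu> \<Longrightarrow> \<mu> = {j. (i, j) \<in> (mat_edges B)\<^sup>* \<and> (j, i) \<in> (mat_edges B)\<^sup>*}"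
  unfolding classes_def by (drule component_eq) auto

lemma class_exists: "\<exists>\<mu>\<in>classes B. i \<in> \<mu>"
  unfolding classes_def by (rule component_exists) auto

lemma accesses_iff:
  assumes "\<mu> \<in> classes B" "\<nu> \<in> classes B"
  shows "accesses B \<mu> \<nu> \<longleftrightarrow> (\<exists>i\<in>\<mu>. \<exists>j\<in>\<nu>. (i, j) \<in> (mat_edges B)\<^sup>*)"
proof
  assume "accesses B \<mu> \<nu>"
  then show "\<exists>i\<in>\<mu>. \<exists>j\<in>\<nu>. (i, j) \<in> (mat_edges B)\<^sup>*"
    unfolding accesses_def using class_strongly_connected(2)[OF assms(1)]
    by (auto dest: trancl_into_rtrancl)
next
  assume "\<exists>i\<in>\<mu>. \<exists>j\<in>\<nu>. (i, j) \<in> (mat_edges B)\<^sup>*"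
  then show "accesses B \<mu> \<nu>"
    unfolding accesses_def using class_eq[OF assms(1)] class_eq[OF assms(2)] by (metis rtranclD)
qed

lemma node_accesses_iff:
  assumes "\<nu> \<in> classes B"
  shows "node_accesses B i \<nu> \<longleftrightarrow> (\<exists>j\<in>\<nu>. (i, j) \<in> (mat_edges B)\<^sup>*)"
proof
  assume "node_accesses B i \<nu>"
  then show "\<exists>j\<in>\<nu>. (i, j) \<in> (mat_edges B)\<^sup>*"
    unfolding node_accesses_def using accesses_iff[OF _ assms] class_eq
    by (smt (verit) mem_Collect_eq rtrancl_trans)
next
  assume "\<exists>j\<in>\<nu>. (i, j) \<in> (mat_edges B)\<^sup>*"
  then show "node_accesses B i \<nu>"
    unfolding node_accesses_def using class_exists[of B i] accesses_iff[OF _ assms] by blast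
qed

lemma mat_edges_scale: "c \<noteq> 0 \<Longrightarrow> mat_edges (c *\<^sub>R B) = mat_edges B"
  by (simp add: mat_edges_def)

lemma classes_scale: "c \<noteq> 0 \<Longrightarrow> classes (c *\<^sub>R B) = classes B"
  by (simp add: classes_def mat_edges_scale)

lemma perron_root_scale:
  assumes B: "nonneg_mat B" and c: "0 < c" and \<mu>: "\<mu> \<in> classes B"
  shows "perron_root alg (c *\<^sub>R B) \<mu> = c * perron_root alg B \<mu>"
proof -
  note sc = class_strongly_connected[OF \<mu>]
  obtain v where v: "\<forall>i\<in>\<mu>. 0 < v $ i \<and> alg_sum alg (\<lambda>j. B $ i $ j * v $ j) \<mu> = perron_root alg B \<mu> * v $ i"
    using perron_vector_exists[OF B sc] by blast
  have cB: "nonneg_mat (c *\<^sub>R B)" using B c by (intro nonneg_mat_scale) auto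
  have sc': "strongly_connected \<mu> (Restr (mat_edges (c *\<^sub>R B)) \<mu>)" using sc c by (simp add: mat_edges_scale)
  have eq: "alg_sum alg (\<lambda>j. (c *\<^sub>R B) $ i $ j * v $ j) \<mu> = (c * perron_root alg B \<mu>) * v $ i" if "i \<in> \<mu>" for i
    using v that c alg_sum_mult[of c \<mu> alg "\<lambda>j. B $ i $ j * v $ j"] by (simp add: mult.assoc)
  obtain k where k: "k \<in> \<mu>" using sc(2) by blast
  show ?thesis
  proof (rule order.antisym)
    show "perron_root alg (c *\<^sub>R B) \<mu> \<le> c * perron_root alg B \<mu>"
      by (rule perron_root_le[OF cB sc' sc(2), where y = v]) (use v eq in auto)
    show "c * perron_root alg B \<mu> \<le> perron_root alg (c *\<^sub>R B) \<mu>"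
    proof (rule perron_root_ge[OF cB sc' sc(2), where x = v and k = k])
      show "v $ k \<noteq> 0" using v k by force
    qed (use v eq k in \<open>auto simp: less_imp_le\<close>)
  qed
qed

lemma spectral_class_scale:
  assumes B: "nonneg_mat B" and \<rho>: "0 < \<rho>"
  shows "spectral_class alg (inverse \<rho> *\<^sub>R B) 1 \<nu> \<longleftrightarrow> spectral_class alg B \<rho> \<nu>"
proof (cases "\<nu> \<in> classes B")
  case True
  note pr = perron_root_scale[OF B, of "inverse \<rho>"]
  have "accesses (inverse \<rho> *\<^sub>R B) = accesses B" using \<rho> by (auto simp: accesses_def mat_edges_scale fun_eq_iff)
  then have "dominates alg (inverse \<rho> *\<^sub>R B) \<nu> \<longleftrightarrow> dominates alg B \<nu>"
    using \<rho> True by (cases alg) (auto simp: classes_scale pr)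
  moreover have "perron_root alg (inverse \<rho> *\<^sub>R B) \<nu> = 1 \<longleftrightarrow> perron_root alg B \<nu> = \<rho>"
    using \<rho> pr[OF _ True, of alg] by (auto simp: field_simps)
  ultimately show ?thesis using \<rho> True
    by (auto simp: spectral_class_def classes_scale)
next
  case False
  then show ?thesis using \<rho> by (auto simp: spectral_class_def classes_scale)
qed

text \<open>
  Passing to \<open>B / \<rho>\<close> reduces everything to the eigenvalue \<open>1\<close>.
\<close>

lemma sigma_num_scale:
  assumes B: "nonneg_mat B" and \<rho>: "0 < \<rho>"
  shows "sigma_num alg B \<rho> = sigma_num alg (inverse \<rho> *\<^sub>R B) 1"
proof (cases alg)
  case Nonneg_Algebra
  then show ?thesis using \<rho> by (simp add: spectral_class_scale[OF B] mat_edges_scale)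
next
  case Max_Algebra
  have acc: "accesses (inverse \<rho> *\<^sub>R B) = accesses B" using \<rho> by (auto simp: accesses_def mat_edges_scale fun_eq_iff)
  have "accessing_nodes (inverse \<rho> *\<^sub>R B) 1 = accessing_nodes B \<rho>" using \<rho>
    by (simp add: accessing_nodes_def spectral_class_scale[OF B] node_accesses_def classes_scale acc)
  then have "scaled_submatrix (inverse \<rho> *\<^sub>R B) 1 = scaled_submatrix B \<rho>"
    by (simp add: scaled_submatrix_def vec_eq_iff)
  then show ?thesis using Max_Algebra by simp
qed

section \<open>A superharmonic vector for a spectral class\<close>

definition access_set :: "real^'n^'n \<Rightarrow> 'n set \<Rightarrow> 'n set" where
  "access_set B \<nu> = {i. \<exists>j\<in>\<nu>. (i, j) \<in> (mat_edges B)\<^sup>*}"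

lemma access_set_pred: "B $ i $ j \<noteq> 0 \<Longrightarrow> j \<in> access_set B \<nu> \<Longrightarrow> i \<in> access_set B \<nu>"
  by (auto simp: access_set_def mat_edges_def intro: converse_rtrancl_into_rtrancl)

lemma access_set_superset: "\<nu> \<subseteq> access_set B \<nu>"
  by (auto simp: access_set_def)

lemma access_set_successor:
  assumes "\<nu> \<in> classes B" "i \<in> \<nu>" "B $ i $ j \<noteq> 0" "j \<in> access_set B \<nu>"
  shows "j \<in> \<nu>"
proof -
  obtain k where k: "k \<in> \<nu>" "(j, k) \<in> (mat_edges B)\<^sup>*" using assms(4) by (auto simp: access_set_def)
  then have "(k, i) \<in> (mat_edges B)\<^sup>*" using class_eq[OF assms(1) k(1)] assms(2) by blast
  then have "(j, i) \<in> (mat_edges B)\<^sup>*" using k(2) by (rule rtrancl_trans[rotated])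
  moreover have "(i, j) \<in> (mat_edges B)\<^sup>*" using assms(3) by (auto simp: mat_edges_def)
  ultimately show ?thesis using class_eq[OF assms(1,2)] by blast
qed

lemma class_perron_vectors_exist:
  assumes B: "nonneg_mat B"
  shows "\<exists>v. \<forall>\<mu>\<in>classes B. \<forall>i\<in>\<mu>.
    0 < v $ i \<and> alg_sum alg (\<lambda>j. B $ i $ j * v $ j) \<mu> = perron_root alg B \<mu> * v $ i"
proof -
  define good where "good \<mu> v \<longleftrightarrow> (\<forall>i\<in>\<mu>. 0 < v $ i \<and>
    alg_sum alg (\<lambda>j. B $ i $ j * v $ j) \<mu> = perron_root alg B \<mu> * v $ i)" for \<mu> v
  have "\<exists>v. good \<mu> v" if "\<mu> \<in> classes B" for \<mu>
    unfolding good_def by (rule perron_vector_exists[OF B class_strongly_connected[OF that]])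
  then obtain w where w: "\<And>\<mu>. \<mu> \<in> classes B \<Longrightarrow> good \<mu> (w \<mu>)" by metis
  obtain c where c: "\<And>i. c i \<in> classes B" "\<And>i. i \<in> c i" using class_exists[of B] by metis
  have c_eq: "c i = \<mu>" if "\<mu> \<in> classes B" "i \<in> \<mu>" for \<mu> i
    using class_eq[OF that] class_eq[OF c(1) c(2), of i] by simp
  define v where "v = (\<chi> i. w (c i) $ i)"
  have "good \<mu> v" if \<mu>: "\<mu> \<in> classes B" for \<mu>
  proof -
    have v: "v $ i = w \<mu> $ i" if "i \<in> \<mu>" for i using c_eq[OF \<mu> that] by (simp add: v_def)
    then have "alg_sum alg (\<lambda>j. B $ i $ j * v $ j) \<mu> = alg_sum alg (\<lambda>j. B $ i $ j * w \<mu> $ j) \<mu>" for i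
      by (intro alg_sum_cong) auto
    then show ?thesis using w[OF \<mu>] v by (simp add: good_def)
  qed
  then show ?thesis unfolding good_def by blast
qed

text \<open>
  Glue the Perron vectors \<open>v\<close> of all classes that access \<open>\<nu>\<close> with
  the weights \<open>K ^ h i\<close>, where \<open>h i\<close> is the number of nodes that
  \<open>i\<close> reaches. This number is constant on classes and drops along every edge that
  leaves a class. So for large \<open>K\<close> the contribution of the other classes to
  \<open>(B u)\<^sub>i\<close> is small against \<open>u\<^sub>i\<close>. In nonnegative algebra
  it fits into the gap left by the Perron root of the class of \<open>i\<close>, which is less
  than \<open>1\<close> by the domination condition; in max algebra a root \<open>\<le>
  1\<close> is enough, as the maximum of two terms that are at most \<open>u\<^sub>i\<close> is
  at most \<open>u\<^sub>i\<close>. On \<open>\<nu>\<close> itself no other class contributes.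
\<close>

lemma superharmonic_vector_exists:
  fixes B :: "real^'n^'n"
  assumes B: "nonneg_mat B" and \<nu>: "spectral_class alg B 1 \<nu>"
  shows "\<exists>u. (\<forall>i. i \<in> access_set B \<nu> \<longrightarrow> 0 < u $ i) \<and> (\<forall>i. i \<notin> access_set B \<nu> \<longrightarrow> u $ i = 0) \<and>
    alg_mult_vec alg B u \<le> u \<and> (\<forall>i\<in>\<nu>. alg_mult_vec alg B u $ i = u $ i)"
proof -
  define S where "S = access_set B \<nu>"
  note Bn = entry_nonneg[OF B]
  have \<nu>c: "\<nu> \<in> classes B" and \<nu>1: "perron_root alg B \<nu> = 1" and dom: "dominates alg B \<nu>"
    using \<nu> by (auto simp: spectral_class_def)
  obtain v where v: "\<And>\<mu> i. \<mu> \<in> classes B \<Longrightarrow> i \<in> \<mu> \<Longrightarrow> 0 < v $ i"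
    "\<And>\<mu> i. \<mu> \<in> classes B \<Longrightarrow> i \<in> \<mu> \<Longrightarrow>
      alg_sum alg (\<lambda>j. B $ i $ j * v $ j) \<mu> = perron_root alg B \<mu> * v $ i"
    using class_perron_vectors_exist[OF B, of alg] by metis
  have vpos: "0 < v $ i" for i using class_exists[of B i] v(1) by blast
  (* constant on classes, decreasing along edges that leave a class *)
  define h where "h i = card {j. (i, j) \<in> (mat_edges B)\<^sup>*}" for i
  have h_mono: "h j \<le> h i" if "(i, j) \<in> (mat_edges B)\<^sup>*" for i j
    unfolding h_def using that by (intro card_mono) (auto intro: rtrancl_trans)
  have h_less: "h j < h i" if "(i, j) \<in> (mat_edges B)\<^sup>*" "(j, i) \<notin> (mat_edges B)\<^sup>*" for i j
    unfolding h_def using that by (intro psubset_card_mono) (auto intro: rtrancl_trans)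
  define C where "C i = alg_sum alg (\<lambda>j. B $ i $ j * v $ j) UNIV" for i
  have "\<forall>\<^sub>F K in at_top. \<forall>i\<in>S - \<nu>. \<forall>\<mu>\<in>classes B. i \<in> \<mu> \<longrightarrow>
      alg_add alg (perron_root alg B \<mu> * v $ i) (inverse K * C i) \<le> v $ i"
  proof (intro eventually_ball_finite ballI finite)
    fix i \<mu> assume i: "i \<in> S - \<nu>" and \<mu>: "\<mu> \<in> classes B"
    have lim: "((\<lambda>K. inverse K * C i) \<longlongrightarrow> 0 * C i) at_top"
      by (intro tendsto_mult tendsto_const tendsto_inverse_0_at_top filterlim_ident)
    show "\<forall>\<^sub>F K in at_top. i \<in> \<mu> \<longrightarrow>
      alg_add alg (perron_root alg B \<mu> * v $ i) (inverse K * C i) \<le> v $ i"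
    proof (cases "i \<in> \<mu>")
      case True
      have acc: "accesses B \<mu> \<nu>" "\<mu> \<noteq> \<nu>"
        using accesses_iff[OF \<mu> \<nu>c] True i by (auto simp: S_def access_set_def)
      show ?thesis
      proof (cases alg)
        case Nonneg_Algebra
        then have "perron_root alg B \<mu> < 1" using dom acc \<mu> \<nu>1 by auto
        then have "0 * C i < v $ i - perron_root alg B \<mu> * v $ i"
          using vpos[of i] by simp
        from order_tendstoD(2)[OF lim this] show ?thesis
          by (rule eventually_mono) (simp add: Nonneg_Algebra)
      next
        case Max_Algebra
        then have le: "perron_root alg B \<mu> \<le> 1" using dom acc \<mu> \<nu>1 by auto
        have "0 * C i < v $ i" using vpos[of i] by simp
        from order_tendstoD(2)[OF lim this] show ?thesis
          by (rule eventually_mono) (use le vpos[of i] in \<open>simp add: Max_Algebra mult_left_le_one_le perron_root_nonneg[OF B class_strongly_connected[OF \<mu>]]\<close>)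
      qed
    qed simp
  qed
  then have "\<forall>\<^sub>F K in at_top. 1 \<le> K \<and> (\<forall>i\<in>S - \<nu>. \<forall>\<mu>\<in>classes B. i \<in> \<mu> \<longrightarrow>
      alg_add alg (perron_root alg B \<mu> * v $ i) (inverse K * C i) \<le> v $ i)"
    by (intro eventually_conj eventually_ge_at_top)
  then obtain K where K: "1 \<le> K" "\<And>i \<mu>. i \<in> S - \<nu> \<Longrightarrow> \<mu> \<in> classes B \<Longrightarrow> i \<in> \<mu> \<Longrightarrow>
      alg_add alg (perron_root alg B \<mu> * v $ i) (inverse K * C i) \<le> v $ i"
    using eventually_happens by (metis (no_types, lifting) trivial_limit_at_top_linorder)
  define u where "u = (\<chi> i. if i \<in> S then K ^ h i * v $ i else 0)"
  have u_nn: "0 \<le> u $ i" for i using K(1) vpos[of i] by (simp add: u_def)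
  have on_\<nu>: "alg_mult_vec alg B u $ i = u $ i" if i: "i \<in> \<nu>" for i
  proof -
    have "alg_sum alg (\<lambda>j. B $ i $ j * u $ j) UNIV = alg_sum alg (\<lambda>j. B $ i $ j * u $ j) \<nu>"
      using access_set_successor[OF \<nu>c i]
      by (intro alg_sum_mono_neutral) (auto simp: u_def S_def)
    also have "\<dots> = alg_sum alg (\<lambda>j. K ^ h i * (B $ i $ j * v $ j)) \<nu>"
    proof (rule alg_sum_cong[OF refl])
      fix j assume j: "j \<in> \<nu>"
      have "(i, j) \<in> (mat_edges B)\<^sup>*" "(j, i) \<in> (mat_edges B)\<^sup>*"
        using class_eq[OF \<nu>c i] j by blast+
      then have "h j = h i" using h_mono by (simp add: order.antisym)
      then show "B $ i $ j * u $ j = K ^ h i * (B $ i $ j * v $ j)"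
        using j access_set_superset[of \<nu> B] by (auto simp: u_def S_def)
    qed
    also have "\<dots> = K ^ h i * v $ i" using K(1) v(2)[OF \<nu>c i] by (simp add: alg_sum_mult \<nu>1)
    finally show ?thesis using i access_set_superset[of \<nu> B] by (auto simp: u_def S_def mult_vec_nth)
  qed
  have "alg_mult_vec alg B u $ i \<le> u $ i" for i
  proof (cases "i \<in> S")
    case False
    then have "B $ i $ j * u $ j = 0" for j using access_set_pred[of B i j \<nu>] by (auto simp: u_def S_def)
    then have "(\<lambda>j. B $ i $ j * u $ j) = (\<lambda>j. 0)" by (rule ext)
    then have "alg_mult_vec alg B u $ i = 0" by (simp only: mult_vec_nth alg_sum_zero)
    then show ?thesis using u_nn by simp
  next
    case True
    show ?thesis
    proof (cases "i \<in> \<nu>")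
      case False
      obtain \<mu> where \<mu>: "\<mu> \<in> classes B" "i \<in> \<mu>" using class_exists by blast
      have "alg_mult_vec alg B u $ i \<le> alg_sum alg (\<lambda>j. K ^ h i *
          alg_add alg (if j \<in> \<mu> then B $ i $ j * v $ j else 0) (inverse K * (B $ i $ j * v $ j))) UNIV"
        unfolding mult_vec_nth
      proof (rule alg_sum_mono[OF finite])
        fix j
        have nn: "0 \<le> B $ i $ j * v $ j" using Bn vpos[of j] by (simp add: less_imp_le)
        show "B $ i $ j * u $ j \<le> K ^ h i *
          alg_add alg (if j \<in> \<mu> then B $ i $ j * v $ j else 0) (inverse K * (B $ i $ j * v $ j))"
        proof (cases "B $ i $ j = 0 \<or> j \<notin> S")
          case True
          moreover have "0 \<le> alg_add alg (if j \<in> \<mu> then B $ i $ j * v $ j else 0) (inverse K * (B $ i $ j * v $ j))"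
            using nn K(1) by (intro alg_add_nonneg) auto
          ultimately show ?thesis using K(1) by (auto simp: u_def)
        next
          case False
          then have ij: "(i, j) \<in> (mat_edges B)\<^sup>*" by (auto simp: mat_edges_def)
          show ?thesis
          proof (cases "j \<in> \<mu>")
            case True
            have "B $ i $ j * u $ j \<le> K ^ h i * (B $ i $ j * v $ j)"
              using power_increasing[OF h_mono[OF ij] K(1)] nn False
              by (auto simp: u_def mult.left_commute[of "B $ i $ j"] intro!: mult_right_mono)
            also have "\<dots> \<le> K ^ h i * alg_add alg (B $ i $ j * v $ j) (inverse K * (B $ i $ j * v $ j))"
              using nn K(1) by (intro mult_left_mono) (cases alg; auto)+
            finally show ?thesis using True by simp
          next
            case False': False
            then have "(j, i) \<notin> (mat_edges B)\<^sup>*" using class_eq[OF \<mu>] ij by blast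
            then have "Suc (h j) \<le> h i" using h_less[OF ij] by simp
            then have "K ^ Suc (h j) \<le> K ^ h i" using K(1) by (rule power_increasing)
            then have "K ^ h j \<le> K ^ h i * inverse K" using K(1) by (simp add: field_simps)
            then have "K ^ h j * (B $ i $ j * v $ j) \<le> K ^ h i * inverse K * (B $ i $ j * v $ j)"
              using nn by (rule mult_right_mono)
            moreover have "alg_add alg 0 (inverse K * (B $ i $ j * v $ j)) = inverse K * (B $ i $ j * v $ j)"
              using nn K(1) by (cases alg) auto
            ultimately show ?thesis using False False' by (simp add: u_def mult_ac)
          qed
        qed
      qed
      also have "\<dots> = K ^ h i * alg_add alg (perron_root alg B \<mu> * v $ i) (inverse K * C i)"
      proof -
        have "alg_sum alg (\<lambda>j. if j \<in> \<mu> then B $ i $ j * v $ j else 0) UNIV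
            = alg_sum alg (\<lambda>j. if j \<in> \<mu> then B $ i $ j * v $ j else 0) \<mu>"
          by (intro alg_sum_mono_neutral) auto
        also have "\<dots> = alg_sum alg (\<lambda>j. B $ i $ j * v $ j) \<mu>" by (intro alg_sum_cong) auto
        finally show ?thesis using K(1) v(2)[OF \<mu>]
          by (simp add: alg_sum_mult alg_sum_add C_def)
      qed
      also have "\<dots> \<le> K ^ h i * v $ i"
        using K(1) K(2)[of i \<mu>] True False \<mu> by (intro mult_left_mono) auto
      finally show ?thesis using True by (simp add: u_def)
    qed (simp add: on_\<nu>)
  qed
  moreover have "0 < u $ i" if "i \<in> S" for i using K(1) vpos[of i] that by (simp add: u_def)
  moreover have "u $ i = 0" if "i \<notin> S" for i using that by (simp add: u_def)
  ultimately show ?thesis using on_\<nu> unfolding S_def by (intro exI[of _ u]) (auto simp: less_eq_vec_def)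
qed

section \<open>Periodic vectors\<close>

lemma funpow_periodic:
  assumes "(f ^^ m) x = x"
  shows "(f ^^ (a + m * k)) x = (f ^^ a) x"
proof -
  have "((f ^^ m) ^^ k) x = x" using assms by (induction k) auto
  then show ?thesis by (simp add: funpow_add funpow_mult)
qed

lemma funpow_cong:
  assumes "(f ^^ m) x = x" "[a = b] (mod m)"
  shows "(f ^^ a) x = (f ^^ b) x"
proof -
  have "(f ^^ a) x = (f ^^ (a mod m)) x" for a
    using funpow_periodic[OF assms(1), of "a mod m" "a div m"] by simp
  then show ?thesis using assms(2) by (metis cong_def)
qed

text \<open>
  The sum of \<open>x\<close> over its orbit. It serves as a reference vector: relative to it,
  \<open>B\<close> acts on the support of \<open>y\<close> like a stochastic matrix.
\<close>

lemma periodic_vector_dominated_by_fixed_vector: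
  fixes B :: "real^'n^'n"
  assumes B: "nonneg_mat B" and x: "nonneg_vec x" and m: "0 < m" "(alg_mult_vec alg B ^^ m) x = x"
  obtains y where "nonneg_vec y" "alg_mult_vec alg B y = y" "\<And>a. (alg_mult_vec alg B ^^ a) x \<le> y"
proof
  let ?T = "alg_mult_vec alg B"
  define y where "y = (\<chi> i. alg_sum alg (\<lambda>a. (?T ^^ a) x $ i) {..<m})"
  have X: "0 \<le> (?T ^^ a) x $ i" for a i
    using mult_vec_pow_nonneg[OF B x] by (auto simp: nonneg_vec_def)
  show "nonneg_vec y" unfolding nonneg_vec_def y_def by (auto intro: alg_sum_nonneg X)
  have inj: "inj_on (\<lambda>a. Suc a mod m) {..<m}" and img: "(\<lambda>a. Suc a mod m) ` {..<m} = {..<m}"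
    using Suc_mod_bij[OF m(1)] by (auto simp: bij_betw_def)
  have shift: "(?T ^^ Suc a) x = (?T ^^ (Suc a mod m)) x" for a
    by (rule funpow_cong[OF m(2)]) (simp add: cong_def)
  have "?T y $ i = y $ i" for i
  proof -
    have "?T y $ i = alg_sum alg (\<lambda>a. (?T ^^ Suc a) x $ i) {..<m}"
      unfolding y_def by (simp add: mult_vec_alg_sum[OF B])
    also have "\<dots> = alg_sum alg (\<lambda>a. (?T ^^ (Suc a mod m)) x $ i) {..<m}"
      unfolding shift ..
    also have "\<dots> = alg_sum alg (\<lambda>a. (?T ^^ a) x $ i) ((\<lambda>a. Suc a mod m) ` {..<m})"
      by (rule alg_sum_reindex[OF inj, symmetric])
    finally show ?thesis unfolding img by (simp add: y_def)
  qed
  then show "?T y = y" by (simp add: vec_eq_iff)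
  show "(?T ^^ a) x \<le> y" for a
  proof -
    have "(?T ^^ a) x = (?T ^^ (a mod m)) x" by (rule funpow_cong[OF m(2)]) (simp add: cong_def)
    moreover have "(?T ^^ (a mod m)) x $ i \<le> y $ i" for i
      unfolding y_def vec_lambda_beta
      by (rule alg_sum_upper[where f = "\<lambda>a. (?T ^^ a) x $ i"]) (use m(1) X in auto)
    ultimately show ?thesis by (simp add: less_eq_vec_def)
  qed
qed

lemma pow_pos_walk:
  assumes B: "nonneg_mat B" and w: "nonneg_vec w" and "0 < (alg_mult_vec alg B ^^ k) w $ i"
  shows "\<exists>j. 0 < w $ j \<and> (i, j) \<in> mat_edges B ^^ k"
  using assms(3)
proof (induction k arbitrary: i)
  case (Suc k)
  have nn: "0 \<le> (alg_mult_vec alg B ^^ k) w $ j" for j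
    using mult_vec_pow_nonneg[OF B w] by (auto simp: nonneg_vec_def)
  have "\<exists>j. 0 < B $ i $ j * (alg_mult_vec alg B ^^ k) w $ j"
    using Suc.prems nn by (auto simp: mult_vec_nth alg_sum_pos_iff entry_nonneg[OF B])
  then obtain l where l: "0 < B $ i $ l * (alg_mult_vec alg B ^^ k) w $ l" by blast
  then have "(i, l) \<in> mat_edges B" "0 < (alg_mult_vec alg B ^^ k) w $ l"
    using nn[of l] by (auto simp: mat_edges_def zero_less_mult_iff)
  then show ?case using Suc.IH by (blast intro: relpow_Suc_I2)
qed auto

lemma superharmonic_entry:
  assumes "nonneg_mat B" "nonneg_vec u" "alg_mult_vec alg B u \<le> u"
  shows "B $ i $ j * u $ j \<le> u $ i"
  using mult_vec_ge_entry[OF assms(1,2), of i j alg] assms(3) by (auto simp: less_eq_vec_def intro: order.trans)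

text \<open>
  The support of a superharmonic vector contains all predecessors of its nodes, so a strongly
  connected set of nodes that meets the support lies in it.
\<close>

lemma superharmonic_support_pred:
  assumes "nonneg_mat C" "\<And>i j. C $ i $ j * u $ j \<le> u $ i"
    and "(i, j) \<in> (mat_edges C)\<^sup>*" "0 < u $ j"
  shows "0 < u $ i"
  using assms(3,4)
proof (induction rule: converse_rtrancl_induct)
  case (step i l)
  then have "0 < C $ i $ l * u $ l" using entry_nonneg[OF assms(1), of i l] by (auto simp: mat_edges_def)
  then show ?case using assms(2)[of i l] by simp
qed

lemma spectral_class_edges:
  assumes B: "nonneg_mat B" and \<nu>: "spectral_class alg B 1 \<nu>"
  shows "Restr (mat_edges B) \<nu> \<noteq> {}"
proof -
  have \<nu>c: "\<nu> \<in> classes B" and \<nu>1: "perron_root alg B \<nu> = 1"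
    using \<nu> by (auto simp: spectral_class_def)
  obtain v where v: "\<forall>i\<in>\<nu>. 0 < v $ i \<and> alg_sum alg (\<lambda>j. B $ i $ j * v $ j) \<nu> = v $ i"
    using perron_vector_exists[OF B class_strongly_connected[OF \<nu>c], of alg] \<nu>1 by auto
  obtain i where i: "i \<in> \<nu>" using class_strongly_connected(2)[OF \<nu>c] by blast
  then have "0 < alg_sum alg (\<lambda>j. B $ i $ j * v $ j) \<nu>" using v by auto
  then obtain j where "j \<in> \<nu>" "0 < B $ i $ j * v $ j"
    using v by (subst (asm) alg_sum_pos_iff) (auto simp: entry_nonneg[OF B] less_imp_le)
  then have "(i, j) \<in> Restr (mat_edges B) \<nu>" using i by (auto simp: mat_edges_def)
  then show ?thesis by blast
qed

subsection \<open>Periods are multiples of the cyclicities\<close>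

text \<open>
  The idea is to construct a vector fixed by \<open>T ^^ d\<close> that is fixed by \<open>T ^^
  q\<close> only if \<open>d\<close> divides \<open>q\<close>. Cut the superharmonic vector
  \<open>u\<close> down to the phase classes \<open>w a\<close> of \<open>G\<close>. As every
  \<open>G\<close>-edge lowers the phase by one and the \<open>G\<close>-successors of a node
  alone account for its value of \<open>u\<close>, the map \<open>T\<close> takes \<open>w
  a\<close> to a vector above \<open>w (a + 1)\<close>. Hence \<open>w 0 \<le> (T ^^ d) (w
  0)\<close>, the sequence \<open>(T ^^ (d * k)) (w 0)\<close> increases below \<open>u\<close>,
  and its limit \<open>x\<close> is fixed by \<open>T ^^ d\<close> with \<open>x $ i0 = u $
  i0\<close>. If \<open>d\<close> does not divide \<open>q\<close>, no \<open>G\<close>-walk of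
  length \<open>q + d * k\<close> leads from \<open>i0\<close> to phase \<open>0\<close>, so
  \<open>((T ^^ q) x) $ i0\<close> stays below \<open>\<theta> * u $ i0\<close>.
\<close>

lemma period_multiple_of_cyclicity:
  fixes B :: "real^'n^'n"
  defines "T alg \<equiv> alg_mult_vec alg B"
  assumes B: "nonneg_mat B" and u: "nonneg_vec u" "T alg u \<le> u"
    and G: "strongly_connected N G" "i0 \<in> N" "0 < u $ i0"
    and d: "\<And>k. (i0, i0) \<in> G ^^ k \<Longrightarrow> d dvd k"
    and tight: "\<And>i w. i \<in> N \<Longrightarrow> nonneg_vec w \<Longrightarrow> (\<And>j. (i, j) \<in> G \<Longrightarrow> w $ j = u $ j) \<Longrightarrow> u $ i \<le> T alg w $ i"
    and \<theta>: "\<theta> < 1" "\<And>k w. nonneg_vec w \<Longrightarrow> w \<le> u \<Longrightarrow> (\<And>j. 0 < w $ j \<Longrightarrow> j \<in> N) \<Longrightarrow>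
      (T alg ^^ k) w $ i0 \<le> \<theta> * u $ i0 \<or> (\<exists>j. 0 < w $ j \<and> (i0, j) \<in> G ^^ k)"
    and q: "\<And>x. nonneg_vec x \<Longrightarrow> (T alg ^^ d) x = x \<Longrightarrow> (T alg ^^ q) x = x"
  shows "d dvd q"
proof (rule ccontr)
  assume nq: "\<not> d dvd q"
  let ?T = "T alg"
  note T = T_def
  define w where "w a = (\<chi> j. if j \<in> phase_class G d i0 a then u $ j else 0)" for a
  have u_nn: "0 \<le> u $ i" for i using u(1) by (auto simp: nonneg_vec_def)
  have w_nn: "nonneg_vec (w a)" for a by (auto simp: nonneg_vec_def w_def u_nn)
  have w_le: "w a \<le> u" for a by (auto simp: less_eq_vec_def w_def u_nn)
  have step: "w (Suc a) \<le> ?T (w a)" for a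
  proof -
    have "w (Suc a) $ i \<le> ?T (w a) $ i" for i
    proof (cases "i \<in> phase_class G d i0 (Suc a)")
      case True
      have "u $ i \<le> ?T (w a) $ i"
      proof (rule tight[OF _ w_nn])
        show "i \<in> N" using True phase_class_subset[OF G(1,2)] by blast
        show "w a $ j = u $ j" if "(i, j) \<in> G" for j
          using phase_class_successor[OF G(1,2) d True that] by (simp add: w_def)
      qed
      then show ?thesis using True by (simp add: w_def)
    next
      case False
      then show ?thesis using mult_vec_nonneg[OF B w_nn, of alg a] by (simp add: w_def T nonneg_vec_def)
    qed
    then show ?thesis by (simp add: less_eq_vec_def)
  qed
  have "w k \<le> (?T ^^ k) (w 0)" for k
  proof (induction k)
    case (Suc k)
    have "w (Suc k) \<le> ?T (w k)" by (rule step)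
    also have "\<dots> \<le> ?T ((?T ^^ k) (w 0))" unfolding T by (rule mult_vec_mono[OF B Suc[unfolded T]])
    finally show ?case by simp
  qed simp
  moreover have "w d = w 0" unfolding w_def by (subst phase_class_cong[of d 0]) (simp_all add: cong_def)
  ultimately have w_d: "w 0 \<le> (?T ^^ d) (w 0)" by metis
  define s where "s k = (?T ^^ (d * k)) (w 0)" for k
  have s_nn: "nonneg_vec (s k)" for k unfolding s_def T by (rule mult_vec_pow_nonneg[OF B w_nn])
  have s_Suc: "s (Suc k) = (?T ^^ d) (s k)" for k by (simp add: s_def funpow_add)
  have s_mono: "s k \<le> s (Suc k)" for k
  proof -
    have "(?T ^^ (d * k)) (w 0) \<le> (?T ^^ (d * k)) ((?T ^^ d) (w 0))"
      unfolding T by (rule mult_vec_pow_mono[OF B w_d[unfolded T]])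
    moreover have "s (Suc k) = (?T ^^ (d * k)) ((?T ^^ d) (w 0))"
      unfolding s_def mult_Suc_right add.commute[of d] funpow_add o_apply ..
    ultimately show ?thesis by (simp add: s_def)
  qed
  have pow_le: "(?T ^^ k) (w 0) \<le> u" for k
  proof (induction k)
    case (Suc k)
    have "?T ((?T ^^ k) (w 0)) \<le> ?T u" unfolding T by (rule mult_vec_mono[OF B Suc[unfolded T]])
    then show ?case using u(2) by simp
  qed (simp add: w_le)
  have "\<exists>l. (\<lambda>k. s k $ i) \<longlonglongrightarrow> l" for i
  proof -
    have "incseq (\<lambda>k. s k $ i)" using s_mono by (auto intro!: incseq_SucI simp: less_eq_vec_def)
    moreover have "s k $ i \<le> u $ i" for k using pow_le by (auto simp: s_def less_eq_vec_def)
    ultimately show ?thesis using incseq_convergent by blast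
  qed
  then obtain l where l: "\<And>i. (\<lambda>k. s k $ i) \<longlonglongrightarrow> l i" by metis
  define x where "x = (\<chi> i. l i)"
  have s_x: "s \<longlonglongrightarrow> x" by (rule vec_tendstoI) (simp add: x_def l)
  have "nonneg_vec x"
    unfolding nonneg_vec_def x_def using s_nn
    by (simp add: nonneg_vec_def LIMSEQ_le_const[OF l])
  moreover have "(?T ^^ d) x = x"
  proof (rule LIMSEQ_unique)
    show "(\<lambda>k. s (Suc k)) \<longlonglongrightarrow> (?T ^^ d) x"
      unfolding s_Suc unfolding T by (rule mult_vec_pow_tendsto[OF B s_x])
    show "(\<lambda>k. s (Suc k)) \<longlonglongrightarrow> x" using s_x by (rule LIMSEQ_Suc)
  qed
  ultimately have "(?T ^^ q) x = x" by (rule q)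
  moreover have "(\<lambda>k. (?T ^^ q) (s k) $ i0) \<longlonglongrightarrow> (?T ^^ q) x $ i0"
    unfolding T by (intro tendsto_vec_nth mult_vec_pow_tendsto[OF B s_x])
  moreover have "(?T ^^ q) (s k) $ i0 \<le> \<theta> * u $ i0" for k
  proof -
    (* a walk of this length from \<open>i0\<close> to a node of phase \<open>0\<close> would
        make \<open>d\<close> divide \<open>q\<close> *)
    have "\<not> (0 < w 0 $ j \<and> (i0, j) \<in> G ^^ (q + d * k))" for j
    proof (rule notI)
      assume j: "0 < w 0 $ j \<and> (i0, j) \<in> G ^^ (q + d * k)"
      then have "j \<in> phase_class G d i0 0" by (auto simp: w_def split: if_splits)
      then have "d dvd q + d * k" using phase_class_0_walk[OF d _ conjunct2[OF j]] by simp
      then show False using nq by (simp add: dvd_add_left_iff)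
    qed
    moreover have "j \<in> N" if "0 < w 0 $ j" for j
      using that phase_class_subset[OF G(1,2)] by (auto simp: w_def split: if_splits)
    ultimately have "(?T ^^ (q + d * k)) (w 0) $ i0 \<le> \<theta> * u $ i0" using \<theta>(2)[OF w_nn w_le] by blast
    then show ?thesis by (simp add: s_def funpow_add)
  qed
  ultimately have "x $ i0 \<le> \<theta> * u $ i0" by (auto intro: LIMSEQ_le_const2)
  moreover have "u $ i0 \<le> x $ i0"
  proof -
    have "i0 \<in> phase_class G d i0 0" by (auto simp: phase_class_def intro!: exI[of _ 0])
    then have "s 0 $ i0 = u $ i0" by (simp add: s_def w_def)
    moreover have "s 0 $ i0 \<le> s k $ i0" for k
      by (induction k) (use s_mono in \<open>auto simp: less_eq_vec_def intro: order.trans\<close>)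
    ultimately show ?thesis using l[of i0] unfolding x_def by (intro LIMSEQ_le_const[of "\<lambda>k. s k $ i0"]) auto
  qed
  ultimately show False using \<theta>(1) G(3) by (smt (verit) mult_le_cancel_right1)
qed

text \<open>
  Here \<open>G\<close> consists of all edges inside \<open>\<nu>\<close>, and \<open>\<theta> =
  0\<close>: a walk from \<open>\<nu>\<close> to \<open>\<nu>\<close> cannot leave
  \<open>\<nu>\<close>.
\<close>

lemma nonneg_period_multiple_of_cyclicity:
  fixes B :: "real^'n^'n"
  defines "T \<equiv> alg_mult_vec Nonneg_Algebra B"
  assumes B: "nonneg_mat B" and \<nu>: "spectral_class Nonneg_Algebra B 1 \<nu>"
    and q: "\<And>x. nonneg_vec x \<Longrightarrow> (T ^^ sc_cyclicity (Restr (mat_edges B) \<nu>)) x = x \<Longrightarrow> (T ^^ q) x = x"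
  shows "sc_cyclicity (Restr (mat_edges B) \<nu>) dvd q"
proof -
  have \<nu>c: "\<nu> \<in> classes B" using \<nu> by (auto simp: spectral_class_def)
  note sc = class_strongly_connected[OF \<nu>c]
  obtain u where u: "\<And>i. i \<in> access_set B \<nu> \<Longrightarrow> 0 < u $ i" "\<And>i. i \<notin> access_set B \<nu> \<Longrightarrow> u $ i = 0"
    "T u \<le> u" "\<And>i. i \<in> \<nu> \<Longrightarrow> T u $ i = u $ i"
    using superharmonic_vector_exists[OF B \<nu>] unfolding T_def by blast
  obtain i0 where i0: "i0 \<in> \<nu>" using sc(2) by blast
  have u_nn: "nonneg_vec u" unfolding nonneg_vec_def using u(1,2) by (metis less_eq_real_def order.refl)
  show ?thesis
  proof (rule period_multiple_of_cyclicity[OF B u_nn _ sc(1) i0, where \<theta> = 0 and alg = Nonneg_Algebra, folded T_def])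
    show "T u \<le> u" by fact
    show "0 < u $ i0" using i0 u(1) access_set_superset by blast
    show "sc_cyclicity (Restr (mat_edges B) \<nu>) dvd k" if "(i0, i0) \<in> Restr (mat_edges B) \<nu> ^^ k" for k
      using that by (rule sc_cyclicity_dvd_closed_walk)
    show "u $ i \<le> T w $ i" if i: "i \<in> \<nu>" and w: "nonneg_vec w"
      "\<And>j. (i, j) \<in> Restr (mat_edges B) \<nu> \<Longrightarrow> w $ j = u $ j" for i w
    proof -
      have "B $ i $ j * u $ j \<le> B $ i $ j * w $ j" for j
      proof (cases "B $ i $ j = 0 \<or> j \<notin> access_set B \<nu>")
        case True
        then show ?thesis using u(2) w(1) entry_nonneg[OF B] by (auto simp: nonneg_vec_def)
      next
        case False
        then have "(i, j) \<in> Restr (mat_edges B) \<nu>"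
          using access_set_successor[OF \<nu>c i] i by (auto simp: mat_edges_def)
        then show ?thesis using w(2) by simp
      qed
      then have "T u $ i \<le> T w $ i" unfolding T_def mult_vec_nth by (intro alg_sum_mono) auto
      then show ?thesis using u(4)[OF i] by simp
    qed
    show "(T ^^ k) w $ i0 \<le> 0 * u $ i0 \<or> (\<exists>j. 0 < w $ j \<and> (i0, j) \<in> Restr (mat_edges B) \<nu> ^^ k)"
      if w: "nonneg_vec w" "\<And>j. 0 < w $ j \<Longrightarrow> j \<in> \<nu>" for k w
    proof (cases "0 < (T ^^ k) w $ i0")
      case True
      then obtain j where j: "0 < w $ j" "(i0, j) \<in> mat_edges B ^^ k"
        using pow_pos_walk[OF B w(1)] unfolding T_def by blast
      then have "(j, i0) \<in> (mat_edges B)\<^sup>*" using class_eq[OF \<nu>c i0] w(2) by blast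
      then have "(i0, j) \<in> Restr (mat_edges B) \<nu> ^^ k"
        using component_walk[of "mat_edges B" UNIV \<nu> i0 j k] \<nu>c i0 j(2) by (auto simp: classes_def)
      then show ?thesis using j(1) by blast
    qed auto
    show "(T ^^ q) x = x" if "nonneg_vec x" "(T ^^ sc_cyclicity (Restr (mat_edges B) \<nu>)) x = x" for x
      using that by (rule q)
  qed simp
qed

subsection \<open>Cyclicities are periods: nonnegative algebra\<close>

text \<open>
  On a class that is final in the support of \<open>y\<close>, the vector \<open>y\<close> is an
  eigenvector of the block. Any other class \<open>\<mu>\<close> that accesses it lies in the
  support as well and has an edge to a node of the support outside \<open>\<mu>\<close>. There
  the block of \<open>\<mu>\<close> loses part of \<open>y\<close>, so its Perron root is less
  than \<open>1\<close>.
\<close>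

lemma final_class_of_support_spectral:
  fixes B :: "real^'n^'n"
  defines "T \<equiv> alg_mult_vec Nonneg_Algebra B" and "E \<equiv> mat_edges B"
  assumes B: "nonneg_mat B" and y: "nonneg_vec y" "T y = y"
    and \<nu>: "\<nu> \<in> classes B" "c \<in> \<nu>" "0 < y $ c"
    and final: "\<And>j. (c, j) \<in> (Restr E {i. 0 < y $ i})\<^sup>* \<Longrightarrow> (j, c) \<in> E\<^sup>*"
  shows "spectral_class Nonneg_Algebra B 1 \<nu>"
proof -
  define S where "S = {i. 0 < y $ i}"
  have pred: "i \<in> S" if "(i, j) \<in> E\<^sup>*" "j \<in> S" for i j
    using superharmonic_support_pred[OF B superharmonic_entry[OF B y(1), of Nonneg_Algebra]] y(2) that
    by (auto simp: S_def E_def T_def)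
  have y0: "y $ i = 0" if "i \<notin> S" for i
    using y(1) that by (auto simp: nonneg_vec_def S_def not_less intro: order.antisym)
  note \<nu>_eq = class_eq[OF \<nu>(1,2), folded E_def]
  have sub: "\<nu> \<subseteq> {i. 0 < y $ i}" using \<nu>_eq pred[of _ c] \<nu>(3) by (auto simp: S_def)
  note sc = class_strongly_connected[OF \<nu>(1)]
  have succ: "j \<in> \<nu>" if i: "i \<in> \<nu>" and ij: "(i, j) \<in> E" "j \<in> S" for i j
  proof -
    have "(c, i) \<in> (Restr E \<nu>)\<^sup>*"
      using sc(1) \<nu>(2) i unfolding strongly_connected_def E_def by blast
    moreover have "Restr E \<nu> \<subseteq> Restr E S" using sub by (auto simp: S_def)
    ultimately have "(c, i) \<in> (Restr E S)\<^sup>*" by (rule subsetD[OF rtrancl_mono, rotated])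
    moreover have "(i, j) \<in> Restr E S" using ij i sub by (auto simp: S_def)
    ultimately have "(c, j) \<in> (Restr E S)\<^sup>*" by (rule rtrancl_into_rtrancl)
    then have "(j, c) \<in> E\<^sup>*" using final unfolding S_def by blast
    moreover have "(c, j) \<in> E\<^sup>*" using \<nu>_eq i ij(1) by (auto intro: rtrancl_into_rtrancl)
    ultimately show ?thesis using \<nu>_eq by blast
  qed
  have Ty: "(\<Sum>j\<in>UNIV. B $ i $ j * y $ j) = y $ i" for i
    using y(2) mult_vec_nth[of Nonneg_Algebra B y i] by (simp add: T_def)
  have term_nn: "0 \<le> B $ i $ j * y $ j" for i j
    using entry_nonneg[OF B] y(1) by (simp add: nonneg_vec_def)
  have on_\<nu>: "alg_sum Nonneg_Algebra (\<lambda>j. B $ i $ j * y $ j) \<nu> = y $ i" if i: "i \<in> \<nu>" for i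
  proof -
    have "B $ i $ j * y $ j = 0" if "j \<notin> \<nu>" for j
      using succ[OF i, of j] y0[of j] that by (auto simp: E_def mat_edges_def)
    then have "(\<Sum>j\<in>UNIV. B $ i $ j * y $ j) = (\<Sum>j\<in>\<nu>. B $ i $ j * y $ j)"
      by (intro sum.mono_neutral_right) auto
    then show ?thesis using Ty by simp
  qed
  have "perron_root Nonneg_Algebra B \<nu> = 1"
  proof (rule order.antisym)
    show "perron_root Nonneg_Algebra B \<nu> \<le> 1"
      by (rule perron_root_le[OF B sc, where y = y]) (use on_\<nu> sub in auto)
    show "1 \<le> perron_root Nonneg_Algebra B \<nu>"
      by (rule perron_root_ge[OF B sc, where x = y and k = c]) (use on_\<nu> sub \<nu> in \<open>auto simp: less_imp_le\<close>)
  qed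
  moreover have "perron_root Nonneg_Algebra B \<mu> < 1"
    if \<mu>: "\<mu> \<in> classes B" "accesses B \<mu> \<nu>" "\<mu> \<noteq> \<nu>" for \<mu>
  proof -
    obtain i j where ij: "i \<in> \<mu>" "j \<in> \<nu>" "(i, j) \<in> E\<^sup>*"
      using accesses_iff[OF \<mu>(1) \<nu>(1)] \<mu>(2) by (auto simp: E_def)
    have "j \<notin> \<mu>" using class_eq[OF \<mu>(1)] class_eq[OF \<nu>(1) ij(2)] \<mu>(3) by blast
    then obtain k l where kl: "k \<in> \<mu>" "l \<notin> \<mu>" "(k, l) \<in> E" "(l, j) \<in> E\<^sup>*"
      using rtrancl_leaves_set[OF ij(3,1)] by blast
    have jS: "j \<in> S" using ij(2) sub by (auto simp: S_def)
    have iS: "i \<in> S" using pred ij(3) jS by blast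
    have \<mu>S: "m \<in> S" if "m \<in> \<mu>" for m
      using class_eq[OF \<mu>(1) ij(1)] that pred[OF _ iS] by (auto simp: E_def)
    show ?thesis
    proof (rule perron_root_less[OF B class_strongly_connected[OF \<mu>(1)], where y = y and k = k])
      show "0 < y $ m" if "m \<in> \<mu>" for m using \<mu>S[OF that] by (simp add: S_def)
      show "(\<Sum>j\<in>\<mu>. B $ m $ j * y $ j) \<le> 1 * y $ m" for m
        using sum_mono2[of UNIV \<mu> "\<lambda>j. B $ m $ j * y $ j"] term_nn Ty by simp
      have "0 < B $ k $ l" using kl(3) entry_nonneg[OF B, of k l] by (simp add: E_def mat_edges_def)
      then have "0 < B $ k $ l * y $ l" using pred[OF kl(4) jS] by (simp add: S_def)
      then have "(\<Sum>j\<in>\<mu>. B $ k $ j * y $ j) < (\<Sum>j\<in>insert l \<mu>. B $ k $ j * y $ j)"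
        using kl(2) by simp
      also have "\<dots> \<le> y $ k"
        using sum_mono2[of UNIV "insert l \<mu>" "\<lambda>j. B $ k $ j * y $ j"] term_nn Ty by simp
      finally show "(\<Sum>j\<in>\<mu>. B $ k $ j * y $ j) < 1 * y $ k" by simp
    qed (use kl in auto)
  qed
  ultimately show "spectral_class Nonneg_Algebra B 1 \<nu>"
    using \<nu>(1) by (auto simp: spectral_class_def)
qed

text \<open>
  The ratio of \<open>D (a + 1)\<close> to \<open>y\<close> is a weighted mean of the ratios of
  \<open>D a\<close> to \<open>y\<close> at the successors; a mean is the maximum only if all
  its terms are.
\<close>

lemma nonneg_harmonic_max_principle:
  fixes B :: "real^'n^'n" and D :: "nat \<Rightarrow> 'n \<Rightarrow> real"
  assumes B: "nonneg_mat B" and y: "nonneg_vec y" "\<And>i. (\<Sum>j\<in>UNIV. B $ i $ j * y $ j) = y $ i"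
    and D: "\<And>a i. D (Suc a) i = (\<Sum>j\<in>UNIV. B $ i $ j * D a j)"
    and D_le: "\<And>a i. D a i \<le> \<delta> * y $ i"
    and eq: "D (Suc a) i = \<delta> * y $ i" and ij: "B $ i $ j \<noteq> 0"
  shows "D a j = \<delta> * y $ j"
proof -
  have nn: "0 \<le> B $ i $ k * (\<delta> * y $ k - D a k)" for k
    using entry_nonneg[OF B] D_le[of a k] by simp
  have "(\<Sum>k\<in>UNIV. B $ i $ k * (\<delta> * y $ k - D a k)) = \<delta> * (\<Sum>k\<in>UNIV. B $ i $ k * y $ k) - D (Suc a) i"
    by (simp add: D right_diff_distrib sum_subtractf sum_distrib_left mult.left_commute)
  then have "(\<Sum>k\<in>UNIV. B $ i $ k * (\<delta> * y $ k - D a k)) = 0" using y(2) eq by simp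
  then have "B $ i $ j * (\<delta> * y $ j - D a j) = 0"
    using nn by (subst (asm) sum_nonneg_eq_0_iff) auto
  then show ?thesis using ij by simp
qed

text \<open>
  Let \<open>D a\<close> be the difference of \<open>(T ^^ a) x\<close> and \<open>(T ^^ (a +
  \<sigma>)) x\<close>, up to the sign \<open>e\<close>, and let \<open>\<delta>\<close> be the
  largest ratio of \<open>D a\<close> to \<open>y\<close>. By the maximum principle the set of
  nodes where \<open>\<delta>\<close> is attained at some time is closed under successors in the
  support of \<open>y\<close>, so it meets a final class \<open>\<nu>\<close>, and
  \<open>\<nu>\<close> is spectral. Since its cyclicity divides \<open>\<sigma>\<close>, a node
  \<open>c\<close> of \<open>\<nu>\<close> lies on a closed walk of length \<open>L \<equiv>
  \<sigma>\<close> modulo the period \<open>m\<close>. Going around this walk \<open>m\<close>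
  times, the value at \<open>c\<close> changes by \<open>\<delta> * y $ c\<close> in each round,
  always in the same direction, but returns to its start by periodicity; so
  \<open>\<delta>\<close> cannot be positive. This applied to both signs gives the claim.
\<close>

lemma nonneg_cyclicity_is_period:
  fixes B :: "real^'n^'n"
  defines "T \<equiv> alg_mult_vec Nonneg_Algebra B"
  assumes B: "nonneg_mat B" and x: "nonneg_vec x" and m: "0 < m" "(T ^^ m) x = x"
    and \<sigma>: "\<And>\<nu>. spectral_class Nonneg_Algebra B 1 \<nu> \<Longrightarrow> sc_cyclicity (Restr (mat_edges B) \<nu>) dvd \<sigma>"
  shows "(T ^^ \<sigma>) x = x"
proof -
  define E where "E = mat_edges B"
  define X where "X a i = (T ^^ a) x $ i" for a i
  obtain y where y: "nonneg_vec y" "T y = y" "\<And>a. (T ^^ a) x \<le> y"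
    by (rule periodic_vector_dominated_by_fixed_vector[OF B x m[unfolded T_def], folded T_def]) blast
  define S where "S = {i. 0 < y $ i}"
  have y_nn: "0 \<le> y $ i" for i using y(1) by (simp add: nonneg_vec_def)
  have Ty: "(\<Sum>j\<in>UNIV. B $ i $ j * y $ j) = y $ i" for i
    using y(2) mult_vec_nth[of Nonneg_Algebra B y i] by (simp add: T_def)
  have X_nn: "0 \<le> X a i" for a i
    using mult_vec_pow_nonneg[OF B x] by (auto simp: nonneg_vec_def X_def T_def)
  have X_le: "X a i \<le> y $ i" for a i using y(3) by (auto simp: X_def less_eq_vec_def)
  have X_Suc: "X (Suc a) i = (\<Sum>j\<in>UNIV. B $ i $ j * X a j)" for a i
    by (simp add: X_def T_def mult_vec_nth)
  have X_cong: "X a i = X b i" if "[a = b] (mod m)" for a b i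
    using funpow_cong[OF m(2) that] by (simp add: X_def)
  have "e * (X a i - X (a + \<sigma>) i) \<le> 0" for e a i
  proof (rule ccontr)
    assume pos: "\<not> e * (X a i - X (a + \<sigma>) i) \<le> 0"
    define D where "D a i = e * (X a i - X (a + \<sigma>) i)" for a i
    have D_Suc: "D (Suc a) i = (\<Sum>j\<in>UNIV. B $ i $ j * D a j)" for a i
      by (simp add: D_def X_Suc sum_subtractf[symmetric] sum_distrib_left right_diff_distrib mult.left_commute)
    have D_cong: "D a i = D b i" if "[a = b] (mod m)" for a b i
      using X_cong[OF that] X_cong[of "a + \<sigma>" "b + \<sigma>"] cong_add[OF that cong_refl] by (simp add: D_def)
    have D0: "D a i = 0" if "i \<notin> S" for a i
    proof -
      have "y $ i = 0" using that y_nn[of i] by (simp add: S_def)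
      then have "X a i = 0" for a using X_nn[of a i] X_le[of a i] by simp
      then show ?thesis by (simp add: D_def)
    qed
    have iS: "i \<in> S" using D0[of i a] pos unfolding D_def by (cases "i \<in> S") linarith+
    have "S \<times> {..<m} \<noteq> {}" using iS m(1) by auto
    then obtain p where p: "p \<in> S \<times> {..<m}"
      "\<And>r. r \<in> S \<times> {..<m} \<Longrightarrow> D (snd r) (fst r) / y $ fst r \<le> D (snd p) (fst p) / y $ fst p"
      using finite_max_exists[of "S \<times> {..<m}" "\<lambda>r. D (snd r) (fst r) / y $ fst r"] by (metis finite_SigmaI finite_lessThan finite)
    define \<delta> where "\<delta> = D (snd p) (fst p) / y $ fst p"
    have ratio: "D b j / y $ j \<le> \<delta>" if "j \<in> S" for b j
      using p(2)[of "(j, b mod m)"] that m(1) D_cong[of b "b mod m" j] by (simp add: \<delta>_def cong_def)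
    have D_le: "D b j \<le> \<delta> * y $ j" for b j
    proof (cases "j \<in> S")
      case True
      then show ?thesis using ratio[OF True, of b] by (simp add: S_def pos_divide_le_eq)
    next
      case False
      then show ?thesis using D0[of j b] y_nn[of j] by (simp add: S_def)
    qed
    have "0 < D a i / y $ i" using pos iS by (simp add: D_def S_def)
    then have \<delta>: "0 < \<delta>" using ratio[OF iS, of a] by linarith
    define Q where "Q = {i \<in> S. \<exists>a. D a i = \<delta> * y $ i}"
    have max_step: "D a j = \<delta> * y $ j" if "D (Suc a) i = \<delta> * y $ i" "(i, j) \<in> E" for a i j
      by (rule nonneg_harmonic_max_principle[OF B y(1) Ty D_Suc D_le that(1)])
         (use that(2) in \<open>simp add: E_def mat_edges_def\<close>)
    have max_walk: "D a j = \<delta> * y $ j" if "(i, j) \<in> E ^^ L" "D (a + L) i = \<delta> * y $ i" for a i j L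
      using that
    proof (induction L arbitrary: i)
      case (Suc L)
      obtain l where "(i, l) \<in> E" "(l, j) \<in> E ^^ L" using relpow_Suc_D2[OF Suc.prems(1)] by blast
      then show ?case using Suc.IH max_step[of "a + L" i l] Suc.prems(2) by simp
    qed simp
    have "fst p \<in> Q" using p(1) unfolding Q_def \<delta>_def by (force simp: S_def)
    then have "Q \<noteq> {}" by blast
    moreover have "j \<in> Q" if ij: "i \<in> Q" "(i, j) \<in> Restr E S" for i j
    proof -
      obtain a where a: "D a i = \<delta> * y $ i" using ij(1) by (auto simp: Q_def)
      (* a period later, so that there is an earlier time to step back to *)
      have "D (Suc (a + (m - 1))) i = \<delta> * y $ i"
        using D_cong[of "Suc (a + (m - 1))" a i] a m(1) by (simp add: cong_def)
      then show ?thesis using max_step that(2) by (auto simp: Q_def)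
    qed
    ultimately obtain c where c: "c \<in> Q" "\<And>j. (c, j) \<in> (Restr E S)\<^sup>* \<Longrightarrow> (j, c) \<in> (Restr E S)\<^sup>*"
      using final_node_exists[of Q "Restr E S"] by blast
    obtain \<nu> where \<nu>: "\<nu> \<in> classes B" "c \<in> \<nu>" using class_exists by blast
    have cS: "0 < y $ c" using c(1) by (auto simp: Q_def S_def)
    have "(j, c) \<in> E\<^sup>*" if "(c, j) \<in> (Restr E S)\<^sup>*" for j
      using c(2)[OF that] by (rule subsetD[OF rtrancl_mono, rotated]) auto
    then have spec: "spectral_class Nonneg_Algebra B 1 \<nu>"
      unfolding S_def E_def by (rule final_class_of_support_spectral[OF B y(1,2)[unfolded T_def] \<nu> cS])
    obtain L where L: "[L = \<sigma>] (mod m)" "(c, c) \<in> (Restr E \<nu>) ^^ L"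
      using closed_walk_in_residue_class[OF class_strongly_connected(1)[OF \<nu>(1)] \<nu>(2)
          spectral_class_edges[OF B spec] \<sigma>[OF spec] m(1), of 0] unfolding E_def by blast
    have cc: "(c, c) \<in> E ^^ L" using L(2) by (rule relpow_subset) auto
    obtain b where b: "D b c = \<delta> * y $ c" using c(1) by (auto simp: Q_def)
    (* the maximum principle runs backwards in time, so begin with the last of the
        \<open>m\<close> rounds, where periodicity gives the value *)
    have D_loop: "D (b + t * L) c = \<delta> * y $ c" if "t \<le> m" for t
      using that
    proof (induction t rule: inc_induct)
      case base
      have "[b + m * L = b] (mod m)" by (simp add: cong_def)
      from D_cong[OF this] show ?case using b by simp
    next
      case (step t)
      then show ?case using max_walk[OF cc, of "b + t * L"] by (simp add: ac_simps)
    qed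
    define f where "f t = e * X (b + t * L) c" for t
    have "f t - f (Suc t) = \<delta> * y $ c" if "t < m" for t
    proof -
      have "[b + t * L + \<sigma> = b + Suc t * L] (mod m)"
        using cong_add[OF cong_refl[of "b + t * L"] cong_sym[OF L(1)]] by (simp add: ac_simps)
      from X_cong[OF this] show ?thesis
        using D_loop[of t] that by (simp add: D_def f_def right_diff_distrib)
    qed
    then have "(\<Sum>t<m. f t - f (Suc t)) = real m * (\<delta> * y $ c)" by simp
    moreover have "(\<Sum>t<m. f t - f (Suc t)) = f 0 - f m" by (rule sum_lessThan_telescope')
    moreover have "f m = f 0"
      unfolding f_def using X_cong[of "b + m * L" "b + 0 * L" c] by (simp add: cong_def)
    ultimately show False using m(1) \<delta> cS by simp
  qed
  from this[of 1 0] this[of "-1" 0] have "X \<sigma> i = X 0 i" for i by (simp add: order.antisym)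
  then show ?thesis by (simp add: X_def vec_eq_iff)
qed

section \<open>The critical graph in max algebra\<close>

text \<open>
  For a superharmonic \<open>u\<close>, the matrix with entries \<open>B $ i $ j * u $ j / u $
  i\<close> has all entries at most \<open>1\<close>; the tight edges are those whose entry is
  \<open>1\<close>.
\<close>

definition tight_edges :: "real^'n^'n \<Rightarrow> real^'n \<Rightarrow> 'n rel" where
  "tight_edges B u = {(i, j). 0 < u $ i \<and> B $ i $ j * u $ j = u $ i}"

lemma tight_edges_pos:
  assumes "nonneg_mat B" "(i, j) \<in> tight_edges B u"
  shows "0 < u $ i" "0 < u $ j" "0 < B $ i $ j"
proof -
  have *: "0 < u $ i" "B $ i $ j * u $ j = u $ i" using assms(2) by (auto simp: tight_edges_def)
  then have "0 < B $ i $ j * u $ j" by simp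
  then show "0 < u $ i" "0 < u $ j" "0 < B $ i $ j"
    using *(1) entry_nonneg[OF assms(1), of i j] by (auto simp: zero_less_mult_iff)
qed

lemma tight_edges_subset: "nonneg_mat B \<Longrightarrow> tight_edges B u \<subseteq> mat_edges B"
  using tight_edges_pos(3) by (fastforce simp: mat_edges_def)

lemma prod_eq_1_imp_eq_1:
  fixes r :: "'a \<Rightarrow> real"
  assumes "finite I" "\<And>i. i \<in> I \<Longrightarrow> 0 \<le> r i \<and> r i \<le> 1" "(\<Prod>i\<in>I. r i) = 1" "i \<in> I"
  shows "r i = 1"
proof -
  have "(\<Prod>i\<in>I - {i}. r i) \<le> 1" using assms(2) by (intro prod_le_1) auto
  then have "r i * (\<Prod>i\<in>I - {i}. r i) \<le> r i * 1" using assms(2,4) by (intro mult_left_mono) auto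
  then have "1 \<le> r i" using assms by (simp add: prod.remove)
  then show ?thesis using assms(2)[OF assms(4)] by simp
qed

context
  fixes C :: "real^'n^'n" and u :: "real^'n"
  assumes C: "nonneg_mat C" and u: "nonneg_vec u" and sub: "\<And>i j. C $ i $ j * u $ j \<le> u $ i"
begin

lemma cycle_support:
  assumes "is_cycle (mat_edges C) c" "v \<in> set c" "0 < u $ v" "v' \<in> set c"
  shows "0 < u $ v'"
proof -
  have "(v', v) \<in> (cycle_edges c)\<^sup>*" using assms(4,2) by (rule cycle_nodes_connected)
  then have "(v', v) \<in> (mat_edges C)\<^sup>*"
    using assms(1) rtrancl_mono unfolding is_cycle_def by blast
  then show ?thesis using assms(3) by (rule superharmonic_support_pred[OF C sub])
qed

text \<open>
  Around a cycle the quotients of the values of \<open>u\<close> cancel. So the weight of the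
  cycle is the product of the entries scaled by \<open>u\<close>, each of which is at most
  \<open>1\<close>.
\<close>

lemma cycle_weight_superharmonic:
  assumes c: "c \<noteq> []" "\<And>v. v \<in> set c \<Longrightarrow> 0 < u $ v"
  shows "cycle_weight C c \<le> 1" "cycle_weight C c = 1 \<longleftrightarrow> cycle_edges c \<subseteq> tight_edges C u"
proof -
  let ?l = "length c"
  define r where "r t = C $ (c ! t) $ (c ! (Suc t mod ?l)) * u $ (c ! (Suc t mod ?l)) / u $ (c ! t)" for t
  have upos: "0 < u $ (c ! t)" if "t < ?l" for t using c(2) that by simp
  have mod: "Suc t mod ?l < ?l" for t using c(1) by (intro mod_less_divisor) auto
  have r: "0 \<le> r t \<and> r t \<le> 1" if "t < ?l" for t
    using sub upos[OF that] upos[OF mod[of t]] entry_nonneg[OF C] by (simp add: r_def pos_divide_le_eq)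
  have "(\<Prod>t<?l. u $ (c ! (Suc t mod ?l))) = (\<Prod>t<?l. u $ (c ! t))"
    using Suc_mod_bij[of ?l] c(1) by (intro prod.reindex_bij_betw) auto
  moreover have "(\<Prod>t<?l. u $ (c ! t)) \<noteq> 0" using upos by (auto simp: less_le)
  ultimately have w: "cycle_weight C c = (\<Prod>t<?l. r t)"
    by (simp add: r_def prod_dividef prod.distrib cycle_weight_def)
  show "cycle_weight C c \<le> 1" unfolding w using r by (intro prod_le_1) auto
  have tight: "(c ! t, c ! (Suc t mod ?l)) \<in> tight_edges C u \<longleftrightarrow> r t = 1" if "t < ?l" for t
    using upos[OF that] by (auto simp: tight_edges_def r_def field_simps)
  show "cycle_weight C c = 1 \<longleftrightarrow> cycle_edges c \<subseteq> tight_edges C u"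
  proof
    assume "cycle_weight C c = 1"
    then have "r t = 1" if "t < ?l" for t
      using prod_eq_1_imp_eq_1[of "{..<?l}" r t] r that unfolding w by auto
    then show "cycle_edges c \<subseteq> tight_edges C u" using tight by (auto simp: cycle_edges_def)
  next
    assume "cycle_edges c \<subseteq> tight_edges C u"
    then have "r t = 1" if "t < ?l" for t using tight[OF that] cycle_edge_at[OF that] by blast
    then show "cycle_weight C c = 1" unfolding w by simp
  qed
qed

text \<open>
  Since \<open>u\<close> is superharmonic, no class inside its support has a Perron root above
  \<open>1\<close>, and all classes that access \<open>\<nu>\<close> are inside. The Perron root
  of \<open>\<nu>\<close> is at least \<open>1\<close> because on the strongly connected set
  \<open>R\<close> of nodes joined to \<open>c\<close> by tight walks, every node has a tight
  successor in \<open>R\<close>.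
\<close>

lemma tight_closed_walk_spectral:
  assumes c: "(c, c) \<in> (tight_edges C u) ^^ k" "0 < k" and \<nu>: "\<nu> \<in> classes C" "c \<in> \<nu>"
  shows "spectral_class Max_Algebra C 1 \<nu>"
proof -
  let ?G = "tight_edges C u"
  obtain k' where "k = Suc k'" using c(2) by (cases k) auto
  then obtain z where cz: "(c, z) \<in> ?G" "(z, c) \<in> ?G\<^sup>*"
    using c(1) relpow_Suc_D2[of c c k' ?G] by (auto simp: rtrancl_power)
  have uc: "0 < u $ c" using cz(1) by (auto simp: tight_edges_def)
  have block_le: "alg_sum Max_Algebra (\<lambda>j. C $ i $ j * u $ j) \<mu> \<le> 1 * u $ i" for i and \<mu> :: "'n set"
    using sub[of i] u by (simp add: nonneg_vec_def)
  have pos: "0 < u $ i" if \<mu>: "\<mu> \<in> classes C" "accesses C \<mu> \<nu>" "i \<in> \<mu>" for i \<mu>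
  proof -
    obtain a b where ab: "a \<in> \<mu>" "b \<in> \<nu>" "(a, b) \<in> (mat_edges C)\<^sup>*"
      using accesses_iff[OF \<mu>(1) \<nu>(1)] \<mu>(2) by blast
    have "(i, a) \<in> (mat_edges C)\<^sup>*" "(b, c) \<in> (mat_edges C)\<^sup>*"
      using class_eq[OF \<mu>(1) ab(1)] \<mu>(3) class_eq[OF \<nu>(1) ab(2)] \<nu>(2) by blast+
    then have "(i, c) \<in> (mat_edges C)\<^sup>*" using ab(3) by (meson rtrancl_trans)
    then show ?thesis using uc by (rule superharmonic_support_pred[OF C sub])
  qed
  have le: "perron_root Max_Algebra C \<mu> \<le> 1" if \<mu>: "\<mu> \<in> classes C" "accesses C \<mu> \<nu>" for \<mu>
    by (rule perron_root_le[OF C class_strongly_connected[OF \<mu>(1)], where y = u])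
       (use pos[OF \<mu>] block_le in auto)
  define R where "R = {j. (c, j) \<in> ?G\<^sup>* \<and> (j, c) \<in> ?G\<^sup>*}"
  have GE: "?G\<^sup>* \<subseteq> (mat_edges C)\<^sup>*" by (rule rtrancl_mono[OF tight_edges_subset[OF C]])
  have R\<nu>: "R \<subseteq> \<nu>" using class_eq[OF \<nu>] GE by (auto simp: R_def)
  have R_succ: "\<exists>j\<in>R. (i, j) \<in> ?G" if i: "i \<in> R" for i
  proof (cases "i = c")
    case True
    then show ?thesis using cz by (auto simp: R_def)
  next
    case False
    then obtain j where "(i, j) \<in> ?G" "(j, c) \<in> ?G\<^sup>*" using i by (metis (lifting) R_def converse_rtranclE mem_Collect_eq)
    then show ?thesis using i by (auto simp: R_def intro: rtrancl_into_rtrancl)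
  qed
  (* the restriction of \<open>u\<close> to \<open>R\<close> is a subeigenvector for the value
      \<open>1\<close> *)
  define x where "x = (\<chi> i. if i \<in> R then u $ i else 0)"
  have u_nn: "0 \<le> u $ i" for i using u by (simp add: nonneg_vec_def)
  have x_nn: "0 \<le> x $ i" for i by (simp add: x_def u_nn)
  have "1 \<le> perron_root Max_Algebra C \<nu>"
  proof (rule perron_root_ge[OF C class_strongly_connected[OF \<nu>(1)], where x = x and k = c])
    show "x $ c \<noteq> 0" using uc by (simp add: x_def R_def)
    show "1 * x $ i \<le> alg_sum Max_Algebra (\<lambda>j. C $ i $ j * x $ j) \<nu>" for i
    proof (cases "i \<in> R")
      case True
      then obtain j where j: "j \<in> R" "(i, j) \<in> ?G" using R_succ by blast
      then have "x $ i = C $ i $ j * x $ j" using True by (simp add: x_def tight_edges_def)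
      also have "\<dots> \<le> alg_sum Max_Algebra (\<lambda>j. C $ i $ j * x $ j) \<nu>"
        by (rule alg_sum_upper[where f = "\<lambda>j. C $ i $ j * x $ j"])
           (use j R\<nu> in \<open>auto simp: entry_nonneg[OF C] x_nn\<close>)
      finally show ?thesis by simp
    next
      case False
      then show ?thesis
        by (subst (1) x_def) (auto intro!: alg_sum_nonneg simp: entry_nonneg[OF C] x_nn simp del: alg_sum.simps)
    qed
  qed (use \<nu> x_nn in auto)
  moreover have "accesses C \<nu> \<nu>" by (simp add: accesses_def)
  ultimately have "perron_root Max_Algebra C \<nu> = 1" using le[OF \<nu>(1)] by (simp add: order.antisym)
  then show ?thesis using le \<nu>(1) by (auto simp: spectral_class_def)
qed

end

text \<open>
  The critical graph associated with the eigenvalue \<open>1\<close>.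
\<close>

abbreviation crit_nodes :: "real^'n^'n \<Rightarrow> 'n set" where
  "crit_nodes B \<equiv> critical_nodes (scaled_submatrix B 1)"

abbreviation crit_edges :: "real^'n^'n \<Rightarrow> 'n rel" where
  "crit_edges B \<equiv> critical_edges (scaled_submatrix B 1)"

context
  fixes B :: "real^'n^'n"
  assumes B: "nonneg_mat B"
begin

lemma accessing_nodes_eq:
  "accessing_nodes B 1 = (\<Union>\<nu>\<in>{\<nu>. spectral_class Max_Algebra B 1 \<nu>}. access_set B \<nu>)"
  using node_accesses_iff[of _ B] by (auto simp: accessing_nodes_def access_set_def spectral_class_def)

lemma scaled_nonneg: "nonneg_mat (scaled_submatrix B 1)"
  by (simp add: nonneg_mat_def scaled_submatrix_def entry_nonneg[OF B])

lemma scaled_nth: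
  "scaled_submatrix B 1 $ i $ j = (if i \<in> accessing_nodes B 1 \<and> j \<in> accessing_nodes B 1 then B $ i $ j else 0)"
  by (simp add: scaled_submatrix_def)

lemma scaled_edges:
  "mat_edges (scaled_submatrix B 1) = Restr (mat_edges B) (accessing_nodes B 1)"
  by (auto simp: mat_edges_def scaled_nth)

lemma scaled_superharmonic:
  assumes "nonneg_vec u" "\<And>i j. B $ i $ j * u $ j \<le> u $ i"
  shows "scaled_submatrix B 1 $ i $ j * u $ j \<le> u $ i"
  using assms by (auto simp: scaled_nth nonneg_vec_def)

lemma scaled_tight_edges:
  "tight_edges (scaled_submatrix B 1) u \<subseteq> tight_edges B u"
  "{i. 0 < u $ i} \<subseteq> accessing_nodes B 1 \<Longrightarrow> tight_edges (scaled_submatrix B 1) u = tight_edges B u"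
proof -
  show *: "tight_edges (scaled_submatrix B 1) u \<subseteq> tight_edges B u"
    by (auto simp: tight_edges_def scaled_nth split: if_splits)
  show "{i. 0 < u $ i} \<subseteq> accessing_nodes B 1 \<Longrightarrow> tight_edges (scaled_submatrix B 1) u = tight_edges B u"
  proof (rule equalityI[OF *], rule subrelI)
    fix i j assume s: "{i. 0 < u $ i} \<subseteq> accessing_nodes B 1" and ij: "(i, j) \<in> tight_edges B u"
    show "(i, j) \<in> tight_edges (scaled_submatrix B 1) u"
      using s ij tight_edges_pos[OF B ij] by (auto simp: tight_edges_def scaled_nth)
  qed
qed

lemma max_superharmonic_vector:
  assumes "i \<in> accessing_nodes B 1"
  obtains u where "nonneg_vec u" "\<And>i j. B $ i $ j * u $ j \<le> u $ i" "0 < u $ i"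
    "alg_mult_vec Max_Algebra B u \<le> u" "{i. 0 < u $ i} \<subseteq> accessing_nodes B 1"
proof -
  obtain \<nu> where \<nu>: "spectral_class Max_Algebra B 1 \<nu>" "i \<in> access_set B \<nu>"
    using assms by (auto simp: accessing_nodes_eq)
  obtain u where u: "\<And>i. i \<in> access_set B \<nu> \<Longrightarrow> 0 < u $ i" "\<And>i. i \<notin> access_set B \<nu> \<Longrightarrow> u $ i = 0"
    "alg_mult_vec Max_Algebra B u \<le> u"
    using superharmonic_vector_exists[OF B \<nu>(1)] by blast
  have nn: "nonneg_vec u" unfolding nonneg_vec_def using u(1,2) by (metis less_eq_real_def order.refl)
  show ?thesis
  proof (rule that[OF nn superharmonic_entry[OF B nn u(3)] u(1)[OF \<nu>(2)] u(3)])
    show "{i. 0 < u $ i} \<subseteq> accessing_nodes B 1"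
      using u(2) \<nu>(1) by (force simp: accessing_nodes_eq)
  qed
qed

lemma scaled_cycle_weight_le:
  assumes "is_cycle (mat_edges (scaled_submatrix B 1)) c"
  shows "cycle_weight (scaled_submatrix B 1) c \<le> 1"
proof -
  have c: "c \<noteq> []" "c ! 0 \<in> set c" using assms by (auto simp: is_cycle_def)
  then have "c ! 0 \<in> accessing_nodes B 1"
    using is_cycle_edge[OF assms, of 0] by (auto simp: scaled_edges)
  then obtain u where u: "nonneg_vec u" "\<And>i j. B $ i $ j * u $ j \<le> u $ i" "0 < u $ (c ! 0)"
    by (rule max_superharmonic_vector) blast
  note s = scaled_nonneg u(1) scaled_superharmonic[OF u(1,2)]
  show ?thesis
    by (rule cycle_weight_superharmonic(1)[OF s c(1) cycle_support[OF s assms c(2) u(3)]])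
qed

text \<open>
  A closed walk of tight edges has weight \<open>1\<close>, the largest weight possible.
\<close>

lemma tight_edge_critical_weight:
  assumes u: "nonneg_vec u" "\<And>i j. B $ i $ j * u $ j \<le> u $ i" "{i. 0 < u $ i} \<subseteq> accessing_nodes B 1"
    and ij: "(i, j) \<in> tight_edges B u" "(j, i) \<in> (tight_edges B u)\<^sup>*"
  shows "\<exists>c. is_cycle (mat_edges (scaled_submatrix B 1)) c \<and> cycle_weight (scaled_submatrix B 1) c = 1 \<and>
    (i, j) \<in> cycle_edges c"
proof -
  let ?C = "scaled_submatrix B 1"
  note s = scaled_nonneg u(1) scaled_superharmonic[OF u(1,2)]
  note t = scaled_tight_edges(2)[OF u(3)]
  obtain c where c: "is_cycle (tight_edges ?C u) c" "(i, j) \<in> cycle_edges c"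
    using edge_on_cycle[OF ij] unfolding t by blast
  have cyc: "is_cycle (mat_edges ?C) c"
    using c(1) tight_edges_subset[OF scaled_nonneg] by (auto simp: is_cycle_def)
  have "i \<in> set c" using c(2) cycle_edges_subset by blast
  moreover have "0 < u $ i" using ij(1) by (auto simp: tight_edges_def)
  ultimately have pos: "0 < u $ v" if "v \<in> set c" for v using cycle_support[OF s cyc] that by blast
  have "cycle_weight ?C c = 1"
    using cycle_weight_superharmonic(2)[OF s _ pos] c(1) by (simp add: is_cycle_def)
  then show ?thesis using cyc c(2) by blast
qed

text \<open>
  All cycles have weight at most \<open>1\<close> by superharmonicity. For a cycle of weight
  \<open>1\<close>, start in a spectral class, where \<open>u\<close> is fixed: each maximum is
  attained, so there are tight edges to follow.
\<close>

lemma scaled_max_cycle_mean: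
  assumes "accessing_nodes B 1 \<noteq> {}"
  shows "max_cycle_mean (scaled_submatrix B 1) = 1"
proof -
  let ?C = "scaled_submatrix B 1"
  obtain \<nu> where \<nu>: "spectral_class Max_Algebra B 1 \<nu>" using assms by (auto simp: accessing_nodes_eq)
  then have \<nu>c: "\<nu> \<in> classes B" by (simp add: spectral_class_def)
  obtain u where u: "\<And>i. i \<in> access_set B \<nu> \<Longrightarrow> 0 < u $ i" "\<And>i. i \<notin> access_set B \<nu> \<Longrightarrow> u $ i = 0"
    "alg_mult_vec Max_Algebra B u \<le> u" "\<And>i. i \<in> \<nu> \<Longrightarrow> alg_mult_vec Max_Algebra B u $ i = u $ i"
    using superharmonic_vector_exists[OF B \<nu>] by blast
  have nn: "nonneg_vec u" unfolding nonneg_vec_def using u(1,2) by (metis less_eq_real_def order.refl)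
  have "\<exists>j\<in>\<nu>. (i, j) \<in> tight_edges B u" if i: "i \<in> \<nu>" for i
  proof -
    obtain j where j: "u $ i = B $ i $ j * u $ j" using max_mult_vec_attained[OF B nn, of i] u(4)[OF i] by metis
    have "0 < u $ i" using u(1) i access_set_superset by blast
    then have "j \<in> \<nu>" using access_set_successor[OF \<nu>c i, of j] u(2)[of j] j by fastforce
    then show ?thesis using j \<open>0 < u $ i\<close> by (auto simp: tight_edges_def)
  qed
  then obtain i k where i: "i \<in> \<nu>" "0 < k" "(i, i) \<in> (Restr (tight_edges B u) \<nu>) ^^ k"
    using closed_walk_exists[of \<nu> "tight_edges B u"] class_strongly_connected(2)[OF \<nu>c] by blast
  then have "(i, i) \<in> (tight_edges B u) ^^ k" by (blast intro: relpow_subset)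
  moreover obtain k' where "k = Suc k'" using i(2) by (cases k) auto
  ultimately obtain j where ij: "(i, j) \<in> tight_edges B u" "(j, i) \<in> (tight_edges B u)\<^sup>*"
    using relpow_Suc_D2[of i i k' "tight_edges B u"] by (auto simp: rtrancl_power)
  have "{i. 0 < u $ i} \<subseteq> accessing_nodes B 1" using u(2) \<nu> by (force simp: accessing_nodes_eq)
  from tight_edge_critical_weight[OF nn superharmonic_entry[OF B nn u(3)] this ij]
  obtain c where c: "is_cycle (mat_edges ?C) c" "cycle_weight ?C c = 1" by blast
  have "length c > 0" using c(1) by (auto simp: is_cycle_def)
  then have 1: "\<exists>c. is_cycle (mat_edges ?C) c \<and> 1 = cycle_mean ?C c"
    using c by (auto simp: cycle_mean_def)
  show ?thesis unfolding max_cycle_mean_def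
  proof (rule Greatest_equality, rule 1)
    fix m assume "\<exists>c. is_cycle (mat_edges ?C) c \<and> m = cycle_mean ?C c"
    then obtain c where c: "is_cycle (mat_edges ?C) c" "m = cycle_mean ?C c" by blast
    then show "m \<le> 1" using scaled_cycle_weight_le[OF c(1)] by (auto simp: cycle_mean_def is_cycle_def)
  qed
qed

lemma critical_cycle_iff:
  "critical_cycle (scaled_submatrix B 1) c \<longleftrightarrow>
     is_cycle (mat_edges (scaled_submatrix B 1)) c \<and> cycle_weight (scaled_submatrix B 1) c = 1"
proof (cases "is_cycle (mat_edges (scaled_submatrix B 1)) c")
  case True
  then have "length c > 0" by (simp add: is_cycle_def)
  moreover have "accessing_nodes B 1 \<noteq> {}"
    using is_cycle_edge[OF True calculation] by (auto simp: scaled_edges)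
  ultimately show ?thesis using True
    by (auto simp: critical_cycle_def scaled_max_cycle_mean cycle_mean_def)
qed (simp add: critical_cycle_def)




lemma critical_edges_subset: "crit_edges B \<subseteq> crit_nodes B \<times> crit_nodes B"
  using cycle_edges_subset by (fastforce simp: critical_edges_def critical_nodes_def)

lemma critical_edges_mat_edges: "crit_edges B \<subseteq> mat_edges B"
  by (auto simp: critical_edges_def critical_cycle_iff is_cycle_def scaled_edges)

lemma critical_node_accessing:
  assumes "i \<in> crit_nodes B"
  shows "i \<in> accessing_nodes B 1"
proof -
  obtain c where c: "critical_cycle (scaled_submatrix B 1) c" "i \<in> set c"
    using assms by (auto simp: critical_nodes_def)
  then obtain t where "t < length c" "i = c ! t" by (metis in_set_conv_nth)
  then show ?thesis using is_cycle_edge[of "mat_edges (scaled_submatrix B 1)" c t] c(1)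
    by (auto simp: critical_cycle_iff scaled_edges)
qed

lemma critical_node_successor:
  assumes "i \<in> crit_nodes B"
  shows "\<exists>j. (i, j) \<in> crit_edges B \<and> (j, i) \<in> (crit_edges B)\<^sup>*"
proof -
  obtain c where c: "critical_cycle (scaled_submatrix B 1) c" "i \<in> set c"
    using assms by (auto simp: critical_nodes_def)
  then obtain t where t: "t < length c" "i = c ! t" by (metis in_set_conv_nth)
  let ?j = "c ! (Suc t mod length c)"
  have e: "(i, ?j) \<in> cycle_edges c" using cycle_edge_at[OF t(1)] t(2) by simp
  have sub: "cycle_edges c \<subseteq> crit_edges B" using c(1) by (auto simp: critical_edges_def)
  have "?j \<in> set c" using e cycle_edges_subset by blast
  then have "(?j, i) \<in> (cycle_edges c)\<^sup>*" using c(2) by (rule cycle_nodes_connected)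
  then show ?thesis using e sub rtrancl_mono by blast
qed

context
  fixes u :: "real^'n"
  assumes u: "nonneg_vec u" "\<And>i j. B $ i $ j * u $ j \<le> u $ i"
begin

text \<open>
  A critical cycle that meets the support of a superharmonic vector lies in it, and its weight
  \<open>1\<close> forces all its edges to be tight.
\<close>

lemma critical_edge_tight:
  assumes "(i, j) \<in> crit_edges B" "0 < u $ i"
  shows "(i, j) \<in> tight_edges B u"
proof -
  obtain c where c: "is_cycle (mat_edges (scaled_submatrix B 1)) c"
    "cycle_weight (scaled_submatrix B 1) c = 1" "(i, j) \<in> cycle_edges c"
    using assms(1) by (auto simp: critical_edges_def critical_cycle_iff)
  note s = scaled_nonneg u(1) scaled_superharmonic[OF u]
  have "i \<in> set c" using c(3) cycle_edges_subset by blast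
  then have pos: "0 < u $ v" if "v \<in> set c" for v using cycle_support[OF s c(1) _ assms(2)] that by blast
  have "cycle_edges c \<subseteq> tight_edges (scaled_submatrix B 1) u"
    using cycle_weight_superharmonic(2)[OF s _ pos] c by (simp add: is_cycle_def)
  then show ?thesis using c(3) scaled_tight_edges(1) by blast
qed

lemma critical_walk_tight:
  assumes "(i, j) \<in> crit_edges B ^^ k" "0 < u $ i"
  shows "(i, j) \<in> (tight_edges B u) ^^ k"
  using assms
proof (induction k arbitrary: i)
  case (Suc k)
  obtain l where l: "(i, l) \<in> crit_edges B" "(l, j) \<in> crit_edges B ^^ k" using relpow_Suc_D2[OF Suc.prems(1)] by blast
  have il: "(i, l) \<in> tight_edges B u" using critical_edge_tight[OF l(1) Suc.prems(2)] .
  show ?case using il Suc.IH[OF l(2) tight_edges_pos(2)[OF B il]] by (rule relpow_Suc_I2)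
qed simp

lemma tight_walk_critical:
  assumes "{i. 0 < u $ i} \<subseteq> accessing_nodes B 1"
    and "(i, j) \<in> (tight_edges B u) ^^ k" "(j, i) \<in> (tight_edges B u)\<^sup>*"
  shows "(i, j) \<in> crit_edges B ^^ k"
  using assms(2,3)
proof (induction k arbitrary: i)
  case (Suc k)
  obtain l where l: "(i, l) \<in> tight_edges B u" "(l, j) \<in> (tight_edges B u) ^^ k"
    using relpow_Suc_D2[OF Suc.prems(1)] by blast
  have "(l, j) \<in> (tight_edges B u)\<^sup>*" using l(2) by (auto simp: rtrancl_power)
  then have "(l, i) \<in> (tight_edges B u)\<^sup>*" using Suc.prems(2) by (rule rtrancl_trans)
  from tight_edge_critical_weight[OF u assms(1) l(1) this]
  have "(i, l) \<in> crit_edges B" by (auto simp: critical_edges_def critical_cycle_iff)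
  moreover have "(j, l) \<in> (tight_edges B u)\<^sup>*" using Suc.prems(2) l(1) by (rule rtrancl_into_rtrancl)
  then have "(l, j) \<in> crit_edges B ^^ k" by (rule Suc.IH[OF l(2)])
  ultimately show ?case by (rule relpow_Suc_I2)
qed simp

text \<open>
  Along a tight walk from \<open>i\<close> to \<open>j\<close>, the ratio of \<open>x\<close> to
  \<open>u\<close> at \<open>j\<close> is a lower bound for the ratio of \<open>T ^^ k\<close>
  applied to \<open>x\<close> to \<open>u\<close> at \<open>i\<close>.
\<close>

lemma tight_walk_ratio:
  assumes "(i, j) \<in> (tight_edges B u) ^^ k" "nonneg_vec x"
  shows "u $ i * x $ j \<le> u $ j * (alg_mult_vec alg B ^^ k) x $ i"
  using assms(1)
proof (induction k arbitrary: i)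
  case (Suc k)
  let ?z = "(alg_mult_vec alg B ^^ k) x"
  obtain l where l: "(i, l) \<in> tight_edges B u" "(l, j) \<in> (tight_edges B u) ^^ k"
    using relpow_Suc_D2[OF Suc.prems] by blast
  have "u $ i * x $ j = B $ i $ l * (u $ l * x $ j)" using l(1) by (auto simp: tight_edges_def)
  also have "\<dots> \<le> B $ i $ l * (u $ j * ?z $ l)"
    by (intro mult_left_mono Suc.IH[OF l(2)] entry_nonneg[OF B])
  also have "\<dots> = u $ j * (B $ i $ l * ?z $ l)" by simp
  also have "\<dots> \<le> u $ j * alg_mult_vec alg B ?z $ i"
    using u(1) mult_vec_ge_entry[OF B mult_vec_pow_nonneg[OF B assms(2)]]
    by (intro mult_left_mono) (auto simp: nonneg_vec_def)
  finally show ?case by simp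
qed simp

end

end

subsection \<open>Cyclicities are periods: max algebra\<close>

text \<open>
  Each node of the support has a tight successor in the support, so tight edges lead from it to
  a tight closed walk, whose class is spectral.
\<close>

lemma max_fixed_support_accessing:
  fixes B :: "real^'n^'n"
  assumes B: "nonneg_mat B" and y: "nonneg_vec y" "alg_mult_vec Max_Algebra B y = y"
  shows "{i. 0 < y $ i} \<subseteq> accessing_nodes B 1"
proof
  fix i assume i: "i \<in> {i. 0 < y $ i}"
  let ?G = "tight_edges B y"
  have le: "B $ i $ j * y $ j \<le> y $ i" for i j
    using superharmonic_entry[OF B y(1), of Max_Algebra] y(2) by simp
  define Q where "Q = {j. 0 < y $ j \<and> (i, j) \<in> ?G\<^sup>*}"
  have "\<exists>l\<in>Q. (j, l) \<in> ?G" if j: "j \<in> Q" for j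
  proof -
    obtain l where "alg_mult_vec Max_Algebra B y $ j = B $ j $ l * y $ l"
      using max_mult_vec_attained[OF B y(1)] by blast
    then have jl: "(j, l) \<in> ?G" using j y(2) by (auto simp: Q_def tight_edges_def)
    then have "l \<in> Q" using j tight_edges_pos(2)[OF B jl] by (auto simp: Q_def intro: rtrancl_into_rtrancl)
    then show ?thesis using jl by blast
  qed
  moreover have "Q \<noteq> {}" using i by (auto simp: Q_def)
  ultimately obtain c k where c: "c \<in> Q" "0 < k" "(c, c) \<in> (Restr ?G Q) ^^ k"
    using closed_walk_exists[of Q ?G] by blast
  then have loop: "(c, c) \<in> ?G ^^ k" by (blast intro: relpow_subset)
  obtain \<nu> where \<nu>: "\<nu> \<in> classes B" "c \<in> \<nu>" using class_exists by blast
  have "spectral_class Max_Algebra B 1 \<nu>"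
    by (rule tight_closed_walk_spectral[OF B y(1) le loop c(2) \<nu>])
  moreover have "(i, c) \<in> (mat_edges B)\<^sup>*"
    using c(1) rtrancl_mono[OF tight_edges_subset[OF B]] by (auto simp: Q_def)
  then have "i \<in> access_set B \<nu>" using \<nu>(2) by (auto simp: access_set_def)
  ultimately show "i \<in> accessing_nodes B 1" by (auto simp: accessing_nodes_eq[OF B])
qed

text \<open>
  It is enough that \<open>x \<le> (T ^^ \<sigma>) x\<close> along the orbit, since the
  increasing sequence obtained by iterating \<open>T ^^ \<sigma>\<close> returns to its start
  after \<open>m\<close> steps. Suppose that some value drops under \<open>T ^^
  \<sigma>\<close>, and among these take one that is largest relative to \<open>y\<close>. The
  successor at which its maximum is attained drops too, is equally large, and is reached by a
  tight edge. So such places lead to a tight closed walk, that is, to a critical node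
  \<open>c\<close>. As the cyclicity of its component divides \<open>\<sigma>\<close>, there is
  a critical closed walk at \<open>c\<close> of length \<open>L \<ge> \<sigma>\<close> with
  \<open>L \<equiv> \<sigma>\<close> modulo \<open>m\<close>. Let \<open>j\<close> be its node
  after \<open>\<sigma>\<close> steps. The remaining \<open>L - \<sigma>\<close> steps are a
  multiple of \<open>m\<close>, so tightness gives the ratio at \<open>j\<close> at least the
  ratio at \<open>c\<close>, and the first \<open>\<sigma>\<close> steps carry it back to
  \<open>c\<close>, where therefore nothing drops.
\<close>

lemma max_cyclicity_is_period:
  fixes B :: "real^'n^'n"
  defines "T \<equiv> alg_mult_vec Max_Algebra B"
  assumes B: "nonneg_mat B" and x: "nonneg_vec x" and m: "0 < m" "(T ^^ m) x = x"
    and \<sigma>: "\<And>N. N \<in> components (crit_nodes B) (crit_edges B) \<Longrightarrow> sc_cyclicity (Restr (crit_edges B) N) dvd \<sigma>"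
  shows "(T ^^ \<sigma>) x = x"
proof -
  define X where "X a = (T ^^ a) x" for a
  obtain y where y: "nonneg_vec y" "T y = y" "\<And>a. (T ^^ a) x \<le> y"
    by (rule periodic_vector_dominated_by_fixed_vector[OF B x m[unfolded T_def], folded T_def]) blast
  let ?G = "tight_edges B y"
  have y_nn: "0 \<le> y $ i" for i using y(1) by (simp add: nonneg_vec_def)
  have le: "B $ i $ j * y $ j \<le> y $ i" for i j
    using superharmonic_entry[OF B y(1), of Max_Algebra] y(2) by (simp add: T_def)
  have supp: "{i. 0 < y $ i} \<subseteq> accessing_nodes B 1"
    by (rule max_fixed_support_accessing[OF B y(1) y(2)[unfolded T_def]])
  have X_nnv: "nonneg_vec (X a)" for a
    unfolding X_def T_def by (rule mult_vec_pow_nonneg[OF B x])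
  then have X_nn: "0 \<le> X a $ i" for a i by (simp add: nonneg_vec_def)
  have X_le: "X a $ i \<le> y $ i" for a i using y(3) by (auto simp: X_def less_eq_vec_def)
  have X_add: "X (a + k) = (T ^^ k) (X a)" for a k
    by (simp add: X_def funpow_add[symmetric, THEN fun_cong, unfolded o_def] add.commute)
  have X_Suc: "X (Suc a) = T (X a)" for a by (simp add: X_def)
  have X_cong: "X a = X b" if "[a = b] (mod m)" for a b
    using funpow_cong[OF m(2) that] by (simp add: X_def)
  have X_mono: "X a $ i \<le> X (a + \<sigma>) $ i" for a i
  proof (rule ccontr)
    define bad where "bad a i \<longleftrightarrow> X (a + \<sigma>) $ i < X a $ i" for a i
    assume "\<not> X a $ i \<le> X (a + \<sigma>) $ i"
    then have bad: "bad a i" by (simp add: bad_def)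
    have bad_cong: "bad a i \<longleftrightarrow> bad b i" if "[a = b] (mod m)" for a b i
      using X_cong[OF that] X_cong[of "a + \<sigma>" "b + \<sigma>"] cong_add[OF that cong_refl] by (simp add: bad_def)
    have bad_pos: "0 < X a $ i" "0 < y $ i" if "bad a i" for a i
      using that X_nn[of "a + \<sigma>" i] X_le[of a i] by (auto simp: bad_def)
    define W where "W = {(i, a). a < m \<and> bad a i}"
    have "W \<subseteq> UNIV \<times> {..<m}" by (auto simp: W_def)
    then have "finite W" by (rule finite_subset) simp
    moreover have "(i, a mod m) \<in> W"
      using bad bad_cong[of a "a mod m" i] m(1) by (simp add: W_def cong_def)
    ultimately obtain p where p: "p \<in> W"
      "\<And>r. r \<in> W \<Longrightarrow> X (snd r) $ fst r / y $ fst r \<le> X (snd p) $ fst p / y $ fst p"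
      using finite_max_exists[of W "\<lambda>r. X (snd r) $ fst r / y $ fst r"] by (metis empty_iff)
    define \<delta> where "\<delta> = X (snd p) $ fst p / y $ fst p"
    have bad_le: "X b $ j \<le> \<delta> * y $ j" if b: "bad b j" for b j
    proof -
      have "(j, b mod m) \<in> W"
        using b bad_cong[of b "b mod m" j] m(1) by (simp add: W_def cong_def)
      moreover have "X (b mod m) = X b" by (rule X_cong) (simp add: cong_def)
      ultimately have "X b $ j / y $ j \<le> \<delta>" using p(2)[of "(j, b mod m)"] by (simp add: \<delta>_def)
      then show ?thesis using bad_pos(2)[OF b] by (simp add: pos_divide_le_eq)
    qed
    have bad_p: "bad (snd p) (fst p)" using p(1) by (auto simp: W_def)
    then have \<delta>: "0 < \<delta>" using bad_pos by (simp add: \<delta>_def)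
    define Q where "Q = {i. \<exists>a. bad a i \<and> X a $ i = \<delta> * y $ i}"
    have "fst p \<in> Q" using bad_p bad_pos(2)[OF bad_p] by (auto simp: Q_def \<delta>_def)
    then have "Q \<noteq> {}" by blast
    moreover have "\<exists>j\<in>Q. (i, j) \<in> ?G" if i: "i \<in> Q" for i
    proof -
      obtain a where a: "bad a i" "X a $ i = \<delta> * y $ i" using i by (auto simp: Q_def)
      (* the time before \<open>a\<close>, moved up by a period so that it is a natural number *)
      define b where "b = a + (m - 1)"
      have ab: "[Suc b = a] (mod m)" using m(1) by (simp add: b_def cong_def)
      obtain j where j: "X (Suc b) $ i = B $ i $ j * X b $ j"
        using max_mult_vec_attained[OF B X_nnv[of b], of i] unfolding X_Suc T_def by blast
      have Xi: "X (Suc b) $ i = \<delta> * y $ i" using X_cong[OF ab] a(2) by simp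
      have "B $ i $ j * X (b + \<sigma>) $ j \<le> X (Suc b + \<sigma>) $ i"
        using mult_vec_ge_entry[OF B X_nnv, of i j "b + \<sigma>" Max_Algebra] by (simp add: X_Suc T_def)
      also have "\<dots> < B $ i $ j * X b $ j"
        using bad_cong[OF ab] a(1) by (simp add: bad_def j[symmetric])
      finally have "bad b j" and Bij: "0 < B $ i $ j"
        using entry_nonneg[OF B, of i j] by (auto simp: bad_def mult_less_cancel_left)
      have "\<delta> * y $ i \<le> \<delta> * (B $ i $ j * y $ j)"
        using mult_left_mono[OF bad_le[OF \<open>bad b j\<close>] entry_nonneg[OF B, of i j]] Xi j
        by (simp add: mult.left_commute)
      then have eq: "B $ i $ j * y $ j = y $ i" using \<delta> le[of i j] by simp
      then have "X b $ j = \<delta> * y $ j" using Bij Xi j by (simp add: mult.left_commute[of \<delta>] eq[symmetric])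
      then have "j \<in> Q" using \<open>bad b j\<close> by (auto simp: Q_def)
      then show ?thesis using eq bad_pos(2)[OF a(1)] by (auto simp: tight_edges_def)
    qed
    ultimately obtain c k where c: "c \<in> Q" "0 < k" "(c, c) \<in> (Restr ?G Q) ^^ k"
      using closed_walk_exists[of Q ?G] by blast
    obtain b where b: "bad b c" using c(1) by (auto simp: Q_def)
    have "(c, c) \<in> ?G ^^ k" using c(3) by (blast intro: relpow_subset)
    then have cc: "(c, c) \<in> crit_edges B ^^ k" by (rule tight_walk_critical[OF B y(1) le supp]) simp
    obtain k' where "k = Suc k'" using c(2) by (cases k) auto
    then obtain z where cz: "(c, z) \<in> crit_edges B" "(z, c) \<in> (crit_edges B)\<^sup>*"
      using relpow_Suc_D2[of c c k' "crit_edges B"] cc by (auto simp: rtrancl_power)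
    have cCN: "c \<in> crit_nodes B" using critical_edges_subset[OF B] cz(1) by blast
    obtain N where N: "N \<in> components (crit_nodes B) (crit_edges B)" "c \<in> N" using component_exists[OF cCN] by blast
    have "(c, z) \<in> (Restr (crit_edges B) N) ^^ 1 \<and> z \<in> N"
      using component_walk[OF critical_edges_subset[OF B] N, of z 1] cz by simp
    then have ne: "Restr (crit_edges B) N \<noteq> {}" by auto
    obtain L where L: "\<sigma> \<le> L" "[L = \<sigma>] (mod m)" "(c, c) \<in> (Restr (crit_edges B) N) ^^ L"
      using closed_walk_in_residue_class[OF component_strongly_connected[OF critical_edges_subset[OF B] N(1)]
          N(2) ne \<sigma>[OF N(1)] m(1)] by blast
    have "(c, c) \<in> crit_edges B ^^ L" using L(3) by (rule relpow_subset) auto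
    then have "(c, c) \<in> ?G ^^ (\<sigma> + (L - \<sigma>))"
      using critical_walk_tight[OF B y(1) le _ bad_pos(2)[OF b]] L(1) by simp
    then obtain j where j: "(c, j) \<in> ?G ^^ \<sigma>" "(j, c) \<in> ?G ^^ (L - \<sigma>)"
      unfolding relpow_add by blast
    have "[\<sigma> + (L - \<sigma>) = \<sigma> + 0] (mod m)" using L(1,2) by simp
    then have "[L - \<sigma> = 0] (mod m)" by (simp only: cong_add_lcancel_nat)
    then have "[b + (L - \<sigma>) = b + 0] (mod m)" by (rule cong_add[OF cong_refl])
    from X_cong[OF this] have r: "y $ j * X b $ c \<le> y $ c * X b $ j"
      using tight_walk_ratio[OF B y(1) le j(2) X_nnv, of b Max_Algebra] by (simp add: X_add[symmetric] T_def[symmetric])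
    have s: "y $ c * X b $ j \<le> y $ j * X (b + \<sigma>) $ c"
      using tight_walk_ratio[OF B y(1) le j(1) X_nnv, of b Max_Algebra] by (simp add: X_add T_def[symmetric])
    have "0 < y $ j"
    proof (cases "\<sigma>")
      case 0
      then show ?thesis using j(1) bad_pos(2)[OF b] by simp
    next
      case (Suc n)
      then obtain l where "(l, j) \<in> ?G" using j(1) by auto
      then show ?thesis by (rule tight_edges_pos(2)[OF B])
    qed
    then have "X b $ c \<le> X (b + \<sigma>) $ c" using order.trans[OF r s] by simp
    then show False using b by (simp add: bad_def)
  qed
  have "X a $ i \<le> X (a + k * \<sigma>) $ i" for a k i
  proof (induction k)
    case (Suc k)
    then show ?case using X_mono[of "a + k * \<sigma>" i] by (simp add: ac_simps)
  qed simp
  from this[of \<sigma> _ "m - 1"] have "X \<sigma> $ i \<le> X (m * \<sigma>) $ i" for i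
    using m(1) by (cases m) (auto simp: ac_simps)
  moreover have "X (m * \<sigma>) = X 0" by (rule X_cong) (simp add: cong_def)
  ultimately have "X \<sigma> $ i = X 0 $ i" for i using X_mono[of 0 i] by (simp add: order.antisym)
  then show ?thesis by (simp add: X_def vec_eq_iff)
qed

text \<open>
  Here \<open>G\<close> is the critical component, and \<open>\<theta>\<close> is the largest
  scaled entry of an edge that is not tight. A walk from \<open>i0\<close> back to
  \<open>N\<close> with weight above \<open>\<theta>\<close> relative to \<open>u\<close> is
  tight, so together with a critical walk from its end to \<open>i0\<close> it forms a critical
  closed walk and stays in the component.
\<close>

lemma max_period_multiple_of_cyclicity:
  fixes B :: "real^'n^'n"
  defines "T \<equiv> alg_mult_vec Max_Algebra B"
  assumes B: "nonneg_mat B" and N: "N \<in> components (crit_nodes B) (crit_edges B)"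
    and q: "\<And>x. nonneg_vec x \<Longrightarrow> (T ^^ sc_cyclicity (Restr (crit_edges B) N)) x = x \<Longrightarrow> (T ^^ q) x = x"
  shows "sc_cyclicity (Restr (crit_edges B) N) dvd q"
proof -
  let ?R = "Restr (crit_edges B) N"
  note comp = critical_edges_subset[OF B] N
  note sc = component_strongly_connected[OF comp]
  obtain i0 where i0: "i0 \<in> N" using component_nonempty[OF N] by blast
  then have "i0 \<in> crit_nodes B" using component_subset[OF N] by blast
  then have "i0 \<in> accessing_nodes B 1" by (rule critical_node_accessing[OF B])
  then obtain u where u: "nonneg_vec u" "\<And>i j. B $ i $ j * u $ j \<le> u $ i" "0 < u $ i0"
    "T u \<le> u" "{i. 0 < u $ i} \<subseteq> accessing_nodes B 1"
    unfolding T_def by (rule max_superharmonic_vector[OF B]) blast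
  let ?G = "tight_edges B u"
  have u_nn: "0 \<le> u $ i" for i using u(1) by (simp add: nonneg_vec_def)
  have N_conn: "(i, j) \<in> (crit_edges B)\<^sup>*" if "i \<in> N" "j \<in> N" for i j
    using component_eq[OF N that(1)] that(2) by blast
  have N_pos: "0 < u $ i" if "i \<in> N" for i
    using superharmonic_support_pred[OF B u(2) _ u(3)] N_conn[OF that i0]
      rtrancl_mono[OF critical_edges_mat_edges[OF B]] by blast
  define \<theta> where "\<theta> = Max (insert 0 ((\<lambda>(i, j). B $ i $ j * u $ j / u $ i) `
      {(i, j). 0 < u $ i \<and> (i, j) \<notin> ?G}))"
  have \<theta>0: "0 \<le> \<theta>" unfolding \<theta>_def by (rule Max_ge) auto
  have "\<theta> < 1"
  proof -
    have "B $ i $ j * u $ j / u $ i < 1" if "0 < u $ i" "(i, j) \<notin> ?G" for i j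
      using that u(2)[of i j] by (auto simp: tight_edges_def pos_divide_less_eq)
    then show ?thesis unfolding \<theta>_def by (subst Max_less_iff) auto
  qed
  have \<theta>_ge: "B $ i $ j * u $ j \<le> \<theta> * u $ i" if "0 < u $ i" "(i, j) \<notin> ?G" for i j
  proof -
    have "B $ i $ j * u $ j / u $ i \<le> \<theta>" unfolding \<theta>_def using that by (intro Max_ge) force+
    then show ?thesis using that(1) by (simp add: pos_divide_le_eq)
  qed
  have dich: "(T ^^ k) w $ i \<le> \<theta> * u $ i \<or> (\<exists>j. 0 < w $ j \<and> (i, j) \<in> ?G ^^ k)"
    if w: "nonneg_vec w" "w \<le> u" for w k i
  proof (induction k arbitrary: i)
    case 0
    show ?case
    proof (cases "0 < w $ i")
      case False
      then have "w $ i \<le> 0" by simp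
      also have "\<dots> \<le> \<theta> * u $ i" using \<theta>0 u_nn by simp
      finally show ?thesis by simp
    qed auto
  next
    case (Suc k)
    let ?z = "(T ^^ k) w"
    have z: "nonneg_vec ?z" unfolding T_def by (rule mult_vec_pow_nonneg[OF B w(1)])
    have Tu: "(T ^^ k) u \<le> u" for k
    proof (induction k)
      case (Suc k)
      then have "T ((T ^^ k) u) \<le> T u" unfolding T_def by (rule mult_vec_mono[OF B])
      then show ?case using u(4) by simp
    qed simp
    have z_le: "?z \<le> u" using mult_vec_pow_mono[OF B w(2), of k Max_Algebra] Tu[of k]
      unfolding T_def by (rule order.trans)
    obtain j where j: "(T ^^ Suc k) w $ i = B $ i $ j * ?z $ j"
      using max_mult_vec_attained[OF B z, of i] by (auto simp: T_def)
    have z_j: "B $ i $ j * ?z $ j \<le> B $ i $ j * u $ j"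
      using z_le entry_nonneg[OF B] by (auto simp: less_eq_vec_def intro: mult_left_mono)
    show ?case
    proof (cases "(i, j) \<in> ?G")
      case True
      from Suc.IH[of j] show ?thesis
      proof
        assume "?z $ j \<le> \<theta> * u $ j"
        then have "B $ i $ j * ?z $ j \<le> B $ i $ j * (\<theta> * u $ j)"
          using entry_nonneg[OF B] by (rule mult_left_mono)
        also have "\<dots> = \<theta> * u $ i" using True by (simp add: tight_edges_def mult.left_commute)
        finally show ?thesis using j by simp
      next
        assume "\<exists>l. 0 < w $ l \<and> (j, l) \<in> ?G ^^ k"
        then show ?thesis using True by (blast intro: relpow_Suc_I2)
      qed
    next
      case False
      show ?thesis
      proof (cases "0 < u $ i")
        case True
        then show ?thesis using \<theta>_ge[OF True False] z_j j by simp
      next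
        case False
        then have "u $ i = 0" using u_nn[of i] by simp
        then show ?thesis using z_j u(2)[of i j] j by simp
      qed
    qed
  qed
  show ?thesis
  proof (rule period_multiple_of_cyclicity[OF B u(1) _ sc i0 u(3), where \<theta> = \<theta> and alg = Max_Algebra, folded T_def])
    show "T u \<le> u" by fact
    show "sc_cyclicity ?R dvd k" if "(i0, i0) \<in> ?R ^^ k" for k
      using that by (rule sc_cyclicity_dvd_closed_walk)
    show "u $ i \<le> T w $ i" if i: "i \<in> N" and w: "nonneg_vec w" "\<And>j. (i, j) \<in> ?R \<Longrightarrow> w $ j = u $ j" for i w
    proof -
      have "i \<in> crit_nodes B" using i component_subset[OF N] by blast
      then obtain j where j: "(i, j) \<in> crit_edges B" "(j, i) \<in> (crit_edges B)\<^sup>*"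
        using critical_node_successor[OF B] by blast
      then have "(i, j) \<in> ?R ^^ 1" using component_walk[OF comp i, of j 1] by simp
      then have "w $ j = u $ j" using w(2) by simp
      moreover have "B $ i $ j * u $ j = u $ i"
        using critical_edge_tight[OF B u(1,2) j(1) N_pos[OF i]] by (simp add: tight_edges_def)
      ultimately show ?thesis using mult_vec_ge_entry[OF B w(1), of i j Max_Algebra] by (simp add: T_def)
    qed
    show "(T ^^ k) w $ i0 \<le> \<theta> * u $ i0 \<or> (\<exists>j. 0 < w $ j \<and> (i0, j) \<in> ?R ^^ k)"
      if w: "nonneg_vec w" "w \<le> u" "\<And>j. 0 < w $ j \<Longrightarrow> j \<in> N" for k w
    proof -
      have "(i0, j) \<in> ?R ^^ k" if j: "0 < w $ j" "(i0, j) \<in> ?G ^^ k" for j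
      proof -
        have ret: "(j, i0) \<in> (crit_edges B)\<^sup>*" using N_conn w(3)[OF j(1)] i0 by blast
        then obtain l where "(j, i0) \<in> crit_edges B ^^ l" by (auto simp: rtrancl_power)
        then have "(j, i0) \<in> ?G ^^ l"
          by (rule critical_walk_tight[OF B u(1,2) _ N_pos[OF w(3)[OF j(1)]]])
        then have "(j, i0) \<in> ?G\<^sup>*" by (auto simp: rtrancl_power)
        then have "(i0, j) \<in> crit_edges B ^^ k" by (rule tight_walk_critical[OF B u(1,2,5) j(2)])
        then show ?thesis using component_walk[OF comp i0 _ ret] by blast
      qed
      then show ?thesis using dich[OF w(1,2), of k i0] by blast
    qed
    show "(T ^^ q) x = x" if "nonneg_vec x" "(T ^^ sc_cyclicity ?R) x = x" for x using that by (rule q)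
  qed (use \<open>\<theta> < 1\<close> in auto)
qed

section \<open>Periods of the eigencone sequences\<close>

text \<open>
  The numbers whose least common multiple is \<open>\<sigma>\<^sub>\<rho>\<close>, for
  \<open>\<rho> = 1\<close>.
\<close>

fun cyclicity_set :: "algebra \<Rightarrow> real^'n^'n \<Rightarrow> nat set" where
  "cyclicity_set Nonneg_Algebra B =
     {sc_cyclicity (Restr (mat_edges B) \<nu>) | \<nu>. spectral_class Nonneg_Algebra B 1 \<nu>}"
| "cyclicity_set Max_Algebra B = {sc_cyclicity (Restr (crit_edges B) N) | N. N \<in> components (crit_nodes B) (crit_edges B)}"

lemma sigma_num_eq_Lcm: "sigma_num alg B 1 = Lcm (cyclicity_set alg B)"
  by (cases alg) (simp_all add: cyclicity_def)

lemma finite_cyclicity_set: "finite (cyclicity_set alg B)"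
  by (cases alg) (simp_all add: setcompr_eq_image)

context
  fixes B :: "real^'n^'n"
  assumes B: "nonneg_mat B"
begin

lemma cyclicity_set_pos:
  assumes "d \<in> cyclicity_set alg B"
  shows "0 < d"
proof (cases alg)
  case Nonneg_Algebra
  then obtain \<nu> where "\<nu> \<in> classes B" "d = sc_cyclicity (Restr (mat_edges B) \<nu>)"
    using assms by (auto simp: spectral_class_def)
  then show ?thesis using sc_cyclicity_pos[OF class_strongly_connected(1)] by blast
next
  case Max_Algebra
  then show ?thesis using assms component_cyclicity_pos[OF critical_edges_subset[OF B]] by auto
qed

lemma cyclicity_set_dvd_period:
  assumes "d \<in> cyclicity_set alg B"
    and "\<And>x. nonneg_vec x \<Longrightarrow> (alg_mult_vec alg B ^^ d) x = x \<Longrightarrow> (alg_mult_vec alg B ^^ q) x = x"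
  shows "d dvd q"
proof (cases alg)
  case Nonneg_Algebra
  then obtain \<nu> where \<nu>: "spectral_class Nonneg_Algebra B 1 \<nu>" "d = sc_cyclicity (Restr (mat_edges B) \<nu>)"
    using assms(1) by auto
  show ?thesis unfolding \<nu>(2)
    by (rule nonneg_period_multiple_of_cyclicity[OF B \<nu>(1) assms(2)[unfolded Nonneg_Algebra \<nu>(2)]])
next
  case Max_Algebra
  then obtain N where N: "N \<in> components (crit_nodes B) (crit_edges B)" "d = sc_cyclicity (Restr (crit_edges B) N)"
    using assms(1) by auto
  show ?thesis unfolding N(2)
    by (rule max_period_multiple_of_cyclicity[OF B N(1) assms(2)[unfolded Max_Algebra N(2)]])
qed

lemma cyclicity_multiple_is_period:
  assumes "\<And>d. d \<in> cyclicity_set alg B \<Longrightarrow> d dvd \<sigma>"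
    and "nonneg_vec x" "0 < m" "(alg_mult_vec alg B ^^ m) x = x"
  shows "(alg_mult_vec alg B ^^ \<sigma>) x = x"
proof (cases alg)
  case Nonneg_Algebra
  have "sc_cyclicity (Restr (mat_edges B) \<nu>) dvd \<sigma>" if "spectral_class Nonneg_Algebra B 1 \<nu>" for \<nu>
    using that assms(1) Nonneg_Algebra by auto
  from nonneg_cyclicity_is_period[OF B assms(2,3) assms(4)[unfolded Nonneg_Algebra] this]
  show ?thesis unfolding Nonneg_Algebra .
next
  case Max_Algebra
  have "sc_cyclicity (Restr (crit_edges B) N) dvd \<sigma>" if "N \<in> components (crit_nodes B) (crit_edges B)" for N
    using that assms(1) Max_Algebra by auto
  from max_cyclicity_is_period[OF B assms(2,3) assms(4)[unfolded Max_Algebra] this]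
  show ?thesis unfolding Max_Algebra .
qed

end

context
  fixes alg :: algebra and A :: "real^'n^'n" and \<rho> :: real
  assumes A: "nonneg_mat A" and \<rho>: "0 < \<rho>"
begin

abbreviation "scaled_action \<equiv> alg_mult_vec alg (inverse \<rho> *\<^sub>R A)"

lemma scaled_nonneg_mat: "nonneg_mat (inverse \<rho> *\<^sub>R A)"
  using A \<rho> by (intro nonneg_mat_scale) auto

lemma sigma_num_eq_Lcm_scaled: "sigma_num alg A \<rho> = Lcm (cyclicity_set alg (inverse \<rho> *\<^sub>R A))"
  by (simp only: sigma_num_scale[OF A \<rho>] sigma_num_eq_Lcm)

lemma sigma_num_pos: "0 < sigma_num alg A \<rho>"
proof -
  have "0 \<notin> cyclicity_set alg (inverse \<rho> *\<^sub>R A)"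
    using cyclicity_set_pos[OF scaled_nonneg_mat, of 0 alg] by blast
  then have "sigma_num alg A \<rho> \<noteq> 0"
    unfolding sigma_num_eq_Lcm_scaled using finite_cyclicity_set by (subst Lcm_0_iff) auto
  then show ?thesis by simp
qed

lemma sigma_num_is_period:
  assumes "nonneg_vec x" "0 < m" "(scaled_action ^^ m) x = x" "sigma_num alg A \<rho> dvd s"
  shows "(scaled_action ^^ s) x = x"
proof (rule cyclicity_multiple_is_period[OF scaled_nonneg_mat _ assms(1-3)])
  fix d assume "d \<in> cyclicity_set alg (inverse \<rho> *\<^sub>R A)"
  then have "d dvd sigma_num alg A \<rho>" unfolding sigma_num_eq_Lcm_scaled by (rule dvd_Lcm)
  then show "d dvd s" using assms(4) by (rule dvd_trans)
qed

lemma sigma_num_dvd_common_period: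
  assumes "\<And>x. nonneg_vec x \<Longrightarrow> (scaled_action ^^ sigma_num alg A \<rho>) x = x \<Longrightarrow> (scaled_action ^^ q) x = x"
  shows "sigma_num alg A \<rho> dvd q"
  unfolding sigma_num_eq_Lcm_scaled
proof (rule Lcm_least)
  fix d assume d: "d \<in> cyclicity_set alg (inverse \<rho> *\<^sub>R A)"
  show "d dvd q"
  proof (rule cyclicity_set_dvd_period[OF scaled_nonneg_mat d])
    fix x assume x: "nonneg_vec x" "(scaled_action ^^ d) x = x"
    have "d dvd sigma_num alg A \<rho>" unfolding sigma_num_eq_Lcm_scaled using d by (rule dvd_Lcm)
    then obtain k where k: "sigma_num alg A \<rho> = d * k" by (rule dvdE)
    have "(scaled_action ^^ sigma_num alg A \<rho>) x = x"
      unfolding k using funpow_periodic[OF x(2), of 0 k] by simp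
    then show "(scaled_action ^^ q) x = x" by (rule assms[OF x(1)])
  qed
qed

lemma eigencone_power_subset:
  assumes "1 \<le> k" "sigma_num alg A \<rho> dvd s"
  shows "eigencone alg (alg_power alg A k) (\<rho> ^ k) \<subseteq> eigencone alg (alg_power alg A s) (\<rho> ^ s)"
  using assms sigma_num_is_period[of _ k s] by (auto simp: mem_eigencone_power_iff[OF A \<rho>])

text \<open>
  A vector fixed by \<open>T ^^ k\<close> or by \<open>T ^^ (k + s)\<close> is also fixed by
  \<open>T ^^ s\<close>, and then the two conditions agree.
\<close>

lemma eigencone_power_periodic:
  assumes "1 \<le> k" "sigma_num alg A \<rho> dvd s"
  shows "eigencone alg (alg_power alg A (k + s)) (\<rho> ^ (k + s)) = eigencone alg (alg_power alg A k) (\<rho> ^ k)"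
proof -
  have "(scaled_action ^^ (k + s)) x = x \<longleftrightarrow> (scaled_action ^^ k) x = x" if x: "nonneg_vec x" for x
  proof -
    have "(scaled_action ^^ s) x = x" if "(scaled_action ^^ m) x = x" "0 < m" for m
      by (rule sigma_num_is_period[OF x that(2,1) assms(2)])
    moreover have "(scaled_action ^^ (k + s)) x = (scaled_action ^^ k) x" if "(scaled_action ^^ s) x = x"
      using that by (simp add: funpow_add)
    ultimately show ?thesis using assms(1) by (metis add_gr_0 less_eq_Suc_le One_nat_def)
  qed
  then show ?thesis by (auto simp: mem_eigencone_power_iff[OF A \<rho>])
qed

text \<open>
  Every vector with period \<open>\<sigma>\<^sub>\<rho>\<close> lies in the eigencone with
  exponent \<open>s\<close>; if it also lies in the one with exponent \<open>s + q\<close>, then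
  \<open>q\<close> is a period of it.
\<close>

lemma sigma_num_dvd_period:
  assumes "sigma_num alg A \<rho> dvd s"
    and "eigencone alg (alg_power alg A s) (\<rho> ^ s) \<subseteq> eigencone alg (alg_power alg A (s + q)) (\<rho> ^ (s + q))"
  shows "sigma_num alg A \<rho> dvd q"
proof (rule sigma_num_dvd_common_period)
  fix x assume x: "nonneg_vec x" "(scaled_action ^^ sigma_num alg A \<rho>) x = x"
  have s: "(scaled_action ^^ s) x = x" by (rule sigma_num_is_period[OF x(1) sigma_num_pos x(2) assms(1)])
  then have "(scaled_action ^^ (q + s)) x = x"
    using assms(2) x(1) by (auto simp: mem_eigencone_power_iff[OF A \<rho>] add.commute)
  then show "(scaled_action ^^ q) x = x" using s by (simp add: funpow_add)
qed

lemma mem_eigencone_iff: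
  "x \<in> eigencone alg A \<rho> \<longleftrightarrow> nonneg_vec x \<and> scaled_action x = x"
proof -
  have "v = \<rho> *\<^sub>R x \<longleftrightarrow> inverse \<rho> *\<^sub>R v = x" for v using \<rho> by auto
  then show ?thesis using \<rho> by (auto simp: eigencone_def mult_vec_scale_mat)
qed

lemma eigencone_power_action:
  assumes "x \<in> eigencone alg (alg_power alg A s) (\<rho> ^ s)"
  shows "(alg_mult_vec alg A ^^ (s * t)) x = \<rho> ^ (s * t) *\<^sub>R x"
proof -
  have "(scaled_action ^^ s) x = x" using assms by (simp add: mem_eigencone_power_iff[OF A \<rho>])
  from funpow_periodic[OF this, of 0 t] have "(scaled_action ^^ (s * t)) x = x" by simp
  then have "inverse \<rho> ^ (s * t) *\<^sub>R (alg_mult_vec alg A ^^ (s * t)) x = x"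
    using \<rho> mult_vec_pow_scale_mat[OF _ A, of "inverse \<rho>" "s * t" alg x] by simp
  then have "\<rho> ^ (s * t) *\<^sub>R x = \<rho> ^ (s * t) *\<^sub>R (inverse \<rho> ^ (s * t) *\<^sub>R (alg_mult_vec alg A ^^ (s * t)) x)" by simp
  also have "\<dots> = (alg_mult_vec alg A ^^ (s * t)) x" using \<rho> by (simp add: power_mult_distrib[symmetric])
  finally show ?thesis ..
qed

end

lemma nonzero_eigvals_pos: "\<rho> \<in> nonzero_eigvals alg A \<Longrightarrow> 0 < \<rho>"
  by (auto simp: nonzero_eigvals_def eigval_def)

text \<open>
  If \<open>x\<close> is an eigenvector of the power, its sum over the orbit under \<open>A /
  \<rho>\<close> is an eigenvector of \<open>A\<close>, nonzero because it is at least
  \<open>x\<close>.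
\<close>

lemma nonzero_eigvals_power:
  fixes A :: "real^'n^'n"
  assumes A: "nonneg_mat A" and k: "1 \<le> k"
  shows "nonzero_eigvals alg (alg_power alg A k) = (\<lambda>\<rho>. \<rho> ^ k) ` nonzero_eigvals alg A"
proof (intro equalityI subsetI)
  fix \<mu> assume \<mu>: "\<mu> \<in> nonzero_eigvals alg (alg_power alg A k)"
  define \<rho> where "\<rho> = root k \<mu>"
  have \<rho>: "0 < \<rho>" "\<mu> = \<rho> ^ k" using nonzero_eigvals_pos[OF \<mu>] k by (auto simp: \<rho>_def real_root_gt_zero)
  obtain x where x: "x \<in> eigencone alg (alg_power alg A k) (\<rho> ^ k)" "x \<noteq> 0"
    using \<mu> unfolding nonzero_eigvals_def eigval_def \<rho>(2) by blast
  let ?T = "alg_mult_vec alg (inverse \<rho> *\<^sub>R A)"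
  have xT: "nonneg_vec x" "(?T ^^ k) x = x" using x(1) by (auto simp: mem_eigencone_power_iff[OF A \<rho>(1)])
  have "0 < k" using k by simp
  then obtain y where y: "nonneg_vec y" "?T y = y" "\<And>a. (?T ^^ a) x \<le> y"
    by (rule periodic_vector_dominated_by_fixed_vector[OF scaled_nonneg_mat[OF A \<rho>(1)] xT(1) _ xT(2)]) blast
  have "y \<noteq> 0"
  proof
    assume "y = 0"
    then have "x \<le> 0" using y(3)[of 0] by simp
    then show False using xT(1) x(2) by (auto simp: less_eq_vec_def nonneg_vec_def vec_eq_iff intro: order.antisym)
  qed
  moreover have "y \<in> eigencone alg A \<rho>" using y(1,2) by (simp add: mem_eigencone_iff[OF A \<rho>(1)])
  ultimately have "\<rho> \<in> nonzero_eigvals alg A" using \<rho>(1) by (auto simp: nonzero_eigvals_def eigval_def)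
  then show "\<mu> \<in> (\<lambda>\<rho>. \<rho> ^ k) ` nonzero_eigvals alg A" using \<rho>(2) by blast
next
  fix \<mu> assume "\<mu> \<in> (\<lambda>\<rho>. \<rho> ^ k) ` nonzero_eigvals alg A"
  then obtain \<rho> where \<rho>: "\<rho> \<in> nonzero_eigvals alg A" "\<mu> = \<rho> ^ k" by blast
  have pos: "0 < \<rho>" by (rule nonzero_eigvals_pos[OF \<rho>(1)])
  obtain x where x: "x \<in> eigencone alg A \<rho>" "x \<noteq> 0" using \<rho>(1) by (auto simp: nonzero_eigvals_def eigval_def)
  have "x \<in> eigencone alg (alg_power alg A k) (\<rho> ^ k)"
    using x(1) funpow_periodic[of 1 "alg_mult_vec alg (inverse \<rho> *\<^sub>R A)" x 0 k]
    by (simp add: mem_eigencone_iff[OF A pos] mem_eigencone_power_iff[OF A pos])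
  then show "\<mu> \<in> nonzero_eigvals alg (alg_power alg A k)"
    using x(2) pos \<rho>(2) by (auto simp: nonzero_eigvals_def eigval_def)
qed

text \<open>
  Indexing the summands by the eigenvalues of \<open>A\<close> instead of those of the power
  makes the sums for different exponents comparable term by term.
\<close>

lemma mem_eigencone_sum_power_iff:
  fixes A :: "real^'n^'n"
  assumes A: "nonneg_mat A" and k: "1 \<le> k"
  shows "z \<in> eigencone_sum alg (alg_power alg A k) \<longleftrightarrow>
    (\<exists>F y. finite F \<and> F \<subseteq> nonzero_eigvals alg A \<and>
      (\<forall>\<rho>\<in>F. y \<rho> \<in> eigencone alg (alg_power alg A k) (\<rho> ^ k)) \<and> z = (\<chi> i. alg_sum alg (\<lambda>\<rho>. y \<rho> $ i) F))"
proof
  assume "z \<in> eigencone_sum alg (alg_power alg A k)"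
  then obtain x F where F: "finite F" "F \<subseteq> nonzero_eigvals alg (alg_power alg A k)"
    "\<forall>\<mu>\<in>F. x \<mu> \<in> eigencone alg (alg_power alg A k) \<mu>" "z = (\<chi> i. alg_sum alg (\<lambda>\<rho>. x \<rho> $ i) F)"
    unfolding eigencone_sum_def by blast
  obtain F' where F': "F' \<subseteq> nonzero_eigvals alg A" "F = (\<lambda>\<rho>. \<rho> ^ k) ` F'" "inj_on (\<lambda>\<rho>. \<rho> ^ k) F'"
    using F(2) unfolding nonzero_eigvals_power[OF A k] by (metis subset_image_inj)
  have "finite F'" using F(1) F'(2,3) by (simp add: finite_image_iff)
  moreover have "alg_sum alg (\<lambda>\<rho>. x \<rho> $ i) F = alg_sum alg (\<lambda>\<rho>. x (\<rho> ^ k) $ i) F'" for i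
    unfolding F'(2) by (rule alg_sum_reindex[OF F'(3)])
  ultimately show "\<exists>F y. finite F \<and> F \<subseteq> nonzero_eigvals alg A \<and>
      (\<forall>\<rho>\<in>F. y \<rho> \<in> eigencone alg (alg_power alg A k) (\<rho> ^ k)) \<and> z = (\<chi> i. alg_sum alg (\<lambda>\<rho>. y \<rho> $ i) F)"
    using F F' by (intro exI[of _ F'] exI[of _ "\<lambda>\<rho>. x (\<rho> ^ k)"]) auto
next
  assume "\<exists>F y. finite F \<and> F \<subseteq> nonzero_eigvals alg A \<and>
      (\<forall>\<rho>\<in>F. y \<rho> \<in> eigencone alg (alg_power alg A k) (\<rho> ^ k)) \<and> z = (\<chi> i. alg_sum alg (\<lambda>\<rho>. y \<rho> $ i) F)"
  then obtain F y where F: "finite F" "F \<subseteq> nonzero_eigvals alg A"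
    "\<And>\<rho>. \<rho> \<in> F \<Longrightarrow> y \<rho> \<in> eigencone alg (alg_power alg A k) (\<rho> ^ k)"
    "z = (\<chi> i. alg_sum alg (\<lambda>\<rho>. y \<rho> $ i) F)" by blast
  have root: "root k (\<rho> ^ k) = \<rho>" if "\<rho> \<in> F" for \<rho>
    using that F(2) k nonzero_eigvals_pos[of \<rho> alg A] by (intro real_root_power_cancel) auto
  have inj: "inj_on (\<lambda>\<rho>. \<rho> ^ k) F" by (rule inj_on_inverseI[of _ "root k"]) (rule root)
  have "alg_sum alg (\<lambda>\<mu>. y (root k \<mu>) $ i) ((\<lambda>\<rho>. \<rho> ^ k) ` F) = alg_sum alg (\<lambda>\<rho>. y \<rho> $ i) F" for i
    unfolding alg_sum_reindex[OF inj] by (rule alg_sum_cong) (auto simp: root)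
  then have "z = (\<chi> i. alg_sum alg (\<lambda>\<mu>. y (root k \<mu>) $ i) ((\<lambda>\<rho>. \<rho> ^ k) ` F))" by (simp add: F(4))
  moreover have "(\<lambda>\<rho>. \<rho> ^ k) ` F \<subseteq> nonzero_eigvals alg (alg_power alg A k)"
    using F(2) by (auto simp: nonzero_eigvals_power[OF A k])
  moreover have "\<forall>\<mu>\<in>(\<lambda>\<rho>. \<rho> ^ k) ` F. y (root k \<mu>) \<in> eigencone alg (alg_power alg A k) \<mu>"
    using F(3) root by auto
  ultimately show "z \<in> eigencone_sum alg (alg_power alg A k)"
    unfolding eigencone_sum_def using F(1)
    by (intro CollectI exI[of _ "\<lambda>\<mu>. y (root k \<mu>)"] exI[of _ "(\<lambda>\<rho>. \<rho> ^ k) ` F"] conjI) simp_all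
qed

lemma eigencone_sum_power_mono:
  fixes A :: "real^'n^'n"
  assumes "nonneg_mat A" "1 \<le> k" "1 \<le> l"
    and "\<And>\<rho>. \<rho> \<in> nonzero_eigvals alg A \<Longrightarrow>
      eigencone alg (alg_power alg A k) (\<rho> ^ k) \<subseteq> eigencone alg (alg_power alg A l) (\<rho> ^ l)"
  shows "eigencone_sum alg (alg_power alg A k) \<subseteq> eigencone_sum alg (alg_power alg A l)"
proof
  fix z assume "z \<in> eigencone_sum alg (alg_power alg A k)"
  then obtain F y where "finite F" "F \<subseteq> nonzero_eigvals alg A"
    "\<forall>\<rho>\<in>F. y \<rho> \<in> eigencone alg (alg_power alg A k) (\<rho> ^ k)" "z = (\<chi> i. alg_sum alg (\<lambda>\<rho>. y \<rho> $ i) F)"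
    unfolding mem_eigencone_sum_power_iff[OF assms(1,2)] by blast
  moreover from this have "\<forall>\<rho>\<in>F. y \<rho> \<in> eigencone alg (alg_power alg A l) (\<rho> ^ l)"
    using assms(4) by blast
  ultimately show "z \<in> eigencone_sum alg (alg_power alg A l)"
    unfolding mem_eigencone_sum_power_iff[OF assms(1,3)] by blast
qed

lemma eigencone_subset_sum:
  fixes A :: "real^'n^'n"
  assumes "nonneg_mat A" "1 \<le> k" "\<rho> \<in> nonzero_eigvals alg A"
  shows "eigencone alg (alg_power alg A k) (\<rho> ^ k) \<subseteq> eigencone_sum alg (alg_power alg A k)"
proof
  fix x assume x: "x \<in> eigencone alg (alg_power alg A k) (\<rho> ^ k)"
  then have "x = (\<chi> i. alg_sum alg (\<lambda>\<rho>. x $ i) {\<rho>})"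
    by (simp add: vec_eq_iff alg_sum_singleton eigencone_def nonneg_vec_def)
  then show "x \<in> eigencone_sum alg (alg_power alg A k)"
    unfolding mem_eigencone_sum_power_iff[OF assms(1,2)] using x assms(3)
    by (intro exI[of _ "{\<rho>}"] exI[of _ "\<lambda>_. x"]) auto
qed

text \<open>
  Apply the \<open>t\<close>-th power of the \<open>s\<close>-th power of \<open>A /
  \<rho>\<close> to the sum. It fixes \<open>x\<close> and multiplies the summand \<open>z
  \<mu>\<close> by \<open>((\<mu> / \<rho>) ^ s) ^ t\<close>. Since all summands stay below
  \<open>x\<close>, those with \<open>\<mu> > \<rho>\<close> must vanish, and those with
  \<open>\<mu> < \<rho>\<close> disappear as \<open>t\<close> tends to infinity. In nonnegative
  algebra linear independence would do; this argument covers max algebra as well.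
\<close>

lemma eigencone_sum_component:
  fixes A :: "real^'n^'n"
  assumes A: "nonneg_mat A" and s: "1 \<le> s" and \<rho>: "0 < \<rho>"
    and x: "x \<in> eigencone alg (alg_power alg A s) (\<rho> ^ s)"
    and F: "finite F" "\<And>\<mu>. \<mu> \<in> F \<Longrightarrow> 0 < \<mu>"
    and z: "\<And>\<mu>. \<mu> \<in> F \<Longrightarrow> z \<mu> \<in> eigencone alg (alg_power alg A s) (\<mu> ^ s)"
    and sum: "x = (\<chi> i. alg_sum alg (\<lambda>\<mu>. z \<mu> $ i) F)"
  shows "x = (if \<rho> \<in> F then z \<rho> else 0)"
proof -
  have z_nn: "0 \<le> z \<mu> $ i" if "\<mu> \<in> F" for \<mu> i using z[OF that] by (simp add: eigencone_def nonneg_vec_def)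
  have "x $ i = (if \<rho> \<in> F then z \<rho> else 0) $ i" for i
  proof -
    define g where "g \<mu> t = ((\<mu> / \<rho>) ^ s) ^ t * z \<mu> $ i" for \<mu> t
    have g_nn: "0 \<le> g \<mu> t" if "\<mu> \<in> F" for \<mu> t
      using z_nn[OF that] F(2)[OF that] \<rho> by (simp add: g_def)
    have eq: "alg_sum alg (\<lambda>\<mu>. g \<mu> t) F = x $ i" for t
    proof -
      have "\<rho> ^ (s * t) *\<^sub>R x = (\<chi> i. alg_sum alg (\<lambda>\<mu>. (alg_mult_vec alg A ^^ (s * t)) (z \<mu>) $ i) F)"
        unfolding eigencone_power_action[OF A \<rho> x, symmetric]
        by (subst sum) (rule mult_vec_pow_alg_sum[OF A F(1)])
      then have "\<rho> ^ (s * t) * x $ i = alg_sum alg (\<lambda>\<mu>. (alg_mult_vec alg A ^^ (s * t)) (z \<mu>) $ i) F"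
        by (simp add: vec_eq_iff)
      also have "\<dots> = alg_sum alg (\<lambda>\<mu>. \<rho> ^ (s * t) * g \<mu> t) F"
      proof (rule alg_sum_cong[OF refl])
        fix \<mu> assume \<mu>: "\<mu> \<in> F"
        show "(alg_mult_vec alg A ^^ (s * t)) (z \<mu>) $ i = \<rho> ^ (s * t) * g \<mu> t"
          using eigencone_power_action[OF A F(2)[OF \<mu>] z[OF \<mu>], of t] \<rho>
          by (simp add: g_def power_divide power_mult)
      qed
      also have "\<dots> = \<rho> ^ (s * t) * alg_sum alg (\<lambda>\<mu>. g \<mu> t) F"
        using \<rho> F(1) by (intro alg_sum_mult) auto
      finally show ?thesis using \<rho> by simp
    qed
    have lim: "(g \<mu> \<longlongrightarrow> (if \<mu> = \<rho> then z \<mu> $ i else 0)) sequentially" if \<mu>: "\<mu> \<in> F" for \<mu>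
    proof -
      consider "\<mu> < \<rho>" | "\<mu> = \<rho>" | "\<rho> < \<mu>" by linarith
      then show ?thesis
      proof cases
        case 1
        then have "(\<mu> / \<rho>) ^ s < 1" using F(2)[OF \<mu>] \<rho> s by (intro power_less_one_iff[THEN iffD2]) auto
        then have "(\<lambda>t. ((\<mu> / \<rho>) ^ s) ^ t) \<longlonglongrightarrow> 0"
          using F(2)[OF \<mu>] \<rho> by (intro LIMSEQ_power_zero) auto
        from tendsto_mult_right[OF this, of "z \<mu> $ i"] show ?thesis using 1 by (simp add: g_def[abs_def])
      next
        case 2
        then show ?thesis using \<rho> by (simp add: g_def[abs_def])
      next
        case 3
        then have gt: "1 < (\<mu> / \<rho>) ^ s" using \<rho> s by (intro one_less_power) auto
        have "z \<mu> $ i = 0"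
        proof (rule ccontr)
          assume "z \<mu> $ i \<noteq> 0"
          then have pos: "0 < z \<mu> $ i" using z_nn[OF \<mu>, of i] by simp
          obtain t where "x $ i / z \<mu> $ i < ((\<mu> / \<rho>) ^ s) ^ t" using real_arch_pow[OF gt] by blast
          then have "x $ i < g \<mu> t" using pos by (simp add: g_def pos_divide_less_eq)
          moreover have "g \<mu> t \<le> x $ i"
            unfolding eq[of t, symmetric]
            by (rule alg_sum_upper[OF F(1) \<mu>, where f = "\<lambda>\<mu>. g \<mu> t"]) (rule g_nn)
          ultimately show False by simp
        qed
        then show ?thesis using 3 by (simp add: g_def[abs_def])
      qed
    qed
    have "(\<lambda>t. alg_sum alg (\<lambda>\<mu>. g \<mu> t) F)
        \<longlonglongrightarrow> alg_sum alg (\<lambda>\<mu>. if \<mu> = \<rho> then z \<mu> $ i else 0) F"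
      by (rule alg_sum_tendsto[OF F(1) lim])
    then have "x $ i = alg_sum alg (\<lambda>\<mu>. if \<mu> = \<rho> then z \<mu> $ i else 0) F"
      unfolding eq by (simp only: LIMSEQ_const_iff)
    also have "\<dots> = alg_sum alg (\<lambda>\<mu>. if \<mu> = \<rho> then z \<mu> $ i else 0) (F \<inter> {\<rho>})"
      by (rule alg_sum_mono_neutral) (auto simp: F(1))
    also have "\<dots> = (if \<rho> \<in> F then z \<rho> else 0) $ i"
      using z_nn by (auto simp: alg_sum_singleton)
    finally show ?thesis .
  qed
  then show ?thesis by (simp add: vec_eq_iff)
qed

text \<open>
  Each value is determined by a set of classes or by a graph on the finite index type.
  Finiteness matters because the least common multiple of an infinite set of numbers is
  \<open>0\<close>.
\<close>

lemma finite_sigma_num_values: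
  fixes A :: "real^'n^'n"
  shows "finite (sigma_num alg A ` X)"
proof (cases alg)
  case Nonneg_Algebra
  have "sigma_num alg A ` X \<subseteq> range (\<lambda>M. Lcm {sc_cyclicity (Restr (mat_edges A) \<nu>) | \<nu>. \<nu> \<in> M})"
    unfolding Nonneg_Algebra sigma_num.simps
    by (intro image_subsetI range_eqI[of _ _ "{\<nu>. spectral_class Nonneg_Algebra A \<rho> \<nu>}" for \<rho>]) simp
  then show ?thesis by (rule finite_subset) simp
next
  case Max_Algebra
  have "sigma_num alg A \<rho> \<in> range (\<lambda>(V :: 'n set, E). cyclicity V E)" for \<rho>
    unfolding Max_Algebra sigma_num.simps
    by (rule range_eqI[of _ _ "(critical_nodes (scaled_submatrix A \<rho>), critical_edges (scaled_submatrix A \<rho>))"]) simp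
  then have "sigma_num alg A ` X \<subseteq> range (\<lambda>(V :: 'n set, E). cyclicity V E)" by blast
  then show ?thesis by (rule finite_subset) simp
qed

theorem theorem2:
  fixes alg :: algebra and A :: "real^'n^'n"
  assumes "nonneg_mat A"
  shows "(\<forall>\<rho>\<in>nonzero_eigvals alg A.
            is_period (\<lambda>k. eigencone alg (alg_power alg A k) (\<rho> ^ k)) (sigma_num alg A \<rho>) \<and>
            (\<forall>k\<ge>1. eigencone alg (alg_power alg A k) (\<rho> ^ k)
                     \<subseteq> eigencone alg (alg_power alg A (sigma_num alg A \<rho>)) (\<rho> ^ sigma_num alg A \<rho>))) \<and>
         is_period (\<lambda>k. eigencone_sum alg (alg_power alg A k)) (sigma_all alg A) \<and>
         (\<forall>k\<ge>1. eigencone_sum alg (alg_power alg A k)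
                  \<subseteq> eigencone_sum alg (alg_power alg A (sigma_all alg A)))"
proof -
  note A = \<open>nonneg_mat A\<close>
  let ?V = "\<lambda>\<rho> k. eigencone alg (alg_power alg A k) (\<rho> ^ k)"
  let ?W = "\<lambda>k. eigencone_sum alg (alg_power alg A k)"
  let ?\<Lambda> = "nonzero_eigvals alg A" and ?\<sigma> = "sigma_num alg A" and ?s = "sigma_all alg A"
  note pos = nonzero_eigvals_pos[of _ alg A]
  have "is_period (?V \<rho>) (?\<sigma> \<rho>) \<and> (\<forall>k\<ge>1. ?V \<rho> k \<subseteq> ?V \<rho> (?\<sigma> \<rho>))" if \<rho>: "\<rho> \<in> ?\<Lambda>" for \<rho>
  proof -
    have "periodic_with (?V \<rho>) (?\<sigma> \<rho>)"
      using sigma_num_pos[OF A pos[OF \<rho>]] eigencone_power_periodic[OF A pos[OF \<rho>]]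
      by (simp add: periodic_with_def)
    moreover have "?\<sigma> \<rho> \<le> q" if q: "periodic_with (?V \<rho>) q" for q
    proof -
      have "?V \<rho> (?\<sigma> \<rho>) = ?V \<rho> (?\<sigma> \<rho> + q)"
        using q sigma_num_pos[OF A pos[OF \<rho>], of alg] by (simp add: periodic_with_def)
      then have "?\<sigma> \<rho> dvd q" by (intro sigma_num_dvd_period[OF A pos[OF \<rho>] dvd_refl]) simp
      then show ?thesis using q by (auto simp: periodic_with_def intro: dvd_imp_le)
    qed
    ultimately show ?thesis
      using eigencone_power_subset[OF A pos[OF \<rho>]] by (simp add: is_period_def)
  qed
  moreover have "is_period ?W ?s \<and> (\<forall>k\<ge>1. ?W k \<subseteq> ?W ?s)"
  proof -
    have dvd: "?\<sigma> \<rho> dvd ?s" if "\<rho> \<in> ?\<Lambda>" for \<rho> using that by (simp add: sigma_all_def)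
    have "?s \<noteq> 0"
      unfolding sigma_all_def using sigma_num_pos[OF A pos, of _ alg] finite_sigma_num_values
      by (subst Lcm_0_iff) force+
    then have s: "1 \<le> ?s" by simp
    have "?W k \<subseteq> ?W ?s" if "1 \<le> k" for k
      by (rule eigencone_sum_power_mono[OF A that s eigencone_power_subset[OF A pos that dvd]])
    moreover have "?W (k + ?s) = ?W k" if "1 \<le> k" for k
      using eigencone_power_periodic[OF A pos that dvd] that
      by (intro equalityI eigencone_sum_power_mono[OF A]) auto
    moreover have "?s \<le> q" if q: "periodic_with ?W q" for q
    proof -
      have "?\<sigma> \<rho> dvd q" if \<rho>: "\<rho> \<in> ?\<Lambda>" for \<rho>
      proof (rule sigma_num_dvd_period[OF A pos[OF \<rho>] dvd[OF \<rho>]])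
        show "?V \<rho> ?s \<subseteq> ?V \<rho> (?s + q)"
        proof
          fix x assume x: "x \<in> ?V \<rho> ?s"
          then have "x \<in> ?W (?s + q)"
            using eigencone_subset_sum[OF A s \<rho>] q s by (auto simp: periodic_with_def)
          moreover have sq: "1 \<le> ?s + q" using s by simp
          ultimately obtain F z where F: "finite F" "F \<subseteq> ?\<Lambda>" "\<And>\<mu>. \<mu> \<in> F \<Longrightarrow> z \<mu> \<in> ?V \<mu> (?s + q)"
            "x = (\<chi> i. alg_sum alg (\<lambda>\<mu>. z \<mu> $ i) F)"
            unfolding mem_eigencone_sum_power_iff[OF A sq] by blast
          have "x = (if \<rho> \<in> F then z \<rho> else 0)"
          proof (rule eigencone_sum_component[OF A s pos[OF \<rho>] x F(1) _ _ F(4)])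
            show "0 < \<mu>" if "\<mu> \<in> F" for \<mu> using that F(2) pos by blast
            show "z \<mu> \<in> ?V \<mu> ?s" if \<mu>: "\<mu> \<in> F" for \<mu>
            proof -
              have "\<mu> \<in> ?\<Lambda>" using \<mu> F(2) by blast
              from eigencone_power_subset[OF A pos[OF this] sq dvd[OF this]] show ?thesis using F(3)[OF \<mu>] by blast
            qed
          qed
          moreover have "0 \<in> ?V \<rho> (?s + q)"
            by (simp add: eigencone_def nonneg_vec_def vec_eq_iff mult_vec_nth)
          ultimately show "x \<in> ?V \<rho> (?s + q)" using F(3) by (auto split: if_splits)
        qed
      qed
      then have "?s dvd q" unfolding sigma_all_def by (auto intro: Lcm_least)
      then show ?thesis using q by (auto simp: periodic_with_def intro: dvd_imp_le)
    qed
    ultimately show ?thesis using s by (simp add: is_period_def periodic_with_def)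
  qed
  ultimately show ?thesis by blast
qed

end
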